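(* Let $(\Sigma,\mu)$ be a Riemann surface with a $C^2$ conformal metric, $(M,\nu)$ an $n$-manifold, $n\ge 3$, with a $C^2$ Riemannian metric, and $f:(\Sigma,\mu)\to(M,\nu)$ an admissible harmonic map whose Hopf differential $\Phi$ is not identically zero. Let $p_1,p_2\in\Sigma$ and suppose $p_1\sim' p_2$. Then $p_1\sim p_2$.
   Context: Manifolds are without boundary. $f$ is harmonic if $\mathrm{trace}_\mu\nabla df=0$, and admissible if its image is not contained in a geodesic. The Hopf differential is the holomorphic quadratic differential $\Phi=\langle f_z,f_z\rangle_{f^*\nu}\,dz^2$ in local holomorphic coordinates $z$, where $f_z=df(\partial/\partial z)$ and the metric is extended complex-bilinearly. $\mathcal{Z}$ is the (discrete) zero set of $\Phi$. The relation $\sim$ on $\Sigma$: (1) if $p_1,p_2\notin\mathcal{Z}$, then $p_1\sim p_2$ if there exist open sets $\Omega_i\ni p_i$ and a holomorphic diffeomorphism $h:\Omega_1\to\Omega_2$ with $h(p_1)=p_2$ and $f=f\circ h$ on $\Omega_1$. (2) If at least one of $p_1,p_2$ is in $\mathcal{Z}$, then $p_1\sim p_2$ if for any pair of neighbourhoods $\Omega_i$ of $p_i$ there are smaller neighbourhoods $\Omega_i'\subset\Omega_i$ of $p_i$, with $\Omega_i'\setminus\{p_i\}$ disjoint from $\mathcal{Z}$, such that each $q_1\in\Omega_1'\setminus\{p_1\}$ satisfies $q_1\sim q_2$ for some $q_2\in\Omega_2'\setminus\{p_2\}$, and each $q_2\in\Omega_2'\setminus\{p_2\}$ satisfies $q_2\sim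 q_1$ for some $q_1\in\Omega_1'\setminus\{p_1\}$. The relation $\sim'$: $p_1\sim' p_2$ if for every pair of neighbourhoods $U_i$ of $p_i$ there exist $p_i'\in U_i$ with $p_1'\sim p_2'$. *)

theory Defs
  imports "HOL-Analysis.Analysis"
begin

section \<open>Manifolds\<close>

text \<open>For open \<open>S\<close> this is the usual class \<open>C\<^sup>k\<close>; it is used on open sets only.\<close>

primrec Ck_on :: "nat \<Rightarrow> ('e::real_normed_vector \<Rightarrow> 'h::real_normed_vector) \<Rightarrow> 'e set \<Rightarrow> bool"
  where
    "Ck_on 0 F S \<longleftrightarrow> continuous_on S F"
  | "Ck_on (Suc k) F S \<longleftrightarrow>
       (\<forall>x\<in>S. F differentiable (at x)) \<and>
       (\<forall>v. Ck_on k (\<lambda>x. frechet_derivative F (at x) v) S)"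

text \<open>A chart is a domain together with a coordinate function; the values of the coordinate
  function outside the domain are irrelevant.\<close>

type_synonym ('a, 'e) chart = "'a set \<times> ('a \<Rightarrow> 'e)"

definition is_chart :: "'a topology \<Rightarrow> ('a, 'e::euclidean_space) chart \<Rightarrow> bool"
  where "is_chart X c \<longleftrightarrow>
    openin X (fst c) \<and> open (snd c ` fst c) \<and>
    homeomorphic_map (subtopology X (fst c)) (top_of_set (snd c ` fst c)) (snd c)"

definition chart_inv :: "('a, 'e) chart \<Rightarrow> 'e \<Rightarrow> 'a"
  where "chart_inv c = inv_into (fst c) (snd c)"

definition local_rep :: "('a, 'e) chart \<Rightarrow> ('b, 'h) chart \<Rightarrow> ('a \<Rightarrow> 'b) \<Rightarrow> 'e \<Rightarrow> 'h"
  where "local_rep c d f = snd d \<circ> f \<circ> chart_inv c"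

text \<open>The part of the coordinate domain of \<open>c\<close> on which \<open>f\<close>, restricted to \<open>W\<close>, is
  represented in the chart \<open>d\<close> of the target.\<close>

definition local_dom ::
    "('a, 'e) chart \<Rightarrow> ('b, 'h) chart \<Rightarrow> ('a \<Rightarrow> 'b) \<Rightarrow> 'a set \<Rightarrow> 'e set"
  where "local_dom c d f W = snd c ` {p \<in> fst c \<inter> W. f p \<in> fst d}"

text \<open>The dimension is that of the model space \<open>'e\<close>.\<close>

definition topological_manifold ::
    "'a topology \<Rightarrow> ('a, 'e::euclidean_space) chart set \<Rightarrow> bool"
  where "topological_manifold X A \<longleftrightarrow>
    Hausdorff_space X \<and> second_countable X \<and>
    (\<forall>c\<in>A. is_chart X c) \<and> (\<Union>c\<in>A. fst c) = topspace X"

definition smooth_manifold :: "'a topology \<Rightarrow> ('a, 'e::euclidean_space) chart set \<Rightarrow> bool"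
  where "smooth_manifold X A \<longleftrightarrow>
    topological_manifold X A \<and>
    (\<forall>c\<in>A. \<forall>d\<in>A. \<forall>k. Ck_on k (local_rep c d id) (local_dom c d id UNIV))"

definition riemann_surface :: "'a topology \<Rightarrow> ('a, complex) chart set \<Rightarrow> bool"
  where "riemann_surface X A \<longleftrightarrow>
    topological_manifold X A \<and> connected_space X \<and>
    (\<forall>c\<in>A. \<forall>d\<in>A. local_rep c d id holomorphic_on local_dom c d id UNIV)"


section \<open>Metrics and connections\<close>

text \<open>A Riemannian metric \<open>g\<close> is given by its expressions in the charts of the atlas:
  \<open>g c x u v\<close> is the inner product of the vectors with components \<open>u\<close> and \<open>v\<close> in
  the chart \<open>c\<close>, at the point with coordinates \<open>x\<close>. The last condition is the
  transformation rule of a covariant 2-tensor.\<close>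

type_synonym ('a, 'e) metric = "('a, 'e) chart \<Rightarrow> 'e \<Rightarrow> 'e \<Rightarrow> 'e \<Rightarrow> real"

definition C2_riemannian_metric ::
    "('a, 'e::euclidean_space) chart set \<Rightarrow> ('a, 'e) metric \<Rightarrow> bool"
  where "C2_riemannian_metric A g \<longleftrightarrow>
    (\<forall>c\<in>A. \<forall>x \<in> snd c ` fst c.
       bilinear (g c x) \<and> (\<forall>u v. g c x u v = g c x v u) \<and> (\<forall>u. u \<noteq> 0 \<longrightarrow> g c x u u > 0)) \<and>
    (\<forall>c\<in>A. \<forall>u v. Ck_on 2 (\<lambda>x. g c x u v) (snd c ` fst c)) \<and>
    (\<forall>c\<in>A. \<forall>d\<in>A. \<forall>p \<in> fst c \<inter> fst d. \<forall>u v.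
       g c (snd c p) u v =
       g d (snd d p) (frechet_derivative (local_rep c d id) (at (snd c p)) u)
                     (frechet_derivative (local_rep c d id) (at (snd c p)) v))"

definition C2_conformal_metric ::
    "('a, complex) chart set \<Rightarrow> ('a, complex) metric \<Rightarrow> bool"
  where "C2_conformal_metric A \<mu> \<longleftrightarrow>
    C2_riemannian_metric A \<mu> \<and>
    (\<forall>c\<in>A. \<forall>z \<in> snd c ` fst c. \<exists>\<rho>>0. \<forall>u v. \<mu> c z u v = \<rho> * (u \<bullet> v))"

text \<open>The vector dual to a covector with respect to an inner product.\<close>

definition sharp :: "('e::euclidean_space \<Rightarrow> 'e \<Rightarrow> real) \<Rightarrow> ('e \<Rightarrow> real) \<Rightarrow> 'e"
  where "sharp G \<alpha> = (THE w. \<forall>v. G w v = \<alpha> v)"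

text \<open>\<open>\<Sum>i j. G\<^sup>i\<^sup>j H\<^sub>i\<^sub>j\<close>, because \<open>sharp G ((\<bullet>) e\<^sub>j) = \<Sum>i. G\<^sup>i\<^sup>j e\<^sub>i\<close>.\<close>

definition metric_trace ::
    "('e::euclidean_space \<Rightarrow> 'e \<Rightarrow> real) \<Rightarrow> ('e \<Rightarrow> 'e \<Rightarrow> 'h::real_vector) \<Rightarrow> 'h"
  where "metric_trace G H = (\<Sum>b\<in>Basis. H (sharp G ((\<bullet>) b)) b)"

text \<open>The Levi-Civita connection in a chart: \<open>christoffel G x u v\<close> has the components
  \<open>\<Gamma>\<^sup>k\<^sub>i\<^sub>j u\<^sup>i v\<^sup>j\<close>.\<close>

definition christoffel ::
    "('e::euclidean_space \<Rightarrow> 'e \<Rightarrow> 'e \<Rightarrow> real) \<Rightarrow> 'e \<Rightarrow> 'e \<Rightarrow> 'e \<Rightarrow> 'e"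
  where "christoffel G x u v = sharp (G x) (\<lambda>w.
    (frechet_derivative (\<lambda>y. G y v w) (at x) u
     + frechet_derivative (\<lambda>y. G y u w) (at x) v
     - frechet_derivative (\<lambda>y. G y u v) (at x) w) / 2)"

text \<open>\<open>\<nabla>dF\<close> for \<open>F\<close> between coordinate domains with metrics \<open>G\<close> and \<open>K\<close>, where
  \<open>\<nabla>\<close> is the connection on \<open>T\<^sup>*\<Sigma> \<otimes> F\<^sup>*TM\<close> induced by the two
  Levi-Civita connections.\<close>

definition nabla_d ::
    "('e::euclidean_space \<Rightarrow> 'e \<Rightarrow> 'e \<Rightarrow> real) \<Rightarrow>
     ('h::euclidean_space \<Rightarrow> 'h \<Rightarrow> 'h \<Rightarrow> real) \<Rightarrow>
     ('e \<Rightarrow> 'h) \<Rightarrow> 'e \<Rightarrow> 'e \<Rightarrow> 'e \<Rightarrow> 'h"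
  where "nabla_d G K F x u v =
    frechet_derivative (\<lambda>y. frechet_derivative F (at y) v) (at x) u
    - frechet_derivative F (at x) (christoffel G x u v)
    + christoffel K (F x) (frechet_derivative F (at x) u) (frechet_derivative F (at x) v)"


section \<open>Harmonic maps, geodesics and the Hopf differential\<close>

definition C2_map ::
    "'a topology \<Rightarrow> ('a, 'e::euclidean_space) chart set \<Rightarrow>
     'b topology \<Rightarrow> ('b, 'h::euclidean_space) chart set \<Rightarrow> ('a \<Rightarrow> 'b) \<Rightarrow> bool"
  where "C2_map X A Y B f \<longleftrightarrow>
    continuous_map X Y f \<and>
    (\<forall>c\<in>A. \<forall>d\<in>B. Ck_on 2 (local_rep c d f) (local_dom c d f UNIV))"

definition harmonic_map ::
    "'a topology \<Rightarrow> ('a, 'e::euclidean_space) chart set \<Rightarrow> ('a, 'e) metric \<Rightarrow>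
     'b topology \<Rightarrow> ('b, 'h::euclidean_space) chart set \<Rightarrow> ('b, 'h) metric \<Rightarrow>
     ('a \<Rightarrow> 'b) \<Rightarrow> bool"
  where "harmonic_map X A \<mu> Y B \<nu> f \<longleftrightarrow>
    C2_map X A Y B f \<and>
    (\<forall>c\<in>A. \<forall>d\<in>B. \<forall>x \<in> local_dom c d f UNIV.
       metric_trace (\<mu> c x) (nabla_d (\<mu> c) (\<nu> d) (local_rep c d f) x) = 0)"

text \<open>Geodesics are parametrised on arbitrary open intervals, since \<open>(M, \<nu>)\<close> need not be
  complete.\<close>

definition geodesic ::
    "'b topology \<Rightarrow> ('b, 'h::euclidean_space) chart set \<Rightarrow> ('b, 'h) metric \<Rightarrow>
     real set \<Rightarrow> (real \<Rightarrow> 'b) \<Rightarrow> bool"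
  where "geodesic Y B \<nu> I \<gamma> \<longleftrightarrow>
    is_interval I \<and> open I \<and> continuous_map (top_of_set I) Y \<gamma> \<and>
    (\<forall>d\<in>B. Ck_on 2 (snd d \<circ> \<gamma>) {t\<in>I. \<gamma> t \<in> fst d} \<and>
      (\<forall>t\<in>I. \<gamma> t \<in> fst d \<longrightarrow>
         vector_derivative (\<lambda>s. vector_derivative (snd d \<circ> \<gamma>) (at s)) (at t)
         + christoffel (\<nu> d) (snd d (\<gamma> t))
             (vector_derivative (snd d \<circ> \<gamma>) (at t)) (vector_derivative (snd d \<circ> \<gamma>) (at t))
         = 0))"

definition admissible ::
    "'a topology \<Rightarrow> 'b topology \<Rightarrow> ('b, 'h::euclidean_space) chart set \<Rightarrow> ('b, 'h) metric \<Rightarrow>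
     ('a \<Rightarrow> 'b) \<Rightarrow> bool"
  where "admissible X Y B \<nu> f \<longleftrightarrow>
    \<not> (\<exists>I \<gamma>. geodesic Y B \<nu> I \<gamma> \<and> f ` topspace X \<subseteq> \<gamma> ` I)"

text \<open>A vector \<open>u + \<i>w\<close> of the complexification of a real vector space is represented by
  the pair \<open>(u, w)\<close>. Below are the complex-bilinear extension of a real bilinear form, the
  complex-linear extension of a real linear map, and
  \<open>\<partial>/\<partial>z = (\<partial>/\<partial>x - \<i> \<partial>/\<partial>y) / 2\<close>; the real tangent vectors
  \<open>\<partial>/\<partial>x\<close> and \<open>\<partial>/\<partial>y\<close> are the elements \<open>1\<close> and \<open>\<i>\<close> of the model
  space \<open>complex\<close>.\<close>

definition cbilinear_ext :: "('h \<Rightarrow> 'h \<Rightarrow> real) \<Rightarrow> 'h \<times> 'h \<Rightarrow> 'h \<times> 'h \<Rightarrow> complex"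
  where "cbilinear_ext G U V =
    Complex (G (fst U) (fst V) - G (snd U) (snd V)) (G (fst U) (snd V) + G (snd U) (fst V))"

definition clinear_ext :: "('e \<Rightarrow> 'h) \<Rightarrow> 'e \<times> 'e \<Rightarrow> 'h \<times> 'h"
  where "clinear_ext L U = (L (fst U), L (snd U))"

definition d_dz :: "complex \<times> complex"
  where "d_dz = (1 / 2, - (\<i> / 2))"

text \<open>The coefficient of \<open>dz\<^sup>2\<close> in \<open>\<Phi>\<close> in the holomorphic chart \<open>c\<close>, at the point
  with coordinate \<open>z\<close>. Since \<open>\<nu>\<close> is a tensor, it does not depend on the chart chosen in
  the target.\<close>

definition hopf ::
    "('b, 'h::euclidean_space) chart set \<Rightarrow> ('b, 'h) metric \<Rightarrow> ('a \<Rightarrow> 'b) \<Rightarrow>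
     ('a, complex) chart \<Rightarrow> complex \<Rightarrow> complex"
  where "hopf B \<nu> f c z =
    (let d = (SOME d. d \<in> B \<and> f (chart_inv c z) \<in> fst d);
         F = local_rep c d f;
         f_z = clinear_ext (frechet_derivative F (at z)) d_dz
     in cbilinear_ext (\<nu> d (F z)) f_z f_z)"

text \<open>The set \<open>\<Z>\<close> of zeros of \<open>\<Phi>\<close>.\<close>

definition hopf_zeros ::
    "('a, complex) chart set \<Rightarrow> ('b, 'h::euclidean_space) chart set \<Rightarrow> ('b, 'h) metric \<Rightarrow>
     ('a \<Rightarrow> 'b) \<Rightarrow> 'a set"
  where "hopf_zeros A B \<nu> f = {p. \<exists>c\<in>A. p \<in> fst c \<and> hopf B \<nu> f c (snd c p) = 0}"


section \<open>The relations\<close>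

definition holomorphic_between ::
    "('a, complex) chart set \<Rightarrow> 'a set \<Rightarrow> ('a \<Rightarrow> 'a) \<Rightarrow> bool"
  where "holomorphic_between A W h \<longleftrightarrow>
    (\<forall>c\<in>A. \<forall>d\<in>A. local_rep c d h holomorphic_on local_dom c d h W)"

definition holomorphic_diffeo ::
    "'a topology \<Rightarrow> ('a, complex) chart set \<Rightarrow> 'a set \<Rightarrow> 'a set \<Rightarrow> ('a \<Rightarrow> 'a) \<Rightarrow> bool"
  where "holomorphic_diffeo X A W\<^sub>1 W\<^sub>2 h \<longleftrightarrow>
    homeomorphic_map (subtopology X W\<^sub>1) (subtopology X W\<^sub>2) h \<and>
    holomorphic_between A W\<^sub>1 h \<and> holomorphic_between A W\<^sub>2 (inv_into W\<^sub>1 h)"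

text \<open>The relation \<open>\<sim>\<close> between two points outside \<open>\<Z>\<close>.\<close>

definition sim_regular ::
    "'a topology \<Rightarrow> ('a, complex) chart set \<Rightarrow>
     ('b, 'h::euclidean_space) chart set \<Rightarrow> ('b, 'h) metric \<Rightarrow> ('a \<Rightarrow> 'b) \<Rightarrow> 'a \<Rightarrow> 'a \<Rightarrow> bool"
  where "sim_regular X A B \<nu> f p\<^sub>1 p\<^sub>2 \<longleftrightarrow>
    p\<^sub>1 \<notin> hopf_zeros A B \<nu> f \<and> p\<^sub>2 \<notin> hopf_zeros A B \<nu> f \<and>
    (\<exists>W\<^sub>1 W\<^sub>2 h. openin X W\<^sub>1 \<and> p\<^sub>1 \<in> W\<^sub>1 \<and> openin X W\<^sub>2 \<and> p\<^sub>2 \<in> W\<^sub>2 \<and>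
       holomorphic_diffeo X A W\<^sub>1 W\<^sub>2 h \<and> h p\<^sub>1 = p\<^sub>2 \<and> (\<forall>q\<in>W\<^sub>1. f q = f (h q)))"

text \<open>In the second case all points \<open>q\<^sub>1, q\<^sub>2\<close> occurring lie outside \<open>\<Z>\<close>, so the relation
  between them is that of the first case.\<close>

definition sim ::
    "'a topology \<Rightarrow> ('a, complex) chart set \<Rightarrow>
     ('b, 'h::euclidean_space) chart set \<Rightarrow> ('b, 'h) metric \<Rightarrow> ('a \<Rightarrow> 'b) \<Rightarrow> 'a \<Rightarrow> 'a \<Rightarrow> bool"
  where "sim X A B \<nu> f p\<^sub>1 p\<^sub>2 \<longleftrightarrow>
    (if p\<^sub>1 \<notin> hopf_zeros A B \<nu> f \<and> p\<^sub>2 \<notin> hopf_zeros A B \<nu> f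
     then sim_regular X A B \<nu> f p\<^sub>1 p\<^sub>2
     else \<forall>W\<^sub>1 W\<^sub>2. openin X W\<^sub>1 \<and> p\<^sub>1 \<in> W\<^sub>1 \<and> openin X W\<^sub>2 \<and> p\<^sub>2 \<in> W\<^sub>2 \<longrightarrow>
       (\<exists>V\<^sub>1 V\<^sub>2. openin X V\<^sub>1 \<and> p\<^sub>1 \<in> V\<^sub>1 \<and> V\<^sub>1 \<subseteq> W\<^sub>1 \<and> openin X V\<^sub>2 \<and> p\<^sub>2 \<in> V\<^sub>2 \<and> V\<^sub>2 \<subseteq> W\<^sub>2 \<and>
          (V\<^sub>1 - {p\<^sub>1}) \<inter> hopf_zeros A B \<nu> f = {} \<and> (V\<^sub>2 - {p\<^sub>2}) \<inter> hopf_zeros A B \<nu> f = {} \<and>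
          (\<forall>q\<^sub>1 \<in> V\<^sub>1 - {p\<^sub>1}. \<exists>q\<^sub>2 \<in> V\<^sub>2 - {p\<^sub>2}. sim_regular X A B \<nu> f q\<^sub>1 q\<^sub>2) \<and>
          (\<forall>q\<^sub>2 \<in> V\<^sub>2 - {p\<^sub>2}. \<exists>q\<^sub>1 \<in> V\<^sub>1 - {p\<^sub>1}. sim_regular X A B \<nu> f q\<^sub>2 q\<^sub>1)))"

definition sim' ::
    "'a topology \<Rightarrow> ('a, complex) chart set \<Rightarrow>
     ('b, 'h::euclidean_space) chart set \<Rightarrow> ('b, 'h) metric \<Rightarrow> ('a \<Rightarrow> 'b) \<Rightarrow> 'a \<Rightarrow> 'a \<Rightarrow> bool"
  where "sim' X A B \<nu> f p\<^sub>1 p\<^sub>2 \<longleftrightarrow>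
    (\<forall>U\<^sub>1 U\<^sub>2. openin X U\<^sub>1 \<and> p\<^sub>1 \<in> U\<^sub>1 \<and> openin X U\<^sub>2 \<and> p\<^sub>2 \<in> U\<^sub>2 \<longrightarrow>
       (\<exists>q\<^sub>1\<in>U\<^sub>1. \<exists>q\<^sub>2\<in>U\<^sub>2. sim X A B \<nu> f q\<^sub>1 q\<^sub>2))"

end

theory Submission
  imports Defs "HOL-Complex_Analysis.Complex_Analysis"
begin

text \<open>Near every point, also a zero of order \<open>m\<close> of \<open>\<Phi>\<close>, the Hopf differential is \<open>dw\<^sup>2\<close> for a
  multivalued coordinate \<open>w\<close>, a power with exponent \<open>(m + 2) / 2\<close> of a local coordinate. In
  the single-valued parameter \<open>s\<close> with \<open>w = exp s\<close>, a germ \<open>h\<close> with \<open>f = f \<circ> h\<close> from a point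
  near \<open>p\<^sub>1\<close> to a point near \<open>p\<^sub>2\<close> preserves \<open>\<Phi>\<close>, so it has the form
  \<open>exp s \<mapsto> \<plusminus>exp s + a\<close>, where \<open>a\<close> is small if the two points are close to \<open>p\<^sub>1\<close> and \<open>p\<^sub>2\<close>. By
  unique continuation \<open>f = f \<circ> h\<close> persists on a half-plane in \<open>s\<close> slit along the logarithmic
  branch cuts. Letting \<open>a\<close> tend to \<open>0\<close>, one sees that the two parametrizations of \<open>f\<close> differ
  by a translation \<open>s \<mapsto> s + \<i>\<pi>k\<close> near \<open>p\<^sub>1\<close> and \<open>p\<^sub>2\<close>, which gives \<open>p\<^sub>1 \<sim> p\<^sub>2\<close>.

  Unique continuation is proved directly, as the metrics are only \<open>C\<^sup>2\<close>: in dimension two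
  the difference \<open>u\<close> of two harmonic maps satisfies a first-order inequality for
  \<open>(u, u\<^sub>x - \<i> u\<^sub>y)\<close>, to which a Carleman inequality for \<open>\<partial>\<^sub>x + \<i> \<partial>\<^sub>y\<close> applies.\<close>

section \<open>A Carleman inequality on a cylinder\<close>

text \<open>The germs supplied by \<open>sim'\<close> live near points other than \<open>p1\<close>
  and \<open>p2\<close>, and their domains may shrink as these points move in, so they have no limit
  by themselves. Continuation removes this obstacle: all germs get the same half-plane as domain, up
  to slits that run to the left of the points with \<open>exp s = a\<close> and recede to
  \<open>Re s = -\<infinity>\<close> as \<open>a\<close> tends to 0. The number \<open>a\<close> is
  small because it is, up to sign, a sum or difference of the values of \<open>exp\<close> at a
  point and at its image. The integer \<open>k\<close> matters only modulo the period of the second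
  parametrization, so one \<open>k\<close> serves for arbitrarily small \<open>a\<close>, and
  continuity into a Hausdorff space gives the limit. As both centres sit at
  \<open>Re s = -\<infinity>\<close>, regular points and zeros of different orders are treated
  alike.

  The Carleman inequality is set on a cylinder because a function on a punctured disc becomes
  periodic in \<open>y\<close> under \<open>exp\<close>: no boundary terms arise in that direction,
  and a convex function of \<open>x\<close> alone serves as weight.\<close>

definition cylinder_C1 ::
    "real \<Rightarrow> real \<Rightarrow> real \<Rightarrow> (real \<Rightarrow> real \<Rightarrow> 'h::real_normed_vector) \<Rightarrow> (real \<Rightarrow> real \<Rightarrow> 'h) \<Rightarrow>
     (real \<Rightarrow> real \<Rightarrow> 'h) \<Rightarrow> bool"
  where "cylinder_C1 a b T p px py \<longleftrightarrow>
    (\<forall>x\<in>{a..b}. \<forall>y.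
       ((\<lambda>x. p x y) has_vector_derivative px x y) (at x within {a..b}) \<and>
       ((\<lambda>y. p x y) has_vector_derivative py x y) (at y) \<and>
       p x (y + T) = p x y \<and> px x (y + T) = px x y \<and> py x (y + T) = py x y) \<and>
    continuous_on ({a..b} \<times> UNIV) (\<lambda>z. p (fst z) (snd z)) \<and>
    continuous_on ({a..b} \<times> UNIV) (\<lambda>z. px (fst z) (snd z)) \<and>
    continuous_on ({a..b} \<times> UNIV) (\<lambda>z. py (fst z) (snd z))"

lemma cylinder_C1D:
  assumes "cylinder_C1 a b T p px py"
  shows "\<And>x y. x \<in> {a..b} \<Longrightarrow> ((\<lambda>x. p x y) has_vector_derivative px x y) (at x within {a..b})"
    and "\<And>x y. x \<in> {a..b} \<Longrightarrow> ((\<lambda>y. p x y) has_vector_derivative py x y) (at y)"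
    and "\<And>x y. x \<in> {a..b} \<Longrightarrow> p x (y + T) = p x y"
    and "\<And>x y. x \<in> {a..b} \<Longrightarrow> px x (y + T) = px x y"
    and "\<And>x y. x \<in> {a..b} \<Longrightarrow> py x (y + T) = py x y"
    and "continuous_on ({a..b} \<times> UNIV) (\<lambda>z. p (fst z) (snd z))"
    and "continuous_on ({a..b} \<times> UNIV) (\<lambda>z. px (fst z) (snd z))"
    and "continuous_on ({a..b} \<times> UNIV) (\<lambda>z. py (fst z) (snd z))"
  using assms unfolding cylinder_C1_def by blast+

section \<open>Integration over one period of the cylinder\<close>

abbreviation rect_integral :: "real \<Rightarrow> real \<Rightarrow> real \<Rightarrow> (real \<Rightarrow> real \<Rightarrow> real) \<Rightarrow> real"
  where "rect_integral a b T h \<equiv> integral (cbox (a, 0) (b, T)) (\<lambda>z. h (fst z) (snd z))"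

lemma rect_integrable:
  fixes h :: "real \<Rightarrow> real \<Rightarrow> real"
  assumes "continuous_on ({a..b} \<times> UNIV) (\<lambda>z. h (fst z) (snd z))"
  shows "(\<lambda>z. h (fst z) (snd z)) integrable_on cbox (a, 0) (b, T)"
  by (rule integrable_continuous, rule continuous_on_subset[OF assms]) (auto simp: cbox_Pair_eq)

lemma rect_integral_x:
  fixes h :: "real \<Rightarrow> real \<Rightarrow> real"
  assumes "a \<le> b" and "cylinder_C1 a b T h hx hy"
  shows "rect_integral a b T hx = integral {0..T} (\<lambda>y. h b y - h a y)"
proof -
  note D = cylinder_C1D[OF assms(2)]
  have c: "continuous_on (cbox (a, 0) (b, T)) (\<lambda>(x, y). hx x y)"
    using continuous_on_subset[OF D(7), of "cbox (a, 0) (b, T)"]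
    by (auto simp: cbox_Pair_eq case_prod_beta)
  have "rect_integral a b T hx = integral (cbox a b) (\<lambda>x. integral (cbox 0 T) (\<lambda>y. hx x y))"
    using integral_prod_continuous[OF c] by (simp add: case_prod_unfold)
  also have "\<dots> = integral (cbox 0 T) (\<lambda>y. integral (cbox a b) (\<lambda>x. hx x y))"
    by (rule integral_swap_continuous[OF c])
  also have "\<dots> = integral {0..T} (\<lambda>y. h b y - h a y)"
  proof -
    have "integral (cbox a b) (\<lambda>x. hx x y) = h b y - h a y" for y
      using fundamental_theorem_of_calculus[OF assms(1), of "\<lambda>x. h x y" "\<lambda>x. hx x y"] D(1)
      by (auto intro: integral_unique)
    then show ?thesis by simp
  qed
  finally show ?thesis .
qed

lemma integral_periodic_shift:
  fixes k :: "real \<Rightarrow> real"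
  assumes "continuous_on UNIV k" and per: "\<And>y. k (y + T) = k y" and "0 \<le> T" "0 \<le> t"
  shows "integral {0..T} (\<lambda>y. k (y + t)) = integral {0..T} k"
proof -
  have i: "k integrable_on {c..d}" for c d
    by (rule integrable_continuous_real) (rule continuous_on_subset[OF assms(1)], simp)
  have s: "integral {c..d} (\<lambda>y. k (y + t)) = integral {c + t..d + t} k" for c d t
    using integral_shift_Icc_real[of c d k t] by (simp add: o_def add.commute)
  have "integral {0..t} k + integral {t..T+t} k = integral {0..T+t} k"
    using assms by (intro Henstock_Kurzweil_Integration.integral_combine i) auto
  moreover have "integral {0..T} k + integral {T..T+t} k = integral {0..T+t} k"
    using assms by (intro Henstock_Kurzweil_Integration.integral_combine i) auto
  moreover have "integral {T..T+t} k = integral {0..t} k"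
    using s[of 0 t T] by (simp add: per add.commute)
  ultimately show ?thesis using s[of 0 T t] by simp
qed

lemma rect_integral_periodic_shift:
  fixes h :: "real \<Rightarrow> real \<Rightarrow> real"
  assumes "continuous_on ({a..b} \<times> UNIV) (\<lambda>z. h (fst z) (snd z))"
    and "\<And>x y. x \<in> {a..b} \<Longrightarrow> h x (y + T) = h x y" and "0 \<le> T" "0 \<le> t"
  shows "rect_integral a b T (\<lambda>x y. h x (y + t)) = rect_integral a b T h"
proof -
  have c: "continuous_on (cbox (a, 0) (b, T)) (\<lambda>z. h (fst z) (snd z))"
    by (rule continuous_on_subset[OF assms(1)]) (auto simp: cbox_Pair_eq)
  have c': "continuous_on (cbox (a, 0) (b, T)) (\<lambda>z. h (fst z) (snd z + t))"
    by (rule continuous_on_compose2[OF assms(1), of _ "\<lambda>z. (fst z, snd z + t)", simplified])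
      (auto simp: cbox_Pair_eq intro!: continuous_intros)
  have "rect_integral a b T (\<lambda>x y. h x (y + t))
      = integral (cbox a b) (\<lambda>x. integral (cbox 0 T) (\<lambda>y. h x (y + t)))"
    using integral_prod_continuous[OF c'] by simp
  also have "\<dots> = integral (cbox a b) (\<lambda>x. integral (cbox 0 T) (\<lambda>y. h x y))"
  proof (rule integral_cong)
    fix x assume x: "x \<in> cbox a b"
    have "continuous_on UNIV (h x)"
      by (rule continuous_on_compose2[OF assms(1), of _ "\<lambda>y. (x, y)", simplified])
        (use x in \<open>auto intro!: continuous_intros\<close>)
    then show "integral (cbox 0 T) (\<lambda>y. h x (y + t)) = integral (cbox 0 T) (\<lambda>y. h x y)"
      using integral_periodic_shift[of "h x" T t] assms x by simp
  qed
  also have "\<dots> = rect_integral a b T h"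
    using integral_prod_continuous[OF c] by simp
  finally show ?thesis .
qed

lemma cont_cyl_shift:
  assumes "continuous_on ({a..b} \<times> UNIV) (\<lambda>z. h (fst z) (snd z))"
  shows "continuous_on ({a..b} \<times> UNIV) (\<lambda>z. h (fst z) (snd z + (t::real)))"
  by (rule continuous_on_compose2[OF assms, of _ "\<lambda>z. (fst z, snd z + t)", simplified])
    (auto intro!: continuous_intros)

lemma has_vector_derivative_affine_arg:
  fixes g :: "real \<Rightarrow> 'h::real_normed_vector"
  assumes "(g has_vector_derivative g') (at (c + e * t))"
  shows "((\<lambda>t. g (c + e * t)) has_vector_derivative e *\<^sub>R g') (at t)"
proof -
  have "((\<lambda>t. c + e * t) has_vector_derivative e) (at t)"
    unfolding has_real_derivative_iff_has_vector_derivative[symmetric]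
    by (auto intro!: derivative_eq_intros)
  from vector_diff_chain_at[OF this assms] show ?thesis by (simp add: o_def)
qed

lemma cylinder_C1_shift:
  assumes "cylinder_C1 a b T p px py"
  shows "cylinder_C1 a b T (\<lambda>x y. p x (y + t)) (\<lambda>x y. px x (y + t)) (\<lambda>x y. py x (y + t))"
proof -
  note D = cylinder_C1D[OF assms]
  have d: "((\<lambda>y. p x (y + t)) has_vector_derivative py x (y + t)) (at y)" if "x \<in> {a..b}" for x y
    using has_vector_derivative_affine_arg[of "p x" _ t 1 y] D(2)[OF that] by (simp add: add.commute)
  have "g x (y + T + t) = g x (y + t)" if "\<And>x y. x \<in> {a..b} \<Longrightarrow> g x (y + T) = g x y" "x \<in> {a..b}"
    for g :: "real \<Rightarrow> real \<Rightarrow> 'a" and x y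
    using that(1)[of x "y + t"] that by (simp add: ac_simps)
  from this[of p] this[of px] this[of py] D show ?thesis
    unfolding cylinder_C1_def by (intro conjI ballI allI d cont_cyl_shift D) auto
qed

lemma cylinder_C1_inner:
  assumes "cylinder_C1 a b T p px py" "cylinder_C1 a b T q qx qy"
  shows "cylinder_C1 a b T (\<lambda>x y. p x y \<bullet> q x y) (\<lambda>x y. p x y \<bullet> qx x y + px x y \<bullet> q x y)
    (\<lambda>x y. p x y \<bullet> qy x y + py x y \<bullet> q x y)"
proof -
  note D = cylinder_C1D[OF assms(1)] and E = cylinder_C1D[OF assms(2)]
  note inn = bounded_bilinear.has_vector_derivative[OF bounded_bilinear_inner]
  show ?thesis
    unfolding cylinder_C1_def
    by (intro conjI ballI allI inn D E continuous_intros) (auto simp: D E)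
qed

text \<open>The derivative in \<open>t\<close> of \<open>\<integral> p(x, y + t) \<bullet> q\<^sub>x(x, y)\<close>, computed before and after
  moving \<open>\<partial>\<^sub>x\<close> and the shift from one factor to the other; this needs no second derivatives.\<close>

lemma rect_integral_jacobian:
  fixes p q :: "real \<Rightarrow> real \<Rightarrow> 'h::euclidean_space"
  assumes "a \<le> b" "0 \<le> T"
    and P: "cylinder_C1 a b T p px py" and Q: "cylinder_C1 a b T q qx qy"
    and z: "\<And>y. p a y = 0"
  shows "rect_integral a b T (\<lambda>x y. py x y \<bullet> qx x y - px x y \<bullet> qy x y)
    = - integral {0..T} (\<lambda>y. p b y \<bullet> qy b y)"
proof -
  note D = cylinder_C1D[OF P] and E = cylinder_C1D[OF Q]
  let ?A = "\<lambda>t. rect_integral a b T (\<lambda>x y. p x (y + t) \<bullet> qx x y)"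
  let ?B = "\<lambda>t. integral {0..T} (\<lambda>y. p b y \<bullet> q b (y - t))"
  let ?C = "\<lambda>t. rect_integral a b T (\<lambda>x y. px x y \<bullet> q x (y - t))"
  \<comment> \<open>Integrate the \<open>x\<close>-derivative of
    \<open>p x (y + t) \<bullet> q x y\<close>: the boundary term at \<open>a\<close> vanishes by
    \<open>z\<close>, and periodicity moves the shift onto \<open>q\<close> in the other
    terms.\<close>
  have eq: "?A t = ?B t - ?C t" if t: "0 \<le> t" for t
  proof -
    have 1: "rect_integral a b T (\<lambda>x y. p x (y + t) \<bullet> qx x y + px x (y + t) \<bullet> q x y)
      = integral {0..T} (\<lambda>y. p b (y + t) \<bullet> q b y - p a (y + t) \<bullet> q a y)"
      by (rule rect_integral_x[OF \<open>a \<le> b\<close> cylinder_C1_inner[OF cylinder_C1_shift[OF P] Q]])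
    have 2: "rect_integral a b T (\<lambda>x y. p x (y + t) \<bullet> qx x y + px x (y + t) \<bullet> q x y) =
      ?A t + rect_integral a b T (\<lambda>x y. px x (y + t) \<bullet> q x y)"
      by (intro integral_add rect_integrable continuous_intros cont_cyl_shift D E)
    have c: "continuous_on ({a..b} \<times> UNIV) (\<lambda>z. q (fst z) (snd z - t))"
      using cont_cyl_shift[OF E(6), of "-t"] by simp
    have pq: "q x (y + T - t) = q x (y - t)" if "x \<in> {a..b}" for x y
      using E(3)[OF that, of "y - t"] by (simp add: algebra_simps)
    have 3: "rect_integral a b T (\<lambda>x y. px x (y + t) \<bullet> q x y) = ?C t"
      using rect_integral_periodic_shift[of a b "\<lambda>x y. px x y \<bullet> q x (y - t)" T t] \<open>0 \<le> T\<close> t D E c pq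
      by (simp add: continuous_on_inner)
    have cb: "continuous_on UNIV (h b)" if "continuous_on ({a..b} \<times> UNIV) (\<lambda>z. h (fst z) (snd z))"
      for h :: "real \<Rightarrow> real \<Rightarrow> 'h"
      by (rule continuous_on_compose2[OF that, of _ "\<lambda>y. (b, y)", simplified])
        (use \<open>a \<le> b\<close> in \<open>auto intro!: continuous_intros\<close>)
    have 4: "integral {0..T} (\<lambda>y. p b (y + t) \<bullet> q b y) = ?B t"
      using integral_periodic_shift[of "\<lambda>y. p b y \<bullet> q b (y - t)" T t] \<open>0 \<le> T\<close> t \<open>a \<le> b\<close> D E pq[of b]
        cb[of p, OF D(6)] cb[of "\<lambda>x y. q x (y - t)", OF c]
      by (simp add: continuous_on_inner)
    show ?thesis using 1 2 3 4 z by simp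
  qed
  \<comment> \<open>The derivatives at 0 are taken within \<open>{0..1}\<close>, because
    \<open>eq\<close> is available for \<open>0 \<le> t\<close>; such one-sided derivatives are
    still unique.\<close>
  have dA: "(?A has_vector_derivative rect_integral a b T (\<lambda>x y. py x (y
      + 0) \<bullet> qx x y)) (at 0 within {0..1})"
  proof (rule leibniz_rule_vector_derivative)
    fix t and z :: "real \<times> real" assume "t \<in> {0..1::real}" and z: "z \<in> cbox (a, 0) (b, T)"
    have "((\<lambda>t. p (fst z) (snd z + t)) has_vector_derivative py (fst z) (snd z + t)) (at t)"
      using has_vector_derivative_affine_arg[of "p (fst z)" _ "snd z" 1 t] D(2)[of "fst z"] z
      by (auto simp: cbox_Pair_eq)
    from has_vector_derivative_at_within[OF bounded_bilinear.has_vector_derivative[OF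
        bounded_bilinear_inner this has_vector_derivative_const]]
    show "((\<lambda>t. p (fst z) (snd z + t) \<bullet> qx (fst z) (snd z)) has_vector_derivative
        py (fst z) (snd z + t) \<bullet> qx (fst z) (snd z)) (at t within {0..1})"
      by simp
  next
    fix t :: real
    show "(\<lambda>z. p (fst z) (snd z + t) \<bullet> qx (fst z) (snd z)) integrable_on cbox (a, 0) (b, T)"
      by (intro rect_integrable continuous_intros cont_cyl_shift D E)
  next
    have "continuous_on ({0..1} \<times> cbox (a, 0) (b, T)) (\<lambda>w. py (fst (snd w)) (snd (snd w) + fst w))"
      by (rule continuous_on_compose2[OF D(8), of _
          "\<lambda>w. (fst (snd w), snd (snd w) + fst w)", simplified])
        (auto simp: cbox_Pair_eq intro!: continuous_intros)
    moreover have "continuous_on ({0..1::real} \<times> cbox (a, 0) (b, T)) (\<lambda>w. qx (fst (snd w)) (snd (snd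
        w)))"
      by (rule continuous_on_compose2[OF E(7), of _ "\<lambda>w. snd w", simplified])
        (auto simp: cbox_Pair_eq intro!: continuous_intros)
    ultimately show "continuous_on ({0..1} \<times> cbox (a, 0) (b, T))
      (\<lambda>(t, z). py (fst z) (snd z + t) \<bullet> qx (fst z) (snd z))"
      by (simp add: case_prod_beta continuous_on_inner)
  qed auto
  have sub: "((\<lambda>t. q x (y - t)) has_vector_derivative - qy x (y - t)) (at t)" if "x \<in> {a..b}" for x y t
    using has_vector_derivative_affine_arg[of "q x" _ y "-1" t] E(2)[OF that] by simp
  have dC: "(?C has_vector_derivative rect_integral a b T (\<lambda>x y. px x y \<bullet> - qy x (y
      - 0))) (at 0 within {0..1})"
  proof (rule leibniz_rule_vector_derivative)
    fix t and z :: "real \<times> real" assume "t \<in> {0..1::real}" and z: "z \<in> cbox (a, 0) (b, T)"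
    have "((\<lambda>t. q (fst z) (snd z - t)) has_vector_derivative - qy (fst z) (snd z - t)) (at t)"
      using sub z by (auto simp: cbox_Pair_eq)
    from has_vector_derivative_at_within[OF bounded_bilinear.has_vector_derivative[OF
        bounded_bilinear_inner has_vector_derivative_const this]]
    show "((\<lambda>t. px (fst z) (snd z) \<bullet> q (fst z) (snd z - t)) has_vector_derivative
        px (fst z) (snd z) \<bullet> - qy (fst z) (snd z - t)) (at t within {0..1})"
      by simp
  next
    fix t :: real
    show "(\<lambda>z. px (fst z) (snd z) \<bullet> q (fst z) (snd z - t)) integrable_on cbox (a, 0) (b, T)"
      using cont_cyl_shift[OF E(6), of "-t"]
      by (intro rect_integrable continuous_intros D) simp
  next
    have "continuous_on ({0..1} \<times> cbox (a, 0) (b, T)) (\<lambda>w. qy (fst (snd w)) (snd (snd w) - fst w))"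
      by (rule continuous_on_compose2[OF E(8), of _
          "\<lambda>w. (fst (snd w), snd (snd w) - fst w)", simplified])
        (auto simp: cbox_Pair_eq intro!: continuous_intros)
    moreover have "continuous_on ({0..1::real} \<times> cbox (a, 0) (b, T)) (\<lambda>w. px (fst (snd w)) (snd (snd
        w)))"
      by (rule continuous_on_compose2[OF D(7), of _ "\<lambda>w. snd w", simplified])
        (auto simp: cbox_Pair_eq intro!: continuous_intros)
    ultimately show "continuous_on ({0..1} \<times> cbox (a, 0) (b, T))
      (\<lambda>(t, z). px (fst z) (snd z) \<bullet> - qy (fst z) (snd z - t))"
      by (simp add: case_prod_beta continuous_on_inner continuous_on_minus)
  qed auto
  have b: "b \<in> {a..b}" using \<open>a \<le> b\<close> by simp
  have cb: "continuous_on UNIV (h b)" if "continuous_on ({a..b} \<times> UNIV) (\<lambda>z. h (fst z) (snd z))"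
    for h :: "real \<Rightarrow> real \<Rightarrow> 'h"
    by (rule continuous_on_compose2[OF that, of _ "\<lambda>y. (b, y)", simplified])
      (use \<open>a \<le> b\<close> in \<open>auto intro!: continuous_intros\<close>)
  have dB: "(?B has_vector_derivative integral (cbox 0 T) (\<lambda>y. p b y \<bullet> - qy b (y
      - 0))) (at 0 within {0..1})"
    unfolding cbox_interval[symmetric]
  proof (rule leibniz_rule_vector_derivative)
    fix t y :: real
    from has_vector_derivative_at_within[OF bounded_bilinear.has_vector_derivative[OF
        bounded_bilinear_inner has_vector_derivative_const sub[OF b]]]
    show "((\<lambda>t. p b y \<bullet> q b (y - t)) has_vector_derivative
        p b y \<bullet> - qy b (y - t)) (at t within cbox 0 1)"
      by simp
  next
    fix t :: real
    have "continuous_on UNIV (\<lambda>y. q b (y - t))"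
      by (rule continuous_on_compose2[OF cb[OF E(6)]]) (auto intro!: continuous_intros)
    then show "(\<lambda>y. p b y \<bullet> q b (y - t)) integrable_on cbox 0 T"
      by (intro integrable_continuous continuous_intros continuous_on_subset[OF cb[OF D(6)]])
        (auto intro: continuous_on_subset)
  next
    have "continuous_on (cbox 0 1 \<times> cbox 0 T) (\<lambda>w. qy b (snd w - fst w))"
      by (rule continuous_on_compose2[OF cb[OF E(8)]]) (auto intro!: continuous_intros)
    moreover have "continuous_on (cbox 0 1 \<times> cbox 0 T) (\<lambda>w::real \<times> real. p b (snd w))"
      by (rule continuous_on_compose2[OF cb[OF D(6)]]) (auto intro!: continuous_intros)
    ultimately show "continuous_on (cbox 0 1 \<times> cbox 0 T) (\<lambda>(t, y). p b y \<bullet> - qy b (y - t))"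
      by (simp add: case_prod_beta continuous_on_inner continuous_on_minus)
  qed auto
  have "(?A has_vector_derivative
      integral (cbox 0 T) (\<lambda>y. p b y \<bullet> - qy b (y - 0)) -
      rect_integral a b T (\<lambda>x y. px x y \<bullet> - qy x (y - 0))) (at 0 within {0..1})"
    by (rule has_vector_derivative_transform[OF _ _ has_vector_derivative_diff[OF dB dC]]) (auto
        simp: eq)
  from vector_derivative_unique_within[OF _ dA this]
  have "rect_integral a b T (\<lambda>x y. py x y \<bullet> qx x y) =
     - integral {0..T} (\<lambda>y. p b y \<bullet> qy b y) + rect_integral a b T (\<lambda>x y. px x y \<bullet> qy x y)"
    by (simp add: trivial_limit_within islimpt_Icc)
  moreover have "rect_integral a b T (\<lambda>x y. py x y \<bullet> qx x y - px x y \<bullet> qy x y) =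
    rect_integral a b T (\<lambda>x y. py x y \<bullet> qx x y) - rect_integral a b T (\<lambda>x y. px x y \<bullet> qy x y)"
    by (intro integral_diff rect_integrable continuous_intros D E)
  ultimately show ?thesis by simp
qed

section \<open>The weighted inequality and unique continuation across a strip\<close>

lemma cylinder_C1_scale:
  assumes "cylinder_C1 a b T p px py" and m: "\<And>x. (m has_real_derivative m' x) (at x)"
    and c: "continuous_on UNIV m'"
  shows "cylinder_C1 a b T (\<lambda>x y. m x *\<^sub>R p x y) (\<lambda>x y. m x *\<^sub>R px x y + m' x *\<^sub>R p x y)
    (\<lambda>x y. m x *\<^sub>R py x y)"
proof -
  note D = cylinder_C1D[OF assms(1)]
  have cm: "continuous_on S (\<lambda>z. m (fst z))" "continuous_on S (\<lambda>z. m' (fst z))"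
      for S :: "(real \<times> real) set"
    by (rule continuous_on_compose2[of UNIV]; auto intro!: continuous_intros c DERIV_continuous_on m)+
  have "((\<lambda>y. m x *\<^sub>R p x y) has_vector_derivative m x *\<^sub>R py x y) (at y)" if "x \<in> {a..b}" for x y
    using bounded_linear.has_vector_derivative[OF bounded_linear_scaleR_right D(2)[OF that]] .
  moreover have "((\<lambda>x. m x *\<^sub>R p x y) has_vector_derivative m x *\<^sub>R px x y + m' x *\<^sub>R p x y)
      (at x within {a..b})" if "x \<in> {a..b}" for x y
    by (rule has_vector_derivative_scaleR[OF has_field_derivative_at_within[OF m] D(1)[OF that]])
  ultimately show ?thesis
    unfolding cylinder_C1_def
    by (intro conjI ballI allI continuous_intros cm D) (auto simp: D)
qed

lemma cylinder_C1_add: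
  assumes "cylinder_C1 a b T p px py" "cylinder_C1 a b T q qx qy"
  shows "cylinder_C1 a b T (\<lambda>x y. p x y + q x y) (\<lambda>x y. px x y + qx x y)
    (\<lambda>x y. py x y + qy x y)"
proof -
  note D = cylinder_C1D[OF assms(1)] and E = cylinder_C1D[OF assms(2)]
  show ?thesis
    unfolding cylinder_C1_def
    by (intro conjI ballI allI has_vector_derivative_add D E continuous_intros) (auto simp: D E)
qed

lemma cylinder_C1_minus:
  assumes "cylinder_C1 a b T p px py"
  shows "cylinder_C1 a b T (\<lambda>x y. - p x y) (\<lambda>x y. - px x y) (\<lambda>x y. - py x y)"
proof -
  note D = cylinder_C1D[OF assms(1)]
  show ?thesis
    unfolding cylinder_C1_def
    by (intro conjI ballI allI has_vector_derivative_minus D continuous_intros) (auto simp: D)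
qed

lemma cylinder_C1_zero: "cylinder_C1 a b T (\<lambda>x y. 0) (\<lambda>x y. 0) (\<lambda>x y. 0)"
  unfolding cylinder_C1_def by auto

text \<open>Below, \<open>v\<close> comes from the antisymmetric part of the conjugated operator and
  \<open>w\<close> from the symmetric part. Dropping the square of \<open>v - w\<close> keeps just
  their cross term, which integrates to the commutator and boundary terms.\<close>

lemma norm_add_ge_inner: "norm (v + w) ^ 2 \<ge> 4 * (v \<bullet> w)"
proof -
  have "0 \<le> norm (v - w) ^ 2" by simp
  then show ?thesis
    unfolding power2_norm_eq_inner by (simp add: algebra_simps inner_commute)
qed

text \<open>With \<open>\<phi>(x) = \<lambda> exp(-x)\<close> and \<open>V = exp(\<phi>) (p + \<i> q)\<close>, conjugating \<open>\<partial>\<^sub>x + \<i> \<partial>\<^sub>y\<close> by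
  \<open>exp(\<phi>)\<close> gives a symmetric plus an antisymmetric operator; their commutator is \<open>\<phi>''\<close>.\<close>

lemma carleman_cylinder:
  fixes p q :: "real \<Rightarrow> real \<Rightarrow> 'h::euclidean_space" and l :: real
  defines "w \<equiv> \<lambda>x. exp (l * exp (- x))"
  assumes "a \<le> b" "0 \<le> T" "0 \<le> l"
    and P: "cylinder_C1 a b T p px py" and Q: "cylinder_C1 a b T q qx qy"
    and z: "\<And>y. p a y = 0" "\<And>y. q a y = 0"
  shows "2 * rect_integral a b T (\<lambda>x y. l * exp (- x) * (w x)\<^sup>2 * ((norm (p x y))\<^sup>2 + (norm (q x y))\<^sup>2))
    \<le> rect_integral a b T (\<lambda>x y. (w x)\<^sup>2 * ((norm (px x y - qy x y))\<^sup>2 + (norm (py x y + qx x y))\<^sup>2))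
      + 4 * ((w b)\<^sup>2 * integral {0..T} (\<lambda>y. p b y \<bullet> qy b y))"
proof -
  define w' where "w' = (\<lambda>x. - (l * exp (- x)) * w x)"
  have w: "(w has_real_derivative w' x) (at x)" for x
    unfolding w_def w'_def by (auto intro!: derivative_eq_intros)
  have cw: "continuous_on S w" for S
    using DERIV_continuous_on[OF has_field_derivative_at_within[OF w]] by blast
  have cw': "continuous_on S w'" for S
    unfolding w'_def by (intro continuous_intros cw)
  define r where "r = (\<lambda>x. l * exp (- x))"
  have r: "(r has_real_derivative - r x) (at x)" for x
    unfolding r_def by (auto intro!: derivative_eq_intros)
  have cr: "continuous_on S r" for S
    unfolding r_def by (intro continuous_intros)
  define Px where "Px = (\<lambda>x y. w x *\<^sub>R px x y + w' x *\<^sub>R p x y)"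
  define Qx where "Qx = (\<lambda>x y. w x *\<^sub>R qx x y + w' x *\<^sub>R q x y)"
  have P': "cylinder_C1 a b T (\<lambda>x y. w x *\<^sub>R p x y) Px (\<lambda>x y. w x *\<^sub>R py x y)"
    unfolding Px_def by (rule cylinder_C1_scale[OF P w cw'])
  have Q': "cylinder_C1 a b T (\<lambda>x y. w x *\<^sub>R q x y) Qx (\<lambda>x y. w x *\<^sub>R qy x y)"
    unfolding Qx_def by (rule cylinder_C1_scale[OF Q w cw'])
  note D = cylinder_C1D[OF P] and E = cylinder_C1D[OF Q] and D' = cylinder_C1D[OF P']
      and E' = cylinder_C1D[OF Q']
  define N where "N = (\<lambda>x y. (w x *\<^sub>R p x y) \<bullet> (w x *\<^sub>R p x y) + (w x *\<^sub>R q x y) \<bullet> (w x *\<^sub>R q x y))"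
  define Nx where "Nx = (\<lambda>x y. 2 * ((w x *\<^sub>R p x y) \<bullet> Px x y + (w x *\<^sub>R q x y) \<bullet> Qx x y))"
  obtain Ny where NC: "cylinder_C1 a b T N Nx Ny"
    using cylinder_C1_add[OF cylinder_C1_inner[OF P' P'] cylinder_C1_inner[OF Q' Q']]
    unfolding N_def Nx_def by (simp add: inner_commute algebra_simps)
  from cylinder_C1_scale[OF NC r] obtain Ky
    where K: "cylinder_C1 a b T (\<lambda>x y. r x * N x y) (\<lambda>x y. r x * Nx x y + - r x * N x y) Ky"
    using cr by (simp add: continuous_on_minus)
  note F = cylinder_C1D[OF K]
  have cr2: "continuous_on S (\<lambda>z. r (fst z))" "continuous_on S (\<lambda>z. w (fst z))"
      for S :: "(real \<times> real) set"
    by (rule continuous_on_compose2[of UNIV]; auto intro!: continuous_intros cr cw)+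
  have cN: "continuous_on ({a..b} \<times> UNIV) (\<lambda>z. N (fst z) (snd z))"
    unfolding N_def by (intro continuous_intros D E cr2)
  let ?J = "\<lambda>x y. (w x *\<^sub>R py x y) \<bullet> Qx x y - Px x y \<bullet> (w x *\<^sub>R qy x y)"
  \<comment> \<open>Since \<open>r' = - r\<close>, the cross term \<open>2 * r * Nx\<close> equals
    twice the \<open>x\<close>-derivative of \<open>r * N\<close> plus \<open>2 * r * N\<close>. The
    last summand is the commutator term that the inequality asserts; the derivative and the Jacobian
    \<open>?J\<close> integrate to boundary terms.\<close>
  have pt: "4 * ?J x y + 2 * (r x * Nx x y + - r x * N x y) + 2 * (r x * N x y)
     \<le> (w x)\<^sup>2 * ((norm (px x y - qy x y))\<^sup>2 + (norm (py x y + qx x y))\<^sup>2)" for x y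
  proof -
    have 1: "w x *\<^sub>R (px x y - qy x y) = Px x y + (r x *\<^sub>R w x *\<^sub>R p x y - w x *\<^sub>R qy x y)"
      unfolding Px_def w'_def r_def by (simp add: algebra_simps)
    have 2: "w x *\<^sub>R (py x y + qx x y) = Qx x y + (w x *\<^sub>R py x y + r x *\<^sub>R w x *\<^sub>R q x y)"
      unfolding Qx_def w'_def r_def by (simp add: algebra_simps)
    have "(w x)\<^sup>2 * ((norm (px x y - qy x y))\<^sup>2 + (norm (py x y + qx x y))\<^sup>2)
      = (norm (w x *\<^sub>R (px x y - qy x y)))\<^sup>2 + (norm (w x *\<^sub>R (py x y + qx x y)))\<^sup>2"
      by (simp add: power_mult_distrib distrib_left)
    also have "\<dots> \<ge> 4 * (Px x y \<bullet> (r x *\<^sub>R w x *\<^sub>R p x y - w x *\<^sub>R qy x y)) +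
       4 * (Qx x y \<bullet> (w x *\<^sub>R py x y + r x *\<^sub>R w x *\<^sub>R q x y))"
      unfolding 1 2 by (intro add_mono norm_add_ge_inner)
    finally show ?thesis
      unfolding Nx_def by (simp add: algebra_simps inner_commute)
  qed
  have "rect_integral a b T (\<lambda>x y. 4 * ?J x y + 2 * (r x * Nx x y + - r x * N x y) + 2 * (r x * N x y))
     \<le> rect_integral a b T (\<lambda>x y. (w x)\<^sup>2 * ((norm (px x y - qy x y))\<^sup>2 + (norm (py x y + qx x y))\<^sup>2))"
    by (intro integral_le rect_integrable pt continuous_intros D E D' E' F cr2 cN)
  also have "rect_integral a b T (\<lambda>x y. 4 * ?J x y + 2 * (r x * Nx x y + - r x * N x y)
      + 2 * (r x * N x y))
    = rect_integral a b T (\<lambda>x y. 4 * ?J x y) + rect_integral a b T (\<lambda>x y. 2 * (r x * Nx x y +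
        - r x * N x y))
     + rect_integral a b T (\<lambda>x y. 2 * (r x * N x y))"
    apply (subst integral_add)
    apply (intro rect_integrable continuous_intros D E D' E' F cr2 cN cylinder_C1D(7)[OF NC])+
    apply (subst integral_add)
    apply (intro rect_integrable continuous_intros D E D' E' F cr2 cN cylinder_C1D(7)[OF NC])+
    apply (rule refl)
    done
  also have "rect_integral a b T (\<lambda>x y. 4 * ?J x y) = 4 * rect_integral a b T ?J"
    by (rule integral_mult_right)
  also have "rect_integral a b T ?J = - integral {0..T} (\<lambda>y. (w b *\<^sub>R p b y) \<bullet> (w b *\<^sub>R qy b y))"
    by (rule rect_integral_jacobian[OF \<open>a \<le> b\<close> \<open>0 \<le> T\<close> P' Q']) (simp add: z)
  also have "integral {0..T} (\<lambda>y. (w b *\<^sub>R p b y) \<bullet> (w b *\<^sub>R qy b y))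
      = (w b)\<^sup>2 * integral {0..T} (\<lambda>y. p b y \<bullet> qy b y)"
    by (simp add: power2_eq_square mult.assoc flip: integral_mult_right)
  also have "rect_integral a b T (\<lambda>x y. 2 * (r x * Nx x y + - r x * N x y)) = 
     2 * rect_integral a b T (\<lambda>x y. (r x * Nx x y + - r x * N x y))"
    by (rule integral_mult_right)
  also have "rect_integral a b T (\<lambda>x y. (r x * Nx x y + - r x * N x y)) = 
     integral {0..T} (\<lambda>y. r b * N b y - r a * N a y)"
    by (rule rect_integral_x[OF \<open>a \<le> b\<close> K])
  also have "rect_integral a b T (\<lambda>x y. 2 * (r x * N x y))
      = 2 * rect_integral a b T (\<lambda>x y. r x * N x y)"
    by (rule integral_mult_right)
  also have "(\<lambda>z. r (fst z) * N (fst z) (snd z)) = 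
     (\<lambda>z. l * exp (- fst z) * (w (fst z))\<^sup>2 * ((norm (p (fst z) (snd z)))\<^sup>2
         + (norm (q (fst z) (snd z)))\<^sup>2))"
    unfolding r_def N_def power2_norm_eq_inner by (simp add: algebra_simps power2_eq_square)
  finally have fin: "4 * - ((w b)\<^sup>2 * integral {0..T} (\<lambda>y. p b y \<bullet> qy b y)) 
     + 2 * integral {0..T} (\<lambda>y. r b * N b y - r a * N a y)
     + 2 * rect_integral a b T (\<lambda>x y. l * exp (- x) * (w x)\<^sup>2 * ((norm (p x y))\<^sup>2 + (norm (q x y))\<^sup>2))
    \<le> rect_integral a b T (\<lambda>x y. (w x)\<^sup>2 * ((norm (px x y - qy x y))\<^sup>2 + (norm (py x y + qx x y))\<^sup>2))" .
  \<comment> \<open>This boundary term is zero at \<open>a\<close> and has the favourable sign at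
    \<open>b\<close>, so it is dropped; the boundary term of the Jacobian has no sign and is
    kept.\<close>
  have "0 \<le> integral {0..T} (\<lambda>y. r b * N b y - r a * N a y)"
  proof (rule integral_nonneg)
    have "continuous_on UNIV (N b)"
      by (rule continuous_on_compose2[OF cN, of _ "\<lambda>y. (b, y)", simplified])
        (use \<open>a \<le> b\<close> in \<open>auto intro!: continuous_intros\<close>)
    then have "continuous_on {0..T} (N b)" by (rule continuous_on_subset) simp
    moreover have "N a = (\<lambda>y. 0)" by (simp add: N_def z)
    ultimately show "(\<lambda>y. r b * N b y - r a * N a y) integrable_on {0..T}"
      by (intro integrable_continuous_real continuous_intros) auto
    show "0 \<le> r b * N b y - r a * N a y" for y
      using \<open>0 \<le> l\<close> unfolding N_def z r_def w_def by (auto intro!: mult_nonneg_nonneg add_nonneg_nonneg)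
  qed
  with fin show ?thesis by simp
qed

text \<open>Carleman's inequality is applied to \<open>u\<close> and to \<open>ux - \<i> uy\<close>.
  The operator turns the former into the gradient and the latter into the Laplacian, as the mixed
  derivatives cancel, so both right-hand sides are bounded by the energy \<open>e\<close> itself and
  are absorbed for a large parameter \<open>l\<close>. In place of a cut-off function the boundary
  term at \<open>b\<close> is kept: its weight is exponentially smaller than the weight to the left
  of \<open>x1 < b\<close>, which forces the energy there to vanish.\<close>

lemma strip_unique_continuation:
  fixes u :: "real \<Rightarrow> real \<Rightarrow> 'h::euclidean_space"
  assumes "a < b" "0 < T"
    and U: "cylinder_C1 a b T u ux uy"
    and Ux: "cylinder_C1 a b T ux uxx uxy" and Uy: "cylinder_C1 a b T uy uyx uyy"
    and sym: "\<And>x y. x \<in> {a..b} \<Longrightarrow> uxy x y = uyx x y"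
    and z: "\<And>y. u a y = 0" "\<And>y. ux a y = 0" "\<And>y. uy a y = 0"
    and ineq: "\<And>x y. x \<in> {a..b} \<Longrightarrow> y \<in> {0..T} \<Longrightarrow> (norm (uxx x y + uyy x y))\<^sup>2
      \<le> C * ((norm (u x y))\<^sup>2 + (norm (ux x y))\<^sup>2 + (norm (uy x y))\<^sup>2)"
    and x: "x \<in> {a..<b}" "y \<in> {0..T}"
  shows "u x y = 0"
proof -
  note D = cylinder_C1D[OF U] and E = cylinder_C1D[OF Ux] and F = cylinder_C1D[OF Uy]
  define e where "e = (\<lambda>x y. (norm (u x y))\<^sup>2 + (norm (ux x y))\<^sup>2 + (norm (uy x y))\<^sup>2)"
  have e0: "0 \<le> e x y" for x y by (simp add: e_def)
  have ce: "continuous_on ({a..b} \<times> UNIV) (\<lambda>z. e (fst z) (snd z))"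
    unfolding e_def by (intro continuous_intros D E F)
  \<comment> \<open>The boundary term at \<open>b\<close> without its weight, hence independent of
    \<open>l\<close>; only the second application contributes one.\<close>
  define M where "M = \<bar>integral {0..T} (\<lambda>y. ux b y \<bullet> - uyy b y)\<bar>"
  define x1 where "x1 = (x + b) / 2"
  have x1: "x < x1" "a < x1" "x1 < b" using x by (auto simp: x1_def)
  define I where "I = rect_integral a x1 T e"
  have ab: "a \<le> b" "0 \<le> T" using assms by auto
  have key: "I * exp (2 * l * (exp (- x1) - exp (- b))) \<le> 4 * M"
    if l: "0 \<le> l" "2 * (l * exp (- b)) - (\<bar>C\<bar> + 1) \<ge> 1" for l
  proof -
    define w where "w = (\<lambda>x. exp (l * exp (- x)))"
    have cw: "continuous_on S (\<lambda>z. w (fst z))" for S :: "(real \<times> real) set"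
      unfolding w_def by (intro continuous_intros)
    note cc = rect_integrable continuous_intros D E F cw ce
    have c1: "2 * rect_integral a b T (\<lambda>x y. l * exp (- x) * (w x)\<^sup>2 * ((norm (u x y))\<^sup>2
        + (norm (0::'h))\<^sup>2))
      \<le> rect_integral a b T (\<lambda>x y. (w x)\<^sup>2 * ((norm (ux x y - 0))\<^sup>2 + (norm (uy x y + 0))\<^sup>2))
      + 4 * ((w b)\<^sup>2 * integral {0..T} (\<lambda>y. u b y \<bullet> 0))"
      unfolding w_def
      by (rule carleman_cylinder[OF ab l(1) U cylinder_C1_zero]) (auto simp: z)
    have c2: "2 * rect_integral a b T (\<lambda>x y. l * exp (- x) * (w x)\<^sup>2 * ((norm (ux x y))\<^sup>2
        + (norm (- uy x y))\<^sup>2))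
      \<le> rect_integral a b T (\<lambda>x y. (w x)\<^sup>2 * ((norm (uxx x y - - uyy x y))\<^sup>2 + (norm (uxy x y +
          - uyx x y))\<^sup>2))
      + 4 * ((w b)\<^sup>2 * integral {0..T} (\<lambda>y. ux b y \<bullet> - uyy b y))"
      unfolding w_def
      by (rule carleman_cylinder[OF ab l(1) Ux cylinder_C1_minus[OF Uy]]) (auto simp: z)
    have "rect_integral a b T (\<lambda>x y. 2 * (l * exp (- x) * (w x)\<^sup>2 * e x y)) = 
       2 * rect_integral a b T (\<lambda>x y. l * exp (- x) * (w x)\<^sup>2 * ((norm (u x y))\<^sup>2 + (norm (0::'h))\<^sup>2)) + 
       2 * rect_integral a b T (\<lambda>x y. l * exp (- x) * (w x)\<^sup>2 * ((norm (ux x y))\<^sup>2 + (norm (- uy x y))\<^sup>2))"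
      apply (subst integral_mult_right)
      apply (subst distrib_left[symmetric])
      apply (subst integral_add[symmetric])
      apply (intro cc)+
      apply (simp add: e_def algebra_simps)
      done
    also have "\<dots> \<le> rect_integral a b T (\<lambda>x y. (w x)\<^sup>2 * ((norm (ux x y - 0))\<^sup>2 + (norm (uy x y + 0))\<^sup>2)) + 
       rect_integral a b T (\<lambda>x y. (w x)\<^sup>2 * ((norm (uxx x y - - uyy x y))\<^sup>2 + (norm (uxy x y +
           - uyx x y))\<^sup>2))
      + 4 * ((w b)\<^sup>2 * integral {0..T} (\<lambda>y. ux b y \<bullet> - uyy b y))"
      using c1 c2 by simp
    also have "rect_integral a b T (\<lambda>x y. (w x)\<^sup>2 * ((norm (ux x y - 0))\<^sup>2 + (norm (uy x y + 0))\<^sup>2)) + 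
       rect_integral a b T (\<lambda>x y. (w x)\<^sup>2 * ((norm (uxx x y - - uyy x y))\<^sup>2 + (norm (uxy x y +
           - uyx x y))\<^sup>2))
      = rect_integral a b T (\<lambda>x y. (w x)\<^sup>2 * ((norm (ux x y - 0))\<^sup>2 + (norm (uy x y + 0))\<^sup>2) + 
         (w x)\<^sup>2 * ((norm (uxx x y - - uyy x y))\<^sup>2 + (norm (uxy x y + - uyx x y))\<^sup>2))"
      by (rule integral_add[symmetric]; intro cc)
    also have "\<dots> \<le> rect_integral a b T (\<lambda>x y. (\<bar>C\<bar> + 1) * ((w x)\<^sup>2 * e x y))"
    proof (intro integral_le cc)
      fix zz assume "zz \<in> cbox (a, 0) (b, T)"
      then have xin: "fst zz \<in> {a..b}" and yin: "snd zz \<in> {0..T}" by (auto simp: cbox_Pair_eq)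
      let ?x = "fst zz" let ?y = "snd zz"
      have "(norm (uxx ?x ?y + uyy ?x ?y))\<^sup>2 \<le> \<bar>C\<bar> * e ?x ?y"
        using ineq[OF xin yin] mult_right_mono[OF abs_ge_self[of C] e0, of ?x ?y] unfolding e_def
          by linarith
      moreover have "(norm (ux ?x ?y))\<^sup>2 + (norm (uy ?x ?y))\<^sup>2 \<le> e ?x ?y"
        by (simp add: e_def)
      ultimately have "((norm (ux ?x ?y))\<^sup>2 + (norm (uy ?x ?y))\<^sup>2) + (norm (uxx ?x ?y + uyy ?x ?y))\<^sup>2
          \<le> (\<bar>C\<bar> + 1) * e ?x ?y"
        by (simp add: algebra_simps)
      from mult_left_mono[OF this, of "(w ?x)\<^sup>2"]
      show "(w ?x)\<^sup>2 * ((norm (ux ?x ?y - 0))\<^sup>2 + (norm (uy ?x ?y + 0))\<^sup>2) + 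
         (w ?x)\<^sup>2 * ((norm (uxx ?x ?y - - uyy ?x ?y))\<^sup>2 + (norm (uxy ?x ?y + - uyx ?x ?y))\<^sup>2)
         \<le> (\<bar>C\<bar> + 1) * ((w ?x)\<^sup>2 * e ?x ?y)"
        using sym[OF xin] by (simp add: algebra_simps)
    qed
    finally have "rect_integral a b T (\<lambda>x y. 2 * (l * exp (- x) * (w x)\<^sup>2 * e x y)) - 
       rect_integral a b T (\<lambda>x y. (\<bar>C\<bar> + 1) * ((w x)\<^sup>2 * e x y))
           \<le> 4 * ((w b)\<^sup>2 * integral {0..T} (\<lambda>y. ux b y \<bullet> - uyy b y))"
      by simp
    also have "\<dots> \<le> 4 * ((w b)\<^sup>2 * M)"
      unfolding M_def by (intro mult_left_mono) auto
    also have "rect_integral a b T (\<lambda>x y. 2 * (l * exp (- x) * (w x)\<^sup>2 * e x y)) - 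
       rect_integral a b T (\<lambda>x y. (\<bar>C\<bar> + 1) * ((w x)\<^sup>2 * e x y)) = 
       rect_integral a b T (\<lambda>x y. 2 * (l * exp (- x) * (w x)\<^sup>2 * e x y) - (\<bar>C\<bar> + 1) * ((w x)\<^sup>2 * e x y))"
      by (rule integral_diff[symmetric]; intro cc)
    finally have A: "rect_integral a b T (\<lambda>x y. 2 * (l * exp (- x) * (w x)\<^sup>2 * e x y) - (\<bar>C\<bar>
        + 1) * ((w x)\<^sup>2 * e x y))
      \<le> 4 * ((w b)\<^sup>2 * M)" .
    have "rect_integral a b T (\<lambda>x y. (w x)\<^sup>2 * e x y) \<le> 
      rect_integral a b T (\<lambda>x y. 2 * (l * exp (- x) * (w x)\<^sup>2 * e x y) - (\<bar>C\<bar> + 1) * ((w x)\<^sup>2 * e x y))"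
    proof (intro integral_le cc)
      fix zz assume "zz \<in> cbox (a, 0) (b, T)"
      then have xin: "fst zz \<in> {a..b}" by (auto simp: cbox_Pair_eq)
      let ?x = "fst zz" let ?y = "snd zz"
      have "l * exp (- b) \<le> l * exp (- ?x)" using l(1) xin by (intro mult_left_mono) auto
      with l(2) have "1 \<le> 2 * (l * exp (- ?x)) - (\<bar>C\<bar> + 1)" by linarith
      from mult_right_mono[OF this, of "(w ?x)\<^sup>2 * e ?x ?y"] e0
      show "(w ?x)\<^sup>2 * e ?x ?y \<le> 2 * (l * exp (- ?x) * (w ?x)\<^sup>2 * e ?x ?y) - (\<bar>C\<bar>
          + 1) * ((w ?x)\<^sup>2 * e ?x ?y)"
        by (simp add: algebra_simps)
    qed
    moreover have "rect_integral a x1 T (\<lambda>x y. (w x)\<^sup>2 * e x y)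
        \<le> rect_integral a b T (\<lambda>x y. (w x)\<^sup>2 * e x y)"
    proof (rule integral_subset_le)
      show "cbox (a, 0) (x1, T) \<subseteq> cbox (a, 0) (b, T)" using x1 by (auto simp: cbox_Pair_eq)
      show "(\<lambda>z. (w (fst z))\<^sup>2 * e (fst z) (snd z)) integrable_on cbox (a, 0) (x1, T)"
        by (intro rect_integrable continuous_intros cw continuous_on_subset[OF ce]) (use x1 in auto)
      show "(\<lambda>z. (w (fst z))\<^sup>2 * e (fst z) (snd z)) integrable_on cbox (a, 0) (b, T)"
        by (intro cc)
    qed (use e0 in auto)
    moreover have "rect_integral a x1 T (\<lambda>x y. (w x1)\<^sup>2 * e x y)
        \<le> rect_integral a x1 T (\<lambda>x y. (w x)\<^sup>2 * e x y)"
    proof (rule integral_le)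
      show "(\<lambda>z. (w (fst z))\<^sup>2 * e (fst z) (snd z)) integrable_on cbox (a, 0) (x1, T)"
        by (intro rect_integrable continuous_intros cw continuous_on_subset[OF ce]) (use x1 in auto)
      show "(\<lambda>z. (w x1)\<^sup>2 * e (fst z) (snd z)) integrable_on cbox (a, 0) (x1, T)"
        by (intro rect_integrable continuous_intros cw continuous_on_subset[OF ce]) (use x1 in auto)
      fix zz assume "zz \<in> cbox (a, 0) (x1, T)"
      then have xin: "fst zz \<in> {a..x1}" by (auto simp: cbox_Pair_eq)
      have "w x1 \<le> w (fst zz)" using xin l by (auto simp: w_def intro!: mult_left_mono)
      then show "(w x1)\<^sup>2 * e (fst zz) (snd zz) \<le> (w (fst zz))\<^sup>2 * e (fst zz) (snd zz)"
        by (intro mult_right_mono power_mono e0) (auto simp: w_def)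
    qed
    moreover have "rect_integral a x1 T (\<lambda>x y. (w x1)\<^sup>2 * e x y) = (w x1)\<^sup>2 * I"
      unfolding I_def by (rule integral_mult_right)
    ultimately have "(w x1)\<^sup>2 * I \<le> (w b)\<^sup>2 * (4 * M)" using A by linarith
    moreover have "(w x1)\<^sup>2 = exp (2 * l * (exp (- x1) - exp (- b))) * (w b)\<^sup>2"
      unfolding w_def exp_double[symmetric] by (simp add: exp_add[symmetric] algebra_simps)
    ultimately have "(w b)\<^sup>2 * (I * exp (2 * l * (exp (- x1) - exp (- b)))) \<le> (w b)\<^sup>2 * (4 * M)"
      by (simp add: algebra_simps)
    then show ?thesis by (simp add: w_def)
  qed
  have "I \<ge> 0" unfolding I_def
    by (rule integral_nonneg) (use x1 in \<open>auto intro!: e0 rect_integrable continuous_on_subset[OF ce]\<close>)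
  have "I = 0"
  proof (rule ccontr)
    assume "I \<noteq> 0"
    with \<open>I \<ge> 0\<close> have I: "I > 0" by simp
    define d where "d = exp (- x1) - exp (- b)"
    have d: "d > 0" using x1 by (simp add: d_def)
    \<comment> \<open>The first entry gives
      \<open>2 * l * exp (- b) \<ge> \<bar>C\<bar> + 2\<close>, which absorbs the right-hand side
      and leaves the energy with coefficient at least 1. The second makes
      \<open>1 + 2 * l * d\<close>, and with it \<open>exp (2 * l * d)\<close>, exceed
      \<open>4 * M / I\<close>.\<close>
    define l where "l = max ((\<bar>C\<bar> + 2) / (2 * exp (- b))) ((4 * M / I) / (2 * d))"
    have "l \<ge> (\<bar>C\<bar> + 2) / (2 * exp (- b))" "l \<ge> (4 * M / I) / (2 * d)" by (auto simp: l_def)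
    then have "(\<bar>C\<bar> + 2) \<le> l * (2 * exp (- b))" "4 * M / I \<le> l * (2 * d)"
      using d by (simp_all only: pos_divide_le_eq mult_pos_pos exp_gt_zero zero_less_numeral)
    then have l1: "2 * (l * exp (- b)) \<ge> \<bar>C\<bar> + 2" and l2: "2 * l * d \<ge> 4 * M / I"
      by (simp_all only: mult_ac)
    have l0: "0 \<le> l" using order_trans[OF _ \<open>l \<ge> (\<bar>C\<bar> + 2) / (2 * exp (- b))\<close>, of 0] by simp
    have "I * exp (2 * l * d) \<le> 4 * M" using key[OF l0] l1 by (simp add: d_def)
    moreover have "exp (2 * l * d) > 4 * M / I" using exp_ge_add_one_self[of "2 * l * d"] l2 by linarith
    ultimately show False using I by (simp add: field_simps)
  qed
  have ne: "box (a, 0) (x1, T) \<noteq> {}"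
    using x1 \<open>0 < T\<close> by (auto simp: box_ne_empty Basis_prod_def)
  from \<open>I = 0\<close> have "\<forall>z\<in>cbox (a, 0) (x1, T). e (fst z) (snd z) = 0"
    unfolding I_def
    by (subst (asm) integral_cbox_eq_0_iff)
      (use x1 e0 ne in \<open>auto intro!: continuous_on_subset[OF ce]\<close>)
  then have "e x y = 0" using x x1 by (auto simp: cbox_Pair_eq)
  then show ?thesis
    unfolding e_def by (smt (verit) norm_eq_zero zero_eq_power2 zero_le_power2)
qed

section \<open>Partial derivatives on the plane\<close>

text \<open>A total derivative, not two separate partial ones: the chain rule with a holomorphic
  inner map requires it.\<close>

definition has_partials :: "(complex \<Rightarrow> 'h::real_normed_vector) \<Rightarrow> 'h \<Rightarrow> 'h \<Rightarrow> complex \<Rightarrow> bool"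
  where "has_partials F a b z \<longleftrightarrow> (F has_derivative (\<lambda>v. Re v *\<^sub>R a + Im v *\<^sub>R b)) (at z)"

definition pdx :: "(complex \<Rightarrow> 'h::real_normed_vector) \<Rightarrow> complex \<Rightarrow> 'h"
  where "pdx F z = frechet_derivative F (at z) 1"

definition pdy :: "(complex \<Rightarrow> 'h::real_normed_vector) \<Rightarrow> complex \<Rightarrow> 'h"
  where "pdy F z = frechet_derivative F (at z) \<i>"

lemma has_partials_unique:
  assumes "has_partials F a b z"
  shows "pdx F z = a \<and> pdy F z = b"
  unfolding pdx_def pdy_def frechet_derivative_at[OF assms[unfolded has_partials_def], symmetric]
    by simp

lemma frechet_derivative_partials:
  assumes "F differentiable (at z)"
  shows "frechet_derivative F (at z) v = Re v *\<^sub>R pdx F z + Im v *\<^sub>R pdy F z"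
proof -
  have l: "linear (frechet_derivative F (at z))"
    using assms by (rule linear_frechet_derivative)
  have "v = Re v *\<^sub>R 1 + Im v *\<^sub>R \<i>" by (simp add: complex_eq_iff)
  then have "frechet_derivative F (at z) v = frechet_derivative F (at z) (Re v *\<^sub>R 1 + Im v *\<^sub>R \<i>)"
    by simp
  also have "\<dots> = Re v *\<^sub>R pdx F z + Im v *\<^sub>R pdy F z"
    unfolding pdx_def pdy_def by (simp only: linear_add[OF l] linear_scale[OF l])
  finally show ?thesis .
qed

lemma has_partials_pd: "F differentiable (at z) \<Longrightarrow> has_partials F (pdx F z) (pdy F z) z"
  unfolding has_partials_def using frechet_derivative_partials[of F z] frechet_derivative_works[of F
      "at z"]
  by (metis (no_types, lifting) ext)

lemma has_partials_differentiable: "has_partials F a b z \<Longrightarrow> F differentiable (at z)"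
  unfolding has_partials_def differentiable_def by blast

lemma has_partials_cong:
  assumes "has_partials F a b z" "open S" "z \<in> S" "\<And>w. w \<in> S \<Longrightarrow> F w = G w"
  shows "has_partials G a b z"
  using assms has_derivative_transform_within_open unfolding has_partials_def by blast

lemma has_partials_add:
  assumes "has_partials F a b z" "has_partials G c d z"
  shows "has_partials (\<lambda>w. F w + G w) (a + c) (b + d) z"
  using has_derivative_add[OF assms[unfolded has_partials_def]]
  unfolding has_partials_def by (simp add: algebra_simps)

lemma has_partials_diff:
  assumes "has_partials F a b z" "has_partials G c d z"
  shows "has_partials (\<lambda>w. F w - G w) (a - c) (b - d) z"
  using has_derivative_diff[OF assms[unfolded has_partials_def]]
  unfolding has_partials_def by (simp add: algebra_simps)

lemma has_partials_scaleR:
  assumes "has_partials \<alpha> a b z" "has_partials G c d z"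
  shows "has_partials (\<lambda>w. \<alpha> w *\<^sub>R G w) (\<alpha> z *\<^sub>R c + a *\<^sub>R G z) (\<alpha> z *\<^sub>R d + b *\<^sub>R G z) z"
  using has_derivative_scaleR[OF assms[unfolded has_partials_def]]
  unfolding has_partials_def by (simp add: algebra_simps)

lemma has_partials_compose:
  assumes "has_partials F a b (g z)" "(g has_field_derivative d) (at z)"
  shows "has_partials (\<lambda>w. F (g w)) (Re d *\<^sub>R a + Im d *\<^sub>R b) (- Im d *\<^sub>R a + Re d *\<^sub>R b) z"
  using has_derivative_compose[OF assms(2)[unfolded has_field_derivative_def] assms(1)[unfolded
      has_partials_def]]
  unfolding has_partials_def by (simp add: algebra_simps)

lemma has_partials_Re:
  assumes "(g has_field_derivative d) (at z)"
  shows "has_partials (\<lambda>w. Re (g w)) (Re d) (- Im d) z"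
  using has_derivative_Re[OF assms(1)[unfolded has_field_derivative_def]]
  unfolding has_partials_def by (simp add: algebra_simps)

lemma has_partials_Im:
  assumes "(g has_field_derivative d) (at z)"
  shows "has_partials (\<lambda>w. Im (g w)) (Im d) (Re d) z"
  using has_derivative_Im[OF assms(1)[unfolded has_field_derivative_def]]
  unfolding has_partials_def by (simp add: algebra_simps)

definition C1_on :: "(complex \<Rightarrow> 'h::real_normed_vector) \<Rightarrow> complex set \<Rightarrow> bool"
  where "C1_on F S \<longleftrightarrow> (\<forall>z\<in>S. F differentiable (at z)) \<and> continuous_on S (pdx F) \<and>
      continuous_on S (pdy F)"

definition C2_on :: "(complex \<Rightarrow> 'h::real_normed_vector) \<Rightarrow> complex set \<Rightarrow> bool"
  where "C2_on F S \<longleftrightarrow> (\<forall>z\<in>S. F differentiable (at z)) \<and> C1_on (pdx F) S \<and> C1_on (pdy F) S"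

lemma C1_onI:
  assumes "\<And>z. z \<in> S \<Longrightarrow> has_partials F (a z) (b z) z" "continuous_on S a" "continuous_on S b"
  shows "C1_on F S"
proof -
  have "pdx F z = a z \<and> pdy F z = b z" if "z \<in> S" for z
    using has_partials_unique[OF assms(1)[OF that]] .
  then show ?thesis
    unfolding C1_on_def using assms has_partials_differentiable[OF assms(1)]
    by (auto cong: continuous_on_cong)
qed

lemma C1_on_partials: "C1_on F S \<Longrightarrow> z \<in> S \<Longrightarrow> has_partials F (pdx F z) (pdy F z) z"
  unfolding C1_on_def by (auto intro: has_partials_pd)

lemma C1_on_continuous: "C1_on F S \<Longrightarrow> continuous_on S F"
  unfolding C1_on_def
  by (auto intro!: continuous_at_imp_continuous_on differentiable_imp_continuous_within)

lemma C1_on_cong: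
  assumes "C1_on F S" "open S" "\<And>w. w \<in> S \<Longrightarrow> F w = G w"
  shows "C1_on G S"
  using assms has_partials_cong[OF C1_on_partials[OF assms(1)] assms(2)]
  by (intro C1_onI[of S G "pdx F" "pdy F"]) (auto simp: C1_on_def)

lemma C2_on_C1_on: "C2_on F S \<Longrightarrow> C1_on F S"
  unfolding C2_on_def by (auto simp: C1_on_def[of F] intro: C1_on_continuous)

lemma C2_onI:
  assumes "open S" "\<And>z. z \<in> S \<Longrightarrow> has_partials F (a z) (b z) z" "C1_on a S" "C1_on b S"
  shows "C2_on F S"
proof -
  have "pdx F z = a z \<and> pdy F z = b z" if "z \<in> S" for z
    using has_partials_unique[OF assms(2)[OF that]] .
  then show ?thesis
    unfolding C2_on_def using assms has_partials_differentiable[OF assms(2)] C1_on_cong[OF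
        assms(3,1)] C1_on_cong[OF assms(4,1)]
    by auto
qed

lemma C1_on_subset: "C1_on F S \<Longrightarrow> T \<subseteq> S \<Longrightarrow> C1_on F T"
  unfolding C1_on_def by (auto intro: continuous_on_subset)

lemma C2_on_subset: "C2_on F S \<Longrightarrow> T \<subseteq> S \<Longrightarrow> C2_on F T"
  unfolding C2_on_def by (auto intro: C1_on_subset)

lemma C1_on_add: "C1_on F S \<Longrightarrow> C1_on G S \<Longrightarrow> C1_on (\<lambda>z. F z + G z) S"
  by (rule C1_onI, rule has_partials_add[OF C1_on_partials C1_on_partials])
    (auto simp: C1_on_def intro!: continuous_intros)

lemma C1_on_scaleR:
  assumes "C1_on F S" "C1_on G S"
  shows "C1_on (\<lambda>z. F z *\<^sub>R G z) S"
  by (rule C1_onI, rule has_partials_scaleR[OF C1_on_partials[OF assms(1)] C1_on_partials[OF assms(2)]])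
    (use assms C1_on_continuous[OF assms(1)] C1_on_continuous[OF assms(2)] in
      \<open>auto simp: C1_on_def intro!: continuous_intros\<close>)

lemma C1_on_compose:
  assumes "C1_on F T" "g holomorphic_on S" "open S" "g ` S \<subseteq> T"
  shows "C1_on (\<lambda>z. F (g z)) S"
proof (rule C1_onI)
  fix z assume "z \<in> S"
  then show "has_partials (\<lambda>z. F (g z)) (Re (deriv g z) *\<^sub>R pdx F (g z) + Im (deriv g z) *\<^sub>R pdy F (g z))
     (- Im (deriv g z) *\<^sub>R pdx F (g z) + Re (deriv g z) *\<^sub>R pdy F (g z)) z"
    using assms by (intro has_partials_compose C1_on_partials[OF assms(1)] holomorphic_derivI) auto
next
  have c: "continuous_on S g" "continuous_on S (deriv g)"
    using assms by (auto intro!: holomorphic_on_imp_continuous_on holomorphic_deriv)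
  have "continuous_on S (\<lambda>z. pdx F (g z))" "continuous_on S (\<lambda>z. pdy F (g z))"
    using assms c by (auto simp: C1_on_def intro: continuous_on_compose2)
  with c show "continuous_on S (\<lambda>z. Re (deriv g z) *\<^sub>R pdx F (g z) + Im (deriv g z) *\<^sub>R pdy F (g z))"
    "continuous_on S (\<lambda>z. - Im (deriv g z) *\<^sub>R pdx F (g z) + Re (deriv g z) *\<^sub>R pdy F (g z))"
    by (auto intro!: continuous_intros)
qed

lemma C1_on_Re_Im:
  assumes "g holomorphic_on S" "open S"
  shows "C1_on (\<lambda>z. Re (g z)) S" "C1_on (\<lambda>z. Im (g z)) S" "C1_on (\<lambda>z. - Im (g z)) S"
proof -
  have c: "continuous_on S (deriv g)"
    using assms by (auto intro!: holomorphic_on_imp_continuous_on holomorphic_deriv)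
  show "C1_on (\<lambda>z. Re (g z)) S"
    by (rule C1_onI[OF has_partials_Re[OF holomorphic_derivI[OF assms]]]) (auto intro!:
        continuous_intros c)
  show "C1_on (\<lambda>z. Im (g z)) S"
    by (rule C1_onI[OF has_partials_Im[OF holomorphic_derivI[OF assms]]]) (auto intro!:
        continuous_intros c)
  have *: "(\<lambda>z. - g z) holomorphic_on S" using assms by (intro holomorphic_intros)
  have c: "continuous_on S (deriv (\<lambda>z. - g z))"
    using assms * by (auto intro!: holomorphic_on_imp_continuous_on holomorphic_deriv)
  have "C1_on (\<lambda>z. Im (- g z)) S"
    by (rule C1_onI[OF has_partials_Im[OF holomorphic_derivI[OF * assms(2)]]]) (auto intro!:
        continuous_intros c)
  then show "C1_on (\<lambda>z. - Im (g z)) S" by simp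
qed

lemma compose_partials:
  assumes "F differentiable (at (g z))" "g holomorphic_on S" "open S" "z \<in> S"
  shows "pdx (\<lambda>z. F (g z)) z = Re (deriv g z) *\<^sub>R pdx F (g z) + Im (deriv g z) *\<^sub>R pdy F (g z)"
    and "pdy (\<lambda>z. F (g z)) z = - Im (deriv g z) *\<^sub>R pdx F (g z) + Re (deriv g z) *\<^sub>R pdy F (g z)"
  using has_partials_unique[OF has_partials_compose[OF has_partials_pd[OF assms(1)]
      holomorphic_derivI[OF assms(2-4)]]]
  by auto

lemma C2_on_compose:
  assumes F: "C2_on F T" and g: "g holomorphic_on S" "open S" "g ` S \<subseteq> T"
  shows "C2_on (\<lambda>z. F (g z)) S"
proof (rule C2_onI[OF g(2)])
  show "has_partials (\<lambda>z. F (g z)) (Re (deriv g z) *\<^sub>R pdx F (g z) + Im (deriv g z) *\<^sub>R pdy F (g z))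
     (- Im (deriv g z) *\<^sub>R pdx F (g z) + Re (deriv g z) *\<^sub>R pdy F (g z)) z" if "z \<in> S" for z
    using assms that C2_on_C1_on[OF F] by (intro has_partials_compose C1_on_partials
        holomorphic_derivI) auto
  have g': "deriv g holomorphic_on S" using g by (intro holomorphic_deriv)
  have "C1_on (pdx F) T" "C1_on (pdy F) T" using F by (auto simp: C2_on_def)
  note C = this[THEN C1_on_compose, OF g] C1_on_Re_Im[OF g' g(2)]
  show "C1_on (\<lambda>z. Re (deriv g z) *\<^sub>R pdx F (g z) + Im (deriv g z) *\<^sub>R pdy F (g z)) S"
    "C1_on (\<lambda>z. - Im (deriv g z) *\<^sub>R pdx F (g z) + Re (deriv g z) *\<^sub>R pdy F (g z)) S"
    by (intro C1_on_add C1_on_scaleR C)+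
qed

text \<open>The terms with the second derivative of \<open>g\<close> enter the two pure second
  derivatives with opposite signs, by the Cauchy-Riemann equations, and so do the mixed derivatives
  of \<open>F\<close>. This is the conformal covariance of the Laplacian in the plane.\<close>

lemma laplacian_compose:
  assumes F: "C2_on F T" and g: "g holomorphic_on S" "open S" "g ` S \<subseteq> T" and z: "z \<in> S"
  shows "pdx (pdx (\<lambda>z. F (g z))) z + pdy (pdy (\<lambda>z. F (g z))) z =
    (norm (deriv g z))\<^sup>2 *\<^sub>R (pdx (pdx F) (g z) + pdy (pdy F) (g z))"
proof -
  have g': "deriv g holomorphic_on S" using g by (intro holomorphic_deriv)
  have gz: "g z \<in> T" using g z by auto
  note d = holomorphic_derivI[OF g(1,2) z] and d' = holomorphic_derivI[OF g' g(2) z]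
  have C: "C1_on (pdx F) T" "C1_on (pdy F) T" "\<And>w. w \<in> T \<Longrightarrow> F differentiable (at w)"
    using F by (auto simp: C2_on_def)
  note X = has_partials_compose[OF C1_on_partials[OF C(1) gz] d]
    and Y = has_partials_compose[OF C1_on_partials[OF C(2) gz] d]
  have "((\<lambda>z. - deriv g z) has_field_derivative - deriv (deriv g) z) (at z)"
    using d' by (auto intro!: derivative_eq_intros)
  from has_partials_Im[OF this]
  have I: "has_partials (\<lambda>w. - Im (deriv g w)) (- Im (deriv (deriv g) z)) (- Re (deriv (deriv g) z)) z"
    by simp
  have "has_partials (\<lambda>z. Re (deriv g z) *\<^sub>R pdx F (g z) + Im (deriv g z) *\<^sub>R pdy F (g z)) a b z \<Longrightarrow>
    has_partials (pdx (\<lambda>z. F (g z))) a b z" for a b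
    by (rule has_partials_cong[OF _ g(2) z], assumption)
      (use compose_partials[OF C(3) g(1,2)] g in auto)
  from this[OF has_partials_add[OF has_partials_scaleR[OF has_partials_Re[OF d'] X]
     has_partials_scaleR[OF has_partials_Im[OF d'] Y]], THEN has_partials_unique]
  have 1: "pdx (pdx (\<lambda>z. F (g z))) z = Re (deriv g z) *\<^sub>R (Re (deriv g z) *\<^sub>R pdx (pdx F) (g z)
      + Im (deriv g z) *\<^sub>R pdy (pdx F) (g z)) +
     Re (deriv (deriv g) z) *\<^sub>R pdx F (g z) +
     (Im (deriv g z) *\<^sub>R (Re (deriv g z) *\<^sub>R pdx (pdy F) (g z) + Im (deriv g z) *\<^sub>R pdy (pdy F) (g z)) +
      Im (deriv (deriv g) z) *\<^sub>R pdy F (g z))" by blast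
  have "has_partials (\<lambda>z. - Im (deriv g z) *\<^sub>R pdx F (g z) + Re (deriv g z) *\<^sub>R pdy F (g z)) a b z \<Longrightarrow>
    has_partials (pdy (\<lambda>z. F (g z))) a b z" for a b
    by (rule has_partials_cong[OF _ g(2) z], assumption)
      (use compose_partials[OF C(3) g(1,2)] g in auto)
  from this[OF has_partials_add[OF has_partials_scaleR[OF I X]
     has_partials_scaleR[OF has_partials_Re[OF d'] Y]], THEN has_partials_unique]
  have 2: "pdy (pdy (\<lambda>z. F (g z))) z = - Im (deriv g z) *\<^sub>R (- Im (deriv g z) *\<^sub>R pdx (pdx F) (g z)
      + Re (deriv g z) *\<^sub>R pdy (pdx F) (g z)) +
     - Re (deriv (deriv g) z) *\<^sub>R pdx F (g z) +
     (Re (deriv g z) *\<^sub>R (- Im (deriv g z) *\<^sub>R pdx (pdy F) (g z) + Re (deriv g z) *\<^sub>R pdy (pdy F) (g z)) +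
      - Im (deriv (deriv g) z) *\<^sub>R pdy F (g z))" by blast
  show ?thesis
    unfolding 1 2 cmod_power2 by (simp add: algebra_simps power2_eq_square)
qed

lemma has_vector_derivative_partials:
  assumes "has_partials F a b (Complex x y)"
  shows "((\<lambda>x. F (Complex x y)) has_vector_derivative a) (at x)"
    and "((\<lambda>y. F (Complex x y)) has_vector_derivative b) (at y)"
proof -
  have "((\<lambda>x. Complex x y) has_derivative (\<lambda>h. complex_of_real h)) (at x)"
    unfolding Complex_eq by (auto intro!: derivative_eq_intros)
  from has_derivative_compose[OF this assms[unfolded has_partials_def]]
  show "((\<lambda>x. F (Complex x y)) has_vector_derivative a) (at x)"
    by (simp add: has_vector_derivative_def)
  have "((\<lambda>y. Complex x y) has_derivative (\<lambda>h. \<i> * complex_of_real h)) (at y)"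
    unfolding Complex_eq by (auto intro!: derivative_eq_intros)
  from has_derivative_compose[OF this assms[unfolded has_partials_def]]
  show "((\<lambda>y. F (Complex x y)) has_vector_derivative b) (at y)"
    by (simp add: has_vector_derivative_def)
qed

lemma continuous_on_Complex [continuous_intros]:
  assumes "continuous_on S f" "continuous_on S g"
  shows "continuous_on S (\<lambda>x. Complex (f x) (g x))"
  unfolding Complex_eq by (intro continuous_intros assms)

text \<open>Differentiate \<open>F(x, y) = F(x, c) + \<integral> F\<^sub>y(x, t) dt\<close> (from \<open>c\<close> to \<open>y\<close>) first in \<open>x\<close>, then in \<open>y\<close>.\<close>

lemma mixed_partials_commute:
  fixes F :: "complex \<Rightarrow> 'h::banach"
  assumes F: "C2_on F S" and S: "open S" "z \<in> S"
  shows "pdy (pdx F) z = pdx (pdy F) z"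
proof -
  have C: "C1_on (pdx F) S" "C1_on (pdy F) S" "C1_on F S"
    using F C2_on_C1_on[OF F] by (auto simp: C2_on_def)
  obtain e where e: "e > 0" "ball z e \<subseteq> S" using S openE by blast
  define d where "d = e / 2"
  have d: "d > 0" using e by (simp add: d_def)
  define X where "X = {Re z - d / 2..Re z + d / 2}"
  define c where "c = Im z - d / 2"
  define Y where "Y = {c..Im z + d / 2}"
  have sq: "Complex x y \<in> S" if "x \<in> X" "y \<in> Y" for x y
  proof -
    have "dist z (Complex x y) \<le> \<bar>Re z - x\<bar> + \<bar>Im z - y\<bar>"
      using cmod_le[of "z - Complex x y"] by (simp add: dist_norm)
    also have "\<dots> < e" using that d by (auto simp: X_def Y_def c_def d_def abs_if field_simps split:
        if_splits)
    finally show ?thesis using e by auto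
  qed
  have int: "(\<lambda>t. G (Complex x t)) integrable_on cbox c y" if "C1_on G S" "x \<in> X" "y \<in> Y"
      for G :: "complex \<Rightarrow> 'h" and x y
    by (rule integrable_continuous, rule continuous_on_compose2[OF C1_on_continuous[OF that(1)]])
      (use that sq in \<open>auto intro!: continuous_intros simp: Y_def\<close>)
  have ftc: "F (Complex x y) = F (Complex x c) + integral (cbox c y) (\<lambda>t. pdy F (Complex x t))"
    if "x \<in> X" "y \<in> Y" for x y
  proof -
    have "((\<lambda>t. pdy F (Complex x t)) has_integral F (Complex x y) - F (Complex x c)) {c..y}"
      by (rule fundamental_theorem_of_calculus)
        (use that sq in \<open>auto simp: Y_def intro!: has_vector_derivative_at_within[OF
            has_vector_derivative_partials(2)[OF C1_on_partials[OF C(3)]]]\<close>)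
    then show ?thesis by (auto dest: integral_unique)
  qed
  have zX: "Re z \<in> X" "Im z \<in> Y" "c \<in> Y" using d by (auto simp: X_def Y_def c_def)
  have dx: "pdx F (Complex (Re z) y) = pdx F (Complex (Re z) c)
      + integral (cbox c y) (\<lambda>t. pdx (pdy F) (Complex (Re z) t))"
    if y: "y \<in> Y" for y
  proof -
    have 1: "((\<lambda>x. integral (cbox c y) (\<lambda>t. pdy F (Complex x t))) has_vector_derivative
      integral (cbox c y) (\<lambda>t. pdx (pdy F) (Complex (Re z) t))) (at (Re z) within X)"
    proof (rule leibniz_rule_vector_derivative)
      fix x t assume x: "x \<in> X" and "t \<in> cbox c y"
      then have "t \<in> Y" using y by (auto simp: Y_def)
      from has_vector_derivative_at_within[OF has_vector_derivative_partials(1)[OF C1_on_partials[OF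
          C(2) sq[OF x this]]]]
      show "((\<lambda>x. pdy F (Complex x t)) has_vector_derivative pdx (pdy F) (Complex x t)) (at x within
          X)" .
    next
      show "continuous_on (X \<times> cbox c y) (\<lambda>(x, t). pdx (pdy F) (Complex x t))"
        unfolding case_prod_beta
        by (rule continuous_on_compose2[of S "pdx (pdy F)"])
          (use C y sq in \<open>auto simp: C1_on_def Y_def intro!: continuous_intros\<close>)
    qed (use zX y int C in \<open>auto simp: X_def\<close>)
    have 2: "((\<lambda>x. F (Complex x c)) has_vector_derivative pdx F (Complex (Re z) c)) (at (Re z)
        within X)"
      using has_vector_derivative_at_within[OF has_vector_derivative_partials(1)[OF
          C1_on_partials[OF C(3) sq[OF zX(1) zX(3)]]]] .
    have "((\<lambda>x. F (Complex x y)) has_vector_derivative pdx F (Complex (Re z) c) +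
       integral (cbox c y) (\<lambda>t. pdx (pdy F) (Complex (Re z) t))) (at (Re z) within X)"
      by (rule has_vector_derivative_transform[OF zX(1) _ has_vector_derivative_add[OF 2 1]]) (use
          ftc y in auto)
    moreover have "((\<lambda>x. F (Complex x y)) has_vector_derivative pdx F (Complex (Re z) y)) (at (Re z)
        within X)"
      using has_vector_derivative_at_within[OF has_vector_derivative_partials(1)[OF
          C1_on_partials[OF C(3) sq[OF zX(1) y]]]] .
    moreover have "at (Re z) within X \<noteq> bot"
      using d by (auto simp: X_def trivial_limit_within islimpt_Icc)
    ultimately show ?thesis by (metis vector_derivative_unique_within)
  qed
  have "((\<lambda>y. integral {c..y} (\<lambda>t. pdx (pdy F) (Complex (Re z) t))) has_vector_derivative pdx (pdy
      F) (Complex (Re z) (Im z))) (at (Im z) within Y)"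
    unfolding Y_def
  proof (rule integral_has_vector_derivative)
    show "continuous_on {c..Im z + d / 2} (\<lambda>t. pdx (pdy F) (Complex (Re z) t))"
      by (rule continuous_on_compose2[of S "pdx (pdy F)"])
        (use C zX sq in \<open>auto simp: C1_on_def Y_def intro!: continuous_intros\<close>)
  qed (use zX in \<open>simp add: Y_def\<close>)
  from has_vector_derivative_add[OF has_vector_derivative_const this]
  have "((\<lambda>y. pdx F (Complex (Re z) y)) has_vector_derivative 0
      + pdx (pdy F) (Complex (Re z) (Im z))) (at (Im z) within Y)"
    by (rule has_vector_derivative_transform[OF zX(2), rotated]) (use dx in auto)
  moreover have "((\<lambda>y. pdx F (Complex (Re z) y)) has_vector_derivative pdy (pdx F) (Complex (Re z)
      (Im z))) (at (Im z) within Y)"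
    using has_vector_derivative_at_within[OF has_vector_derivative_partials(2)[OF C1_on_partials[OF
        C(1) sq[OF zX(1) zX(2)]]]] .
  moreover have "at (Im z) within Y \<noteq> bot"
    using d by (auto simp: Y_def c_def trivial_limit_within islimpt_Icc)
  ultimately have "pdy (pdx F) (Complex (Re z) (Im z)) = 0 + pdx (pdy F) (Complex (Re z) (Im z))"
    by (metis vector_derivative_unique_within)
  then show ?thesis by simp
qed

section \<open>Harmonic maps in a chart of the target\<close>

text \<open>The coordinate expression of a metric in one chart, detached from the manifold so that
  the estimates concern an open subset of the model space.\<close>

definition metric_on :: "'h::euclidean_space set \<Rightarrow> ('h \<Rightarrow> 'h \<Rightarrow> 'h \<Rightarrow> real) \<Rightarrow> bool"
  where "metric_on V K \<longleftrightarrow> open V \<and>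
    (\<forall>x\<in>V. bilinear (K x) \<and> (\<forall>u v. K x u v = K x v u) \<and> (\<forall>u. u \<noteq> 0 \<longrightarrow> K x u u > 0)) \<and>
    (\<forall>u v. Ck_on 2 (\<lambda>x. K x u v) V)"

definition metric_deriv :: "('h::euclidean_space \<Rightarrow> 'h \<Rightarrow> 'h \<Rightarrow> real) \<Rightarrow> 'h \<Rightarrow> 'h \<Rightarrow> 'h \<Rightarrow> 'h \<Rightarrow> real"
  where "metric_deriv K x a u v = frechet_derivative (\<lambda>y. K y u v) (at x) a"

text \<open>Christoffel symbols of the first kind. They involve no inverse of the metric, so
  trilinearity, bounds and Lipschitz estimates are inherited directly from the first derivatives of
  \<open>K\<close>.\<close>

definition christoffel1 :: "('h::euclidean_space \<Rightarrow> 'h \<Rightarrow> 'h \<Rightarrow> real) \<Rightarrow> 'h \<Rightarrow> 'h \<Rightarrow> 'h \<Rightarrow> 'h \<Rightarrow> real"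
  where "christoffel1 K x u v w =
    (metric_deriv K x u v w + metric_deriv K x v u w - metric_deriv K x w u v) / 2"

lemma Ck_on_Suc_differentiable: "Ck_on (Suc k) F S \<Longrightarrow> x \<in> S \<Longrightarrow> F differentiable (at x)"
  by simp

lemma Ck_on_continuous: "Ck_on k F S \<Longrightarrow> continuous_on S F"
  by (cases k) (auto intro!: continuous_at_imp_continuous_on differentiable_imp_continuous_within)

lemma metric_onD:
  assumes "metric_on V K"
  shows "open V" and "\<And>x. x \<in> V \<Longrightarrow> bilinear (K x)"
    and "\<And>x u v. x \<in> V \<Longrightarrow> K x u v = K x v u"
    and "\<And>x u. x \<in> V \<Longrightarrow> u \<noteq> 0 \<Longrightarrow> K x u u > 0"
    and "\<And>u v. Ck_on 2 (\<lambda>x. K x u v) V"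
    and "\<And>x u v. x \<in> V \<Longrightarrow> (\<lambda>x. K x u v) differentiable (at x)"
    and "\<And>a u v. Ck_on 1 (\<lambda>x. metric_deriv K x a u v) V"
proof -
  show "Ck_on 2 (\<lambda>x. K x u v) V" for u v
    using assms by (auto simp: metric_on_def)
  then have C: "Ck_on (Suc 1) (\<lambda>x. K x u v) V" for u v by (simp add: numeral_2_eq_2)
  then show "(\<lambda>x. K x u v) differentiable (at x)" if "x \<in> V" for x u v
    using that Ck_on_Suc_differentiable by blast
  show "Ck_on 1 (\<lambda>x. metric_deriv K x a u v) V" for a u v
    using C[of u v] unfolding metric_deriv_def Ck_on.simps(2)[of 1] by blast
qed (use assms in \<open>auto simp: metric_on_def\<close>)

lemma metric_deriv_has_derivative:
  assumes "metric_on V K" "x \<in> V"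
  shows "((\<lambda>y. K y u v) has_derivative (\<lambda>a. metric_deriv K x a u v)) (at x)"
  unfolding metric_deriv_def using metric_onD(6)[OF assms] frechet_derivative_works
  by (metis (no_types, lifting) ext)

lemma metric_deriv_eqI:
  assumes "metric_on V K" "x \<in> V" "((\<lambda>y. K y u v) has_derivative D) (at x)"
  shows "metric_deriv K x a u v = D a"
  using has_derivative_unique[OF metric_deriv_has_derivative[OF assms(1,2)] assms(3)] by meson

lemma metric_deriv_sym:
  assumes "metric_on V K" "x \<in> V"
  shows "metric_deriv K x a u v = metric_deriv K x a v u"
  by (rule metric_deriv_eqI[OF assms],
      rule has_derivative_transform_within_open[OF metric_deriv_has_derivative[OF assms]
          metric_onD(1)[OF assms(1)] assms(2)])
    (use metric_onD[OF assms(1)] in auto)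

lemma metric_deriv_linear:
  assumes m: "metric_on V K" and x: "x \<in> V"
  shows "linear (\<lambda>a. metric_deriv K x a u v)" and "linear (\<lambda>u. metric_deriv K x a u v)"
    and "linear (\<lambda>v. metric_deriv K x a u v)"
proof -
  note D = metric_onD[OF m]
  show "linear (\<lambda>a. metric_deriv K x a u v)" for u v
    using has_derivative_linear[OF metric_deriv_has_derivative[OF m x]] .
  show 2: "linear (\<lambda>u. metric_deriv K x a u v)" for a v
  proof (rule linearI)
    fix u u' and r :: real
    show "metric_deriv K x a (u + u') v = metric_deriv K x a u v + metric_deriv K x a u' v"
      by (rule metric_deriv_eqI[OF m x], rule has_derivative_transform_within_open[OF
          has_derivative_add[OF metric_deriv_has_derivative[OF m x] metric_deriv_has_derivative[OF m
              x]] D(1) x])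
        (use D(2) in \<open>auto simp: bilinear_ladd\<close>)
    show "metric_deriv K x a (r *\<^sub>R u) v = r *\<^sub>R metric_deriv K x a u v"
      by (rule metric_deriv_eqI[OF m x], rule has_derivative_transform_within_open[OF
          has_derivative_scaleR_right[OF metric_deriv_has_derivative[OF m x]] D(1) x])
        (use D(2) in \<open>auto simp: bilinear_lmul\<close>)
  qed
  show "linear (\<lambda>v. metric_deriv K x a u v)"
    using 2[of a u] metric_deriv_sym[OF m x] by simp
qed

lemma christoffel1_linear:
  assumes m: "metric_on V K" and x: "x \<in> V"
  shows "linear (\<lambda>u. christoffel1 K x u v w)" and "linear (\<lambda>v. christoffel1 K x u v w)"
    and "linear (\<lambda>w. christoffel1 K x u v w)"
  unfolding christoffel1_def
  using metric_deriv_linear[OF m x] by (simp_all add: linear_iff field_simps)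

section \<open>Uniform bounds for the metric on compact convex sets\<close>

lemma linear_bound_basis:
  fixes f :: "'h::euclidean_space \<Rightarrow> real"
  assumes "linear f" "\<And>b. b \<in> Basis \<Longrightarrow> \<bar>f b\<bar> \<le> B"
  shows "\<bar>f u\<bar> \<le> B * DIM('h) * norm u"
proof -
  have "f u = f (\<Sum>b\<in>Basis. (u \<bullet> b) *\<^sub>R b)" by (simp add: euclidean_representation)
  also have "\<dots> = (\<Sum>b\<in>Basis. (u \<bullet> b) * f b)"
    using assms(1) by (simp add: linear_sum linear_scale)
  finally have "\<bar>f u\<bar> \<le> (\<Sum>b\<in>Basis. \<bar>(u \<bullet> b) * f b\<bar>)" by simp
  also have "\<dots> \<le> (\<Sum>b\<in>(Basis::'h set). norm u * B)"
    by (rule sum_mono) (auto simp: abs_mult Basis_le_norm intro!: mult_mono assms(2))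
  finally show ?thesis by (simp add: mult_ac)
qed

lemma bilinear_bound_basis:
  fixes f :: "'h::euclidean_space \<Rightarrow> 'h \<Rightarrow> real"
  assumes "\<And>v. linear (\<lambda>u. f u v)" "\<And>u. linear (\<lambda>v. f u v)"
    "\<And>b c. b \<in> Basis \<Longrightarrow> c \<in> Basis \<Longrightarrow> \<bar>f b c\<bar> \<le> B"
  shows "\<bar>f u v\<bar> \<le> B * DIM('h) ^ 2 * norm u * norm v"
proof -
  have "\<bar>f u v\<bar> \<le> (B * DIM('h) * norm u) * DIM('h) * norm v"
    by (rule linear_bound_basis[OF assms(2)] linear_bound_basis[OF assms(1)] assms(3); assumption?)+
  then show ?thesis by (simp add: power2_eq_square mult_ac)
qed

lemma trilinear_bound_basis:
  fixes f :: "'h::euclidean_space \<Rightarrow> 'h \<Rightarrow> 'h \<Rightarrow> real"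
  assumes "\<And>v w. linear (\<lambda>u. f u v w)" "\<And>u w. linear (\<lambda>v. f u v w)" "\<And>u v. linear (\<lambda>w. f u v w)"
    "\<And>b c d. b \<in> Basis \<Longrightarrow> c \<in> Basis \<Longrightarrow> d \<in> Basis \<Longrightarrow> \<bar>f b c d\<bar> \<le> B"
  shows "\<bar>f u v w\<bar> \<le> B * DIM('h) ^ 3 * norm u * norm v * norm w"
proof -
  have "\<bar>f u v w\<bar> \<le> (B * DIM('h) ^ 2 * norm u * norm v) * DIM('h) * norm w"
    by (rule linear_bound_basis[OF assms(3)] bilinear_bound_basis[OF assms(1,2)] assms(4); assumption?)+
  then show ?thesis by (simp add: power3_eq_cube power2_eq_square mult_ac)
qed

lemma finite_common_bound:
  fixes \<phi> :: "'i \<Rightarrow> 'x \<Rightarrow> real"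
  assumes "finite I" "\<And>i. i \<in> I \<Longrightarrow> \<exists>B. \<forall>x\<in>X. \<phi> i x \<le> B"
  shows "\<exists>B\<ge>0. \<forall>i\<in>I. \<forall>x\<in>X. \<phi> i x \<le> B"
proof -
  obtain B where B: "\<And>i x. i \<in> I \<Longrightarrow> x \<in> X \<Longrightarrow> \<phi> i x \<le> B i" using assms(2) by metis
  have "\<phi> i x \<le> (\<Sum>i\<in>I. \<bar>B i\<bar>)" if "i \<in> I" "x \<in> X" for i x
    using B[OF that] member_le_sum[OF that(1), of "\<lambda>i. \<bar>B i\<bar>"] assms(1) by force
  then show ?thesis by (intro exI[of _ "\<Sum>i\<in>I. \<bar>B i\<bar>"]) (auto intro: sum_nonneg)
qed

lemma compact_bound:
  fixes \<phi> :: "'a::metric_space \<Rightarrow> real"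
  assumes "continuous_on X \<phi>" "compact X"
  shows "\<exists>B. \<forall>x\<in>X. \<bar>\<phi> x\<bar> \<le> B"
  using compact_imp_bounded[OF compact_continuous_image[OF assms]] by (auto simp: bounded_iff)

lemma Ck_on_1_lipschitz:
  fixes \<phi> :: "'h::euclidean_space \<Rightarrow> real"
  assumes \<phi>: "Ck_on 1 \<phi> V" and X: "compact X" "convex X" "X \<subseteq> V"
  shows "\<exists>L. \<forall>x\<in>X. \<forall>y\<in>X. \<bar>\<phi> x - \<phi> y\<bar> \<le> L * norm (x - y)"
proof -
  have d: "\<phi> differentiable (at x)" if "x \<in> X" for x using \<phi> X that by auto
  have "\<exists>B\<ge>0. \<forall>b\<in>Basis. \<forall>x\<in>X. \<bar>frechet_derivative \<phi> (at x) b\<bar> \<le> B"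
    using \<phi> X by (intro finite_common_bound compact_bound) (auto intro: continuous_on_subset)
  then obtain B where B: "B \<ge> 0" "\<And>b x. b \<in> Basis \<Longrightarrow> x \<in> X \<Longrightarrow> \<bar>frechet_derivative \<phi> (at x) b\<bar> \<le> B"
    by blast
  have "norm (\<phi> x - \<phi> y) \<le> (B * DIM('h)) * norm (x - y)" if "x \<in> X" "y \<in> X" for x y
  proof (rule differentiable_bound[OF X(2)])
    fix x assume x: "x \<in> X"
    show "(\<phi> has_derivative frechet_derivative \<phi> (at x)) (at x within X)"
      using d[OF x] frechet_derivative_works has_derivative_at_withinI by blast
    have "linear (frechet_derivative \<phi> (at x))" using d[OF x] by (rule linear_frechet_derivative)
    from linear_bound_basis[OF this B(2)[OF _ x]]
    show "onorm (frechet_derivative \<phi> (at x)) \<le> B * DIM('h)"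
      using B(1) by (intro onorm_bound) auto
  qed (use that in auto)
  then show ?thesis by (intro exI[of _ "B * DIM('h)"]) auto
qed

lemma common_lipschitz:
  fixes \<phi> :: "'i \<Rightarrow> 'h::euclidean_space \<Rightarrow> real"
  assumes "finite I" "\<And>i. Ck_on 1 (\<phi> i) V" and X: "compact X" "convex X" "X \<subseteq> V"
  shows "\<exists>L\<ge>0. \<forall>i\<in>I. \<forall>x\<in>X. \<forall>y\<in>X. \<bar>\<phi> i x - \<phi> i y\<bar> \<le> L * norm (x - y)"
proof -
  obtain L where L: "\<And>i x y. x \<in> X \<Longrightarrow> y \<in> X \<Longrightarrow> \<bar>\<phi> i x - \<phi> i y\<bar> \<le> L i * norm (x - y)"
    using Ck_on_1_lipschitz[OF assms(2) X] by metis
  have "\<bar>\<phi> i x - \<phi> i y\<bar> \<le> (\<Sum>i\<in>I. \<bar>L i\<bar>) * norm (x - y)" if "i \<in> I" "x \<in> X" "y \<in> X" for i x y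
  proof -
    have "L i \<le> (\<Sum>i\<in>I. \<bar>L i\<bar>)"
      using member_le_sum[OF that(1), of "\<lambda>i. \<bar>L i\<bar>"] assms(1) by force
    from mult_right_mono[OF this norm_ge_zero, of "x - y"] show ?thesis using L[OF that(2,3), of i]
      by linarith
  qed
  then show ?thesis by (intro exI[of _ "\<Sum>i\<in>I. \<bar>L i\<bar>"]) (auto intro: sum_nonneg)
qed

lemma Ck_on_2_1: "Ck_on 2 F S \<Longrightarrow> Ck_on 1 F S"
  by (auto simp: numeral_2_eq_2 intro!: continuous_at_imp_continuous_on
      differentiable_imp_continuous_within)

lemma bilinear_expand:
  fixes f :: "'h::euclidean_space \<Rightarrow> 'h \<Rightarrow> real"
  assumes "bilinear f"
  shows "f u v = (\<Sum>b\<in>Basis. \<Sum>c\<in>Basis. (u \<bullet> b) * (v \<bullet> c) * f b c)"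
proof -
  have "f u v = f (\<Sum>b\<in>Basis. (u \<bullet> b) *\<^sub>R b) (\<Sum>c\<in>Basis. (v \<bullet> c) *\<^sub>R c)"
    by (simp add: euclidean_representation)
  also have "\<dots> = (\<Sum>(b,c)\<in>Basis \<times> Basis. f ((u \<bullet> b) *\<^sub>R b) ((v \<bullet> c) *\<^sub>R c))"
    by (rule bilinear_sum[OF assms])
  also have "\<dots> = (\<Sum>b\<in>Basis. \<Sum>c\<in>Basis. (u \<bullet> b) * (v \<bullet> c) * f b c)"
    unfolding sum.cartesian_product using assms
      by (auto simp: bilinear_lmul bilinear_rmul intro!: sum.cong)
  finally show ?thesis .
qed

lemma metric_lower_bound:
  assumes m: "metric_on V K" and X: "compact X" "X \<subseteq> V"
  shows "\<exists>c>0. \<forall>x\<in>X. \<forall>u. c * (norm u)\<^sup>2 \<le> K x u u"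
proof (cases "X = {}")
  case True then show ?thesis by (auto intro: exI[of _ 1])
next
  case False
  note D = metric_onD[OF m]
  let ?S = "X \<times> sphere (0::'a) 1"
  \<comment> \<open>Regularity of \<open>K\<close> is given for fixed vectors; joint continuity in
    point and vector comes from the expansion in a basis.\<close>
  have "continuous_on ?S (\<lambda>z. K (fst z) (snd z) (snd z)) \<longleftrightarrow>
    continuous_on ?S (\<lambda>z. \<Sum>b\<in>Basis. \<Sum>c\<in>Basis. (snd z \<bullet> b) * (snd z \<bullet> c) * K (fst z) b c)"
    using X D(2) by (intro continuous_on_cong refl bilinear_expand) auto
  moreover have "continuous_on ?S (\<lambda>z. K (fst z) b c)" for b c
    using X by (intro continuous_on_compose2[OF Ck_on_continuous[OF D(5)]]) (auto intro!:
        continuous_intros)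
  ultimately have cont: "continuous_on ?S (\<lambda>z. K (fst z) (snd z) (snd z))"
    by (simp add: continuous_intros)
  have "?S \<noteq> {}" "compact ?S"
    using False X by (auto intro!: compact_Times)
  from continuous_attains_inf[OF this(2,1) cont] obtain x0 u0 where
    xu: "x0 \<in> X" "norm u0 = 1" and le: "\<And>x u. x \<in> X \<Longrightarrow> norm u = 1 \<Longrightarrow> K x0 u0 u0 \<le> K x u u" by auto
  have pos: "K x0 u0 u0 > 0" by (rule D(4)) (use xu X in auto)
  have "K x0 u0 u0 * (norm u)\<^sup>2 \<le> K x u u" if x: "x \<in> X" for x u
  proof (cases "u = 0")
    case True
    then show ?thesis using bilinear_lzero[OF D(2)[of x]] x X by auto
  next
    case u: False
    let ?v = "(1 / norm u) *\<^sub>R u"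
    have v: "u = norm u *\<^sub>R ?v" "norm ?v = 1" using u by auto
    have b: "bilinear (K x)" using x X D(2) by auto
    have "K x u u = K x (norm u *\<^sub>R ?v) (norm u *\<^sub>R ?v)" using v(1) by simp
    also have "\<dots> = (norm u)\<^sup>2 * K x ?v ?v"
      by (simp only: bilinear_lmul[OF b] bilinear_rmul[OF b]) (simp add: power2_eq_square)
    finally show ?thesis using mult_left_mono[OF le[OF x v(2)], of "(norm u)\<^sup>2"] by (simp add: mult_ac)
  qed
  with pos show ?thesis by blast
qed

lemma abs_half_sum_le:
  fixes a b c t :: real
  assumes "\<bar>a\<bar> \<le> t" "\<bar>b\<bar> \<le> t" "\<bar>c\<bar> \<le> t"
  shows "\<bar>(a + b - c) / 2\<bar> \<le> 2 * t"
proof -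
  have "0 \<le> t" using assms(1) by linarith
  with assms have "\<bar>a + b - c\<bar> \<le> 4 * t" by linarith
  then show ?thesis by simp
qed

text \<open>The basis components of \<open>K\<close> and of its first derivatives are
  \<open>C\<^sup>1\<close> because the metric is \<open>C\<^sup>2\<close>, so on a compact convex
  set they are bounded and Lipschitz by the mean value inequality. Multilinearity extends this to
  all vectors, at the cost of powers of the dimension.\<close>

lemma metric_bounds:
  fixes K :: "'h::euclidean_space \<Rightarrow> 'h \<Rightarrow> 'h \<Rightarrow> real"
  assumes m: "metric_on V K" and X: "compact X" "convex X" "X \<subseteq> V"
  obtains c B L where "c > 0" "B \<ge> 0" "L \<ge> 0"
    "\<And>x u. x \<in> X \<Longrightarrow> c * (norm u)\<^sup>2 \<le> K x u u"
    "\<And>x u v w. x \<in> X \<Longrightarrow> \<bar>christoffel1 K x u v w\<bar> \<le> B * norm u * norm v * norm w"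
    "\<And>x y u v. x \<in> X \<Longrightarrow> y \<in> X \<Longrightarrow> \<bar>K x u v - K y u v\<bar> \<le> L * norm (x - y) * norm u * norm v"
    "\<And>x y u v w. x \<in> X \<Longrightarrow> y \<in> X \<Longrightarrow>
       \<bar>christoffel1 K x u v w - christoffel1 K y u v w\<bar> \<le> L * norm (x - y) * norm u * norm v * norm w"
proof -
  note D = metric_onD[OF m]
  have V: "x \<in> V" if "x \<in> X" for x using X that by auto
  obtain c where c: "c > 0" "\<And>x u. x \<in> X \<Longrightarrow> c * (norm u)\<^sup>2 \<le> K x u u"
    using metric_lower_bound[OF m X(1,3)] by blast
  have "\<exists>B\<ge>0. \<forall>i\<in>Basis \<times> Basis \<times> Basis. \<forall>x\<in>X. \<bar>metric_deriv K x (fst i) (fst (snd i)) (snd (snd i))\<bar>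
      \<le> B"
    using D(7)[THEN Ck_on_continuous] X
    by (intro finite_common_bound compact_bound) (auto intro: continuous_on_subset)
  then obtain B where B: "B \<ge> 0"
    "\<And>b c d x. b \<in> Basis \<Longrightarrow> c \<in> Basis \<Longrightarrow> d \<in> Basis \<Longrightarrow> x \<in> X \<Longrightarrow> \<bar>metric_deriv K x b c d\<bar> \<le> B"
    by fastforce
  have md: "\<bar>metric_deriv K x a u v\<bar> \<le> B * DIM('h) ^ 3 * norm a * norm u * norm v" if x: "x \<in> X"
      for x a u v
    by (rule trilinear_bound_basis) (use metric_deriv_linear[OF m V[OF x]] B(2) x in auto)
  have "\<exists>L\<ge>0. \<forall>i\<in>Basis \<times> Basis. \<forall>x\<in>X. \<forall>y\<in>X.
      \<bar>K x (fst i) (snd i) - K y (fst i) (snd i)\<bar> \<le> L * norm (x - y)"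
    by (rule common_lipschitz[OF _ Ck_on_2_1[OF D(5)] X]) auto
  then obtain L1 where L1: "L1 \<ge> 0"
    "\<And>b c x y. b \<in> Basis \<Longrightarrow> c \<in> Basis \<Longrightarrow> x \<in> X \<Longrightarrow> y \<in> X \<Longrightarrow> \<bar>K x b c - K y b c\<bar> \<le> L1 * norm (x - y)"
    by fastforce
  have K1: "\<bar>K x u v - K y u v\<bar> \<le> (L1 * norm (x - y)) * DIM('h) ^ 2 * norm u * norm v"
      if x: "x \<in> X" "y \<in> X" for x y u v
  proof (rule bilinear_bound_basis)
    show "\<bar>K x b c - K y b c\<bar> \<le> L1 * norm (x - y)" if "b \<in> Basis" "c \<in> Basis" for b c
      using L1(2)[OF that x] .
  qed (use D(2)[OF V] x in \<open>auto simp: bilinear_def intro!: linear_compose_sub\<close>)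
  have "\<exists>L\<ge>0. \<forall>i\<in>Basis \<times> Basis \<times> Basis. \<forall>x\<in>X. \<forall>y\<in>X.
      \<bar>metric_deriv K x (fst i) (fst (snd i)) (snd (snd i))
          - metric_deriv K y (fst i) (fst (snd i)) (snd (snd i))\<bar>
        \<le> L * norm (x - y)"
    by (rule common_lipschitz[OF _ D(7) X]) auto
  then obtain L2 where L2: "L2 \<ge> 0"
    "\<And>b c d x y. b \<in> Basis \<Longrightarrow> c \<in> Basis \<Longrightarrow> d \<in> Basis \<Longrightarrow> x \<in> X \<Longrightarrow> y \<in> X \<Longrightarrow>
      \<bar>metric_deriv K x b c d - metric_deriv K y b c d\<bar> \<le> L2 * norm (x - y)"
    by fastforce
  have K2: "\<bar>metric_deriv K x a u v - metric_deriv K y a u v\<bar>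
      \<le> (L2 * norm (x - y)) * DIM('h) ^ 3 * norm a * norm u * norm v"
    if x: "x \<in> X" "y \<in> X" for x y a u v
  proof (rule trilinear_bound_basis)
    show "\<bar>metric_deriv K x b c d - metric_deriv K y b c d\<bar> \<le> L2 * norm (x - y)"
        if "b \<in> Basis" "c \<in> Basis" "d \<in> Basis" for b c d
      using L2(2)[OF that x] .
  qed (use metric_deriv_linear[OF m V] x in \<open>auto intro!: linear_compose_sub\<close>)
  define n where "n = real DIM('h)"
  have n: "n \<ge> 0" by (simp add: n_def)
  show ?thesis
  proof (rule that[OF c(1), of "2 * (B * n ^ 3)" "L1 * n ^ 2 + 2 * (L2 * n ^ 3)"])
    show "0 \<le> 2 * (B * n ^ 3)" "0 \<le> L1 * n ^ 2 + 2 * (L2 * n ^ 3)"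
      using B L1(1) L2(1) n by auto
    show "c * (norm u)\<^sup>2 \<le> K x u u" if "x \<in> X" for x u using c(2)[OF that] .
    show "\<bar>christoffel1 K x u v w\<bar> \<le> 2 * (B * n ^ 3) * norm u * norm v * norm w" if x: "x \<in> X"
        for x u v w
    proof -
      let ?t = "B * n ^ 3 * norm u * norm v * norm w"
      have "\<bar>metric_deriv K x u v w\<bar> \<le> ?t" "\<bar>metric_deriv K x v u w\<bar> \<le> ?t"
          "\<bar>metric_deriv K x w u v\<bar> \<le> ?t"
        using md[OF x, of u v w] md[OF x, of v u w] md[OF x, of w u v] by (auto simp: n_def mult_ac)
      then have "\<bar>christoffel1 K x u v w\<bar> \<le> 2 * ?t" unfolding christoffel1_def by (rule abs_half_sum_le)
      then show ?thesis by (simp add: mult_ac)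
    qed
    show "\<bar>K x u v - K y u v\<bar> \<le> (L1 * n ^ 2 + 2 * (L2 * n ^ 3)) * norm (x - y) * norm u * norm v"
      if x: "x \<in> X" "y \<in> X" for x y u v
    proof -
      have "0 \<le> 2 * (L2 * n ^ 3) * norm (x - y) * norm u * norm v" using L2(1) n by auto
      with K1[OF x, of u v] show ?thesis by (simp add: algebra_simps n_def)
    qed
    show "\<bar>christoffel1 K x u v w - christoffel1 K y u v w\<bar>
      \<le> (L1 * n ^ 2 + 2 * (L2 * n ^ 3)) * norm (x - y) * norm u * norm v * norm w"
      if x: "x \<in> X" "y \<in> X" for x y u v w
    proof -
      let ?t = "L2 * n ^ 3 * norm (x - y) * norm u * norm v * norm w"
      let ?d = "\<lambda>u v w. metric_deriv K x u v w - metric_deriv K y u v w"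
      have "\<bar>?d u v w\<bar> \<le> ?t" "\<bar>?d v u w\<bar> \<le> ?t" "\<bar>?d w u v\<bar> \<le> ?t"
        using K2[OF x, of u v w] K2[OF x, of v u w] K2[OF x, of w u v] by (auto simp: n_def mult_ac)
      from abs_half_sum_le[OF this]
      have "\<bar>christoffel1 K x u v w - christoffel1 K y u v w\<bar> \<le> 2 * ?t"
        unfolding christoffel1_def by (simp add: field_simps)
      moreover have "0 \<le> L1 * n ^ 2 * norm (x - y) * norm u * norm v * norm w" using L1(1) n by auto
      ultimately show ?thesis by (simp add: algebra_simps)
    qed
  qed
qed

text \<open>The equation \<open>\<Delta>F + \<Gamma>(F\<^sub>x, F\<^sub>x) + \<Gamma>(F\<^sub>y,
  F\<^sub>y) = 0\<close> with its index lowered by pairing with \<open>w\<close>. The metric of the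
  domain does not appear, since in dimension two its conformal factor cancels.\<close>

definition harmonic_at :: "('h::euclidean_space \<Rightarrow> 'h \<Rightarrow> 'h \<Rightarrow> real) \<Rightarrow> (complex \<Rightarrow> 'h) \<Rightarrow> complex \<Rightarrow> bool"
  where "harmonic_at K F z \<longleftrightarrow> (\<forall>w.
    K (F z) (pdx (pdx F) z + pdy (pdy F) z) w + christoffel1 K (F z) (pdx F z) (pdx F z) w
    + christoffel1 K (F z) (pdy F z) (pdy F z) w = 0)"

text \<open>The derivative of \<open>g\<close> acts on the pair of partial derivatives as a rotation
  times its modulus, so the sum of the two Christoffel terms is multiplied by
  \<open>a\<^sup>2 + b\<^sup>2\<close>, exactly as the Laplacian is.\<close>

lemma harmonic_at_compose:
  assumes m: "metric_on V K" and F: "C2_on F T" and g: "g holomorphic_on S" "open S" "g ` S \<subseteq> T"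
    and z: "z \<in> S" and FV: "F (g z) \<in> V" and h: "harmonic_at K F (g z)"
  shows "harmonic_at K (\<lambda>z. F (g z)) z"
  unfolding harmonic_at_def
proof
  fix w
  have gz: "F differentiable (at (g z))" using F g z by (auto simp: C2_on_def)
  define a b where "a = Re (deriv g z)" and "b = Im (deriv g z)"
  define p q where "p = pdx F (g z)" and "q = pdy F (g z)"
  have n: "(norm (deriv g z))\<^sup>2 = a\<^sup>2 + b\<^sup>2" by (simp add: cmod_power2 a_def b_def)
  note lin = christoffel1_linear[OF m FV]
  let ?c = "\<lambda>u v. christoffel1 K (F (g z)) u v w"
  have 1: "?c (x + y) v = ?c x v + ?c y v" "?c v (x + y) = ?c v x + ?c v y"
    "?c (r *\<^sub>R x) v = r * ?c x v" "?c v (r *\<^sub>R x) = r * ?c v x" for x y v r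
    using linear_add[OF lin(1)] linear_add[OF lin(2)] linear_scale[OF lin(1)] linear_scale[OF
        lin(2)] by simp_all
  define Q where "Q = K (F (g z)) (pdx (pdx F) (g z) + pdy (pdy F) (g z)) w"
  have A: "K (F (g z)) ((norm (deriv g z))\<^sup>2 *\<^sub>R (pdx (pdx F) (g z) + pdy (pdy F) (g z))) w
    = (a\<^sup>2 + b\<^sup>2) * Q"
    unfolding n Q_def using bilinear_lmul[OF metric_onD(2)[OF m FV]] by simp
  have B: "?c (a *\<^sub>R p + b *\<^sub>R q) (a *\<^sub>R p + b *\<^sub>R q) + ?c ((- b) *\<^sub>R p + a *\<^sub>R q) ((- b) *\<^sub>R p + a *\<^sub>R q)
     = (a\<^sup>2 + b\<^sup>2) * (?c p p + ?c q q)"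
    unfolding 1 by (simp add: algebra_simps power2_eq_square)
  have C: "Q + (?c p p + ?c q q) = 0"
    using h unfolding harmonic_at_def p_def q_def Q_def by (simp add: add.assoc)
  show "K (F (g z)) (pdx (pdx (\<lambda>z. F (g z))) z + pdy (pdy (\<lambda>z. F (g z))) z) w +
      ?c (pdx (\<lambda>z. F (g z)) z) (pdx (\<lambda>z. F (g z)) z)
          + ?c (pdy (\<lambda>z. F (g z)) z) (pdy (\<lambda>z. F (g z)) z) = 0"
    unfolding laplacian_compose[OF F g z] compose_partials[of F g, OF gz g(1,2) z]
      a_def[symmetric] b_def[symmetric] p_def[symmetric] q_def[symmetric] A add.assoc B
    unfolding distrib_left[symmetric] C by simp
qed

text \<open>The difference of the two equations is tested with \<open>D\<close>, the difference of
  the Laplacians. Positivity of \<open>K\<close> gives \<open>c * (norm D)\<^sup>2\<close> on the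
  left, and every term on the right is Lipschitz in the point or in the first derivatives. The
  Laplacian of \<open>G\<close> has to be bounded because it multiplies the change of
  \<open>K\<close> between the two points.\<close>

lemma harmonic_difference_inequality:
  fixes K :: "'h::euclidean_space \<Rightarrow> 'h \<Rightarrow> 'h \<Rightarrow> real"
  assumes m: "metric_on V K" and X: "compact X" "convex X" "X \<subseteq> V" and M: "M \<ge> 0"
  shows "\<exists>C. \<forall>F G z. F z \<in> X \<longrightarrow> G z \<in> X \<longrightarrow> harmonic_at K F z \<longrightarrow> harmonic_at K G z \<longrightarrow>
    norm (pdx F z) \<le> M \<longrightarrow> norm (pdy F z) \<le> M \<longrightarrow> norm (pdx G z) \<le> M \<longrightarrow> norm (pdy G z) \<le> M \<longrightarrow>
    norm (pdx (pdx G) z + pdy (pdy G) z) \<le> M \<longrightarrow>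
    (norm ((pdx (pdx F) z + pdy (pdy F) z) - (pdx (pdx G) z + pdy (pdy G) z)))\<^sup>2
      \<le> C * ((norm (F z - G z))\<^sup>2 + (norm (pdx F z - pdx G z))\<^sup>2 + (norm (pdy F z - pdy G z))\<^sup>2)"
proof -
  from metric_bounds[OF m X] obtain c B L where c: "c > 0" and B: "B \<ge> 0" and L: "L \<ge> 0"
    and low: "\<And>x u. x \<in> X \<Longrightarrow> c * (norm u)\<^sup>2 \<le> K x u u"
    and chB: "\<And>x u v w. x \<in> X \<Longrightarrow> \<bar>christoffel1 K x u v w\<bar> \<le> B * norm u * norm v * norm w"
    and KL: "\<And>x y u v. x \<in> X \<Longrightarrow> y \<in> X \<Longrightarrow> \<bar>K x u v - K y u v\<bar> \<le> L * norm (x - y) * norm u * norm v"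
    and chL: "\<And>x y u v w. x \<in> X \<Longrightarrow> y \<in> X \<Longrightarrow>
       \<bar>christoffel1 K x u v w - christoffel1 K y u v w\<bar> \<le> L * norm (x - y) * norm u * norm v * norm w"
    by blast
  \<comment> \<open>\<open>L * M\<close> comes from the change of \<open>K\<close> against the
    Laplacian of \<open>G\<close>, \<open>2 * (L * M\<^sup>2)\<close> from moving the base point in
    the two Christoffel terms, and \<open>2 * (B * M)\<close> from changing their two arguments in
    turn.\<close>
  define A where "A = L * M + 2 * (L * M\<^sup>2) + 2 * (B * M)"
  have A: "A \<ge> 0" using L M B by (simp add: A_def)
  have pt: "(norm (P - Q))\<^sup>2 \<le> 3 * (A / c)\<^sup>2 * ((norm (x - y))\<^sup>2 + (norm (p1 - p2))\<^sup>2 + (norm (q1 - q2))\<^sup>2)"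
    if x: "x \<in> X" "y \<in> X" and bd: "norm p1 \<le> M" "norm q1 \<le> M" "norm p2 \<le> M" "norm q2 \<le> M" "norm Q \<le> M"
      and e1: "\<And>w. K x P w + christoffel1 K x p1 p1 w + christoffel1 K x q1 q1 w = 0"
      and e2: "\<And>w. K y Q w + christoffel1 K y p2 p2 w + christoffel1 K y q2 q2 w = 0"
    for x y P Q p1 q1 p2 q2
  proof (cases "P = Q")
    case False
    define D where "D = P - Q"
    have nD: "norm D > 0" using False by (simp add: D_def)
    have xV: "x \<in> V" "y \<in> V" using x X by auto
    have ch: "\<bar>christoffel1 K x p p D - christoffel1 K y p' p' D\<bar>
        \<le> (L * M\<^sup>2 * norm (x - y) + 2 * (B * M) * norm (p - p')) * norm D"
      if p: "norm p \<le> M" "norm p' \<le> M" for p p'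
    proof -
      have "christoffel1 K x p p D - christoffel1 K y p' p' D
        = (christoffel1 K x p p D - christoffel1 K y p p D) + christoffel1 K y (p - p') p D
            + christoffel1 K y p' (p - p') D"
        using linear_diff[OF christoffel1_linear(1)[OF m xV(2)]] linear_diff[OF
            christoffel1_linear(2)[OF m xV(2)]]
        by simp
      moreover have "\<bar>christoffel1 K x p p D - christoffel1 K y p p D\<bar>
          \<le> L * norm (x - y) * M * M * norm D"
        by (rule order_trans[OF chL[OF x]]) (use L M p in \<open>intro mult_mono mult_nonneg_nonneg; simp\<close>)
      moreover have "\<bar>christoffel1 K y (p - p') p D\<bar> \<le> B * norm (p - p') * M * norm D"
        by (rule order_trans[OF chB[OF x(2)]]) (use B M p in \<open>intro mult_mono mult_nonneg_nonneg; simp\<close>)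
      moreover have "\<bar>christoffel1 K y p' (p - p') D\<bar> \<le> B * M * norm (p - p') * norm D"
        by (rule order_trans[OF chB[OF x(2)]]) (use B M p in \<open>intro mult_mono mult_nonneg_nonneg; simp\<close>)
      ultimately show ?thesis by (simp add: algebra_simps power2_eq_square)
    qed
    have "K x D D = K x P D - K x Q D"
      unfolding D_def using bilinear_lsub[OF metric_onD(2)[OF m xV(1)]] by blast
    also have "\<dots> = - (K x Q D - K y Q D) - (christoffel1 K x p1 p1 D - christoffel1 K y p2 p2 D)
      - (christoffel1 K x q1 q1 D - christoffel1 K y q2 q2 D)"
      using e1[of D] e2[of D] by simp
    also have "\<dots> \<le> L * norm (x - y) * M * norm D + (L * M\<^sup>2 * norm (x - y) + 2 * (B * M) * norm (p1
        - p2)) * norm D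
      + (L * M\<^sup>2 * norm (x - y) + 2 * (B * M) * norm (q1 - q2)) * norm D"
    proof -
      have "\<bar>K x Q D - K y Q D\<bar> \<le> L * norm (x - y) * M * norm D"
        by (rule order_trans[OF KL[OF x]]) (use L M bd in \<open>intro mult_mono mult_nonneg_nonneg; simp\<close>)
      with ch[of p1 p2] ch[of q1 q2] bd show ?thesis by linarith
    qed
    also have "\<dots> \<le> (A * (norm (x - y) + norm (p1 - p2) + norm (q1 - q2))) * norm D"
    proof -
      have "L * norm (x - y) * M + (L * M\<^sup>2 * norm (x - y) + 2 * (B * M) * norm (p1 - p2))
        + (L * M\<^sup>2 * norm (x - y) + 2 * (B * M) * norm (q1 - q2)) = 
         (L * M + 2 * (L * M\<^sup>2)) * norm (x - y) + 2 * (B * M) * norm (p1 - p2)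
             + 2 * (B * M) * norm (q1 - q2)"
        by (simp add: algebra_simps)
      also have "\<dots> \<le> A * norm (x - y) + A * norm (p1 - p2) + A * norm (q1 - q2)"
      proof -
        have "0 \<le> L * M" "0 \<le> L * M\<^sup>2" "0 \<le> B * M" using L M B by auto
        then have "L * M + 2 * (L * M\<^sup>2) \<le> A" "2 * (B * M) \<le> A" unfolding A_def by linarith+
        then show ?thesis by (intro add_mono mult_right_mono norm_ge_zero)
      qed
      finally have "L * norm (x - y) * M + (L * M\<^sup>2 * norm (x - y) + 2 * (B * M) * norm (p1 - p2))
        + (L * M\<^sup>2 * norm (x - y) + 2 * (B * M) * norm (q1 - q2))
            \<le> A * (norm (x - y) + norm (p1 - p2) + norm (q1 - q2))"
        by (simp add: distrib_left)
      from mult_right_mono[OF this, of "norm D"] show ?thesis by (simp only: distrib_right norm_ge_zero)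
    qed
    finally have "c * (norm D)\<^sup>2 \<le> (A * (norm (x - y) + norm (p1 - p2) + norm (q1 - q2))) * norm D"
      using low[OF x(1), of D] by linarith
    then have "c * norm D \<le> A * (norm (x - y) + norm (p1 - p2) + norm (q1 - q2))"
      using nD by (simp add: power2_eq_square flip: mult.assoc)
    then have le: "norm D \<le> A / c * (norm (x - y) + norm (p1 - p2) + norm (q1 - q2))"
      using c by (simp add: pos_le_divide_eq mult_ac)
    have sq: "(r + s + t)\<^sup>2 \<le> 3 * (r\<^sup>2 + s\<^sup>2 + t\<^sup>2)" for r s t :: real
    proof -
      have "0 \<le> (r - s)\<^sup>2 + (s - t)\<^sup>2 + (r - t)\<^sup>2" by simp
      then show ?thesis by (simp add: power2_eq_square algebra_simps)
    qed
    have "(norm D)\<^sup>2 \<le> (A / c)\<^sup>2 * (norm (x - y) + norm (p1 - p2) + norm (q1 - q2))\<^sup>2"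
      using power_mono[OF le, of 2] by (simp only: power_mult_distrib norm_ge_zero)
    also have "\<dots> \<le> (A / c)\<^sup>2 * (3 * ((norm (x - y))\<^sup>2 + (norm (p1 - p2))\<^sup>2 + (norm (q1 - q2))\<^sup>2))"
      by (intro mult_left_mono sq) auto
    finally show ?thesis by (simp only: D_def mult_ac)
  qed (use A c in simp)
  show ?thesis
    by (intro exI[of _ "3 * (A / c)\<^sup>2"] allI impI pt) (auto simp: harmonic_at_def)
qed

section \<open>Unique continuation\<close>

lemma cylinder_C1_diff:
  assumes "cylinder_C1 a b T p px py" "cylinder_C1 a b T q qx qy"
  shows "cylinder_C1 a b T (\<lambda>x y. p x y - q x y) (\<lambda>x y. px x y - qx x y)
    (\<lambda>x y. py x y - qy x y)"
  using cylinder_C1_add[OF assms(1) cylinder_C1_minus[OF assms(2)]] by simp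

lemma partials_periodic:
  assumes "\<And>s. Re s < c \<Longrightarrow> U (s + \<i> * of_real T) = U s" "C1_on U {s. Re s < c}" "Re s < c"
  shows "pdx U (s + \<i> * of_real T) = pdx U s" "pdy U (s + \<i> * of_real T) = pdy U s"
proof -
  let ?t = "s + \<i> * of_real T"
  have "has_partials U (pdx U ?t) (pdy U ?t) ?t"
    by (rule C1_on_partials[OF assms(2)]) (use assms(3) in simp)
  moreover have "((\<lambda>s. s + \<i> * of_real T) has_field_derivative 1) (at s)"
    by (auto intro!: derivative_eq_intros)
  ultimately have "has_partials (\<lambda>s. U (s + \<i> * of_real T)) (pdx U ?t) (pdy U ?t) s"
    using has_partials_compose[of U _ _ "\<lambda>s. s + \<i> * of_real T" s 1] by fastforce
  from has_partials_cong[OF this, of "{s. Re s < c}" U]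
  have "has_partials U (pdx U ?t) (pdy U ?t) s"
    using assms(1,3) open_halfspace_Re_lt by auto
  from has_partials_unique[OF this] show "pdx U ?t = pdx U s" "pdy U ?t = pdy U s" by auto
qed

lemma C1_on_cylinder:
  assumes U: "C1_on U {s. Re s < c}" and per: "\<And>s. Re s < c \<Longrightarrow> U (s + \<i> * of_real T) = U s" and "b < c"
  shows "cylinder_C1 a b T (\<lambda>x y. U (Complex x y)) (\<lambda>x y. pdx U (Complex x y)) (\<lambda>x y. pdy U (Complex
      x y))"
proof -
  have P: "has_partials U (pdx U (Complex x y)) (pdy U (Complex x y)) (Complex x y)" if "x \<in> {a..b}"
      for x y
    by (rule C1_on_partials[OF U]) (use that assms(3) in auto)
  have c: "continuous_on ({a..b} \<times> UNIV) (\<lambda>z. G (Complex (fst z) (snd z)))"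
      if "continuous_on {s. Re s < c} G" for G :: "complex \<Rightarrow> 'a"
    by (rule continuous_on_compose2[OF that]) (use assms(3) in \<open>auto intro!: continuous_intros\<close>)
  have e: "Complex x (y + T) = Complex x y + \<i> * of_real T" for x y by (simp add: complex_eq_iff)
  show ?thesis
    unfolding cylinder_C1_def
  proof (intro conjI ballI allI c)
    fix x y assume x: "x \<in> {a..b}"
    show "((\<lambda>x. U (Complex x y)) has_vector_derivative pdx U (Complex x y)) (at x within {a..b})"
      using has_vector_derivative_at_within[OF has_vector_derivative_partials(1)[OF P[OF x]]] .
    show "((\<lambda>y. U (Complex x y)) has_vector_derivative pdy U (Complex x y)) (at y)"
      by (rule has_vector_derivative_partials(2)[OF P[OF x]])
    show "U (Complex x (y + T)) = U (Complex x y)" "pdx U (Complex x (y + T)) = pdx U (Complex x y)"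
      "pdy U (Complex x (y + T)) = pdy U (Complex x y)"
      unfolding e using x assms(3) by (auto intro!: per partials_periodic[OF per U])
  qed (use U C1_on_continuous[OF U] in \<open>auto simp: C1_on_def\<close>)
qed

lemma C2_on_cylinder:
  assumes U: "C2_on U {s. Re s < c}" and per: "\<And>s. Re s < c \<Longrightarrow> U (s + \<i> * of_real T) = U s" and "b < c"
  shows "cylinder_C1 a b T (\<lambda>x y. U (Complex x y)) (\<lambda>x y. pdx U (Complex x y)) (\<lambda>x y. pdy U (Complex
      x y))"
    and "cylinder_C1 a b T (\<lambda>x y. pdx U (Complex x y)) (\<lambda>x y. pdx (pdx U) (Complex x y)) (\<lambda>x y. pdy
        (pdx U) (Complex x y))"
    and "cylinder_C1 a b T (\<lambda>x y. pdy U (Complex x y)) (\<lambda>x y. pdx (pdy U) (Complex x y)) (\<lambda>x y. pdy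
        (pdy U) (Complex x y))"
proof -
  have C: "C1_on U {s. Re s < c}" "C1_on (pdx U) {s. Re s < c}" "C1_on (pdy U) {s. Re s < c}"
    using U C2_on_C1_on[OF U] by (auto simp: C2_on_def)
  show "cylinder_C1 a b T (\<lambda>x y. U (Complex x y)) (\<lambda>x y. pdx U (Complex x y)) (\<lambda>x y. pdy U (Complex
      x y))"
    using C1_on_cylinder[OF C(1) per assms(3)] .
  show "cylinder_C1 a b T (\<lambda>x y. pdx U (Complex x y)) (\<lambda>x y. pdx (pdx U) (Complex x y)) (\<lambda>x y. pdy
      (pdx U) (Complex x y))"
    "cylinder_C1 a b T (\<lambda>x y. pdy U (Complex x y)) (\<lambda>x y. pdx (pdy U) (Complex x y)) (\<lambda>x y. pdy (pdy
        U) (Complex x y))"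
    by (rule C1_on_cylinder[OF C(2) _ assms(3)] C1_on_cylinder[OF C(3) _ assms(3)], rule
        partials_periodic[OF per C(1)]; assumption)+
qed

text \<open>In the coordinate \<open>s\<close> with \<open>z = z0 + exp s\<close> the punctured disc becomes a half-plane, on which
  both maps are periodic.\<close>

lemma harmonic_ball_unique_continuation:
  fixes F G :: "complex \<Rightarrow> 'h::euclidean_space"
  assumes m: "metric_on V K" and X: "compact X" "convex X" "X \<subseteq> V"
    and F: "C2_on F (ball z0 R)" "F ` ball z0 R \<subseteq> X" "\<And>z. z \<in> ball z0 R \<Longrightarrow> harmonic_at K F z"
    and G: "C2_on G (ball z0 R)" "G ` ball z0 R \<subseteq> X" "\<And>z. z \<in> ball z0 R \<Longrightarrow> harmonic_at K G z"
    and r: "r > 0" "\<And>z. z \<in> ball z0 r \<Longrightarrow> F z = G z"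
    and z: "z \<in> ball z0 R"
  shows "F z = G z"
proof (cases "z = z0")
  case True then show ?thesis using r by auto
next
  case False
  have R: "R > 0" using z by (auto intro: le_less_trans[OF zero_le_dist])
  define e where "e = (\<lambda>s. z0 + exp s)"
  define H where "H = {s. Re s < ln R}"
  have oH: "open H" unfolding H_def by (rule open_halfspace_Re_lt)
  have e: "e holomorphic_on H" unfolding e_def by (intro holomorphic_intros)
  have eR: "e s \<in> ball z0 t \<longleftrightarrow> Re s < ln t" if "t > 0" for s t
    using that by (simp add: e_def dist_norm) (metis exp_ln exp_less_cancel_iff)
  have eH: "e ` H \<subseteq> ball z0 R" using eR[OF R] by (auto simp: H_def)
  have per: "e (s + \<i> * of_real (2 * pi)) = e s" for s
    by (simp add: e_def exp_add mult.commute[of \<i>] exp_two_pi_i')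
  define F' where "F' = (\<lambda>s. F (e s))"
  define G' where "G' = (\<lambda>s. G (e s))"
  have C: "C2_on F' H" "C2_on G' H"
    unfolding F'_def G'_def by (rule C2_on_compose[OF F(1) e oH eH] C2_on_compose[OF G(1) e oH eH])+
  have h: "harmonic_at K F' s" "harmonic_at K G' s" if "s \<in> H" for s
  proof -
    have es: "e s \<in> ball z0 R" using that eH by blast
    then have "F (e s) \<in> V" "G (e s) \<in> V" using F(2) G(2) X(3) by blast+
    then show "harmonic_at K F' s" "harmonic_at K G' s"
      unfolding F'_def G'_def
      using harmonic_at_compose[OF m F(1) e oH eH that _ F(3)[OF es]]
        harmonic_at_compose[OF m G(1) e oH eH that _ G(3)[OF es]] by blast+
  qed
  have FX: "F' s \<in> X" "G' s \<in> X" if "s \<in> H" for s using that F(2) G(2) eH unfolding F'_def G'_def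
    by blast+
  define x where "x = ln (norm (z - z0))"
  define y where "y = Arg2pi (z - z0)"
  have zxy: "z = e (Complex x y)"
  proof -
    have "exp (Complex x y) = of_real (exp x) * exp (\<i> * of_real y)"
      by (simp add: Complex_eq exp_add exp_of_real)
    also have "\<dots> = z - z0" using False Arg2pi_eq[of "z - z0"] by (simp add: x_def y_def)
    finally show ?thesis by (simp add: e_def)
  qed
  have xR: "x < ln R" using z eR[OF R, of "Complex x y"] zxy by auto
  \<comment> \<open>The line \<open>Re s = a\<close> lies where the maps agree, so their difference
    and its gradient vanish on it. Stopping at \<open>b\<close>, short of \<open>ln R\<close>, keeps
    the rectangle \<open>Q\<close> compact inside \<open>H\<close>, which provides the bound
    \<open>M\<close>.\<close>
  define a where "a = min (ln r) x - 1"
  define b where "b = (x + ln R) / 2"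
  have ab: "a < x" "x < b" "b < ln R" "a < ln r" using xR by (auto simp: a_def b_def)
  have pF: "F' (s + \<i> * of_real (2 * pi)) = F' s" "G' (s + \<i> * of_real (2 * pi)) = G' s" for s
    by (simp_all only: F'_def G'_def per)
  note cF = C2_on_cylinder[OF C(1)[unfolded H_def] pF(1) ab(3), of a]
    and cG = C2_on_cylinder[OF C(2)[unfolded H_def] pF(2) ab(3), of a]
  have near: "F' s = G' s" if "Re s < ln r" for s
    using that r(2) eR[OF r(1)] by (auto simp: F'_def G'_def)
  define N where "N = {s. Re s < ln r} \<inter> H"
  have oN: "open N" unfolding N_def using oH by (intro open_Int open_halfspace_Re_lt)
  have aN: "Complex a t \<in> N" for t using ab xR by (auto simp: N_def H_def)
  have nearp: "pdx F' s = pdx G' s" "pdy F' s = pdy G' s" if "s \<in> N" for s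
  proof -
    have sH: "s \<in> H" using that by (auto simp: N_def)
    have "has_partials F' (pdx F' s) (pdy F' s) s"
      using C1_on_partials[OF C2_on_C1_on[OF C(1)] sH] .
    then have "has_partials G' (pdx F' s) (pdy F' s) s"
      by (rule has_partials_cong[OF _ oN that]) (simp add: near N_def)
    from has_partials_unique[OF this] show "pdx F' s = pdx G' s" "pdy F' s = pdy G' s" by auto
  qed
  define Q where "Q = cbox (Complex a 0) (Complex b (2 * pi))"
  have QH: "Q \<subseteq> H" using ab by (auto simp: Q_def H_def in_cbox_complex_iff)
  define \<phi> where "\<phi> = (\<lambda>s. norm (pdx F' s) + norm (pdy F' s) + norm (pdx G' s) + norm (pdy G' s)
     + norm (pdx (pdx G') s + pdy (pdy G') s))"
  have "continuous_on Q \<phi>"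
    unfolding \<phi>_def using C C2_on_C1_on[OF C(1)] C2_on_C1_on[OF C(2)]
    by (intro continuous_intros continuous_on_subset[OF _ QH]) (auto simp: C2_on_def C1_on_def)
  from compact_bound[OF this] obtain M where M: "\<And>s. s \<in> Q \<Longrightarrow> \<bar>\<phi> s\<bar> \<le> M"
    unfolding Q_def using compact_cbox by blast
  have M0: "\<bar>M\<bar> \<ge> 0" by simp
  obtain c where c: "\<And>F G z. F z \<in> X \<Longrightarrow> G z \<in> X \<Longrightarrow> harmonic_at K F z \<Longrightarrow> harmonic_at K G z \<Longrightarrow>
    norm (pdx F z) \<le> \<bar>M\<bar> \<Longrightarrow> norm (pdy F z) \<le> \<bar>M\<bar> \<Longrightarrow> norm (pdx G z) \<le> \<bar>M\<bar> \<Longrightarrow> norm (pdy G z) \<le> \<bar>M\<bar> \<Longrightarrow>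
    norm (pdx (pdx G) z + pdy (pdy G) z) \<le> \<bar>M\<bar> \<Longrightarrow>
    (norm ((pdx (pdx F) z + pdy (pdy F) z) - (pdx (pdx G) z + pdy (pdy G) z)))\<^sup>2
      \<le> c * ((norm (F z - G z))\<^sup>2 + (norm (pdx F z - pdx G z))\<^sup>2 + (norm (pdy F z - pdy G z))\<^sup>2)"
    using harmonic_difference_inequality[OF m X M0] by blast
  have "F' (Complex x y) - G' (Complex x y) = 0"
  proof (rule strip_unique_continuation[OF _ _ cylinder_C1_diff[OF cF(1) cG(1)] cylinder_C1_diff[OF
      cF(2) cG(2)]
        cylinder_C1_diff[OF cF(3) cG(3)]])
    show "a < b" "0 < 2 * pi" "x \<in> {a..<b}" "y \<in> {0..2 * pi}"
      using ab Arg2pi_ge_0[of "z - z0"] Arg2pi_lt_2pi[of "z - z0"] by (auto simp: y_def)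
    show "pdy (pdx F') (Complex x y) - pdy (pdx G') (Complex x y)
        = pdx (pdy F') (Complex x y) - pdx (pdy G') (Complex x y)"
      if "x \<in> {a..b}" for x y
      using mixed_partials_commute[OF C(1) oH] mixed_partials_commute[OF C(2) oH] that ab
        by (simp add: H_def)
    show "F' (Complex a y) - G' (Complex a y) = 0" "pdx F' (Complex a y) - pdx G' (Complex a y) = 0"
      "pdy F' (Complex a y) - pdy G' (Complex a y) = 0" for y
      using near[of "Complex a y"] nearp[OF aN] ab by simp_all
    fix x y assume "x \<in> {a..b}" "y \<in> {0..2 * pi}"
    then have q: "Complex x y \<in> Q" by (auto simp: Q_def in_cbox_complex_iff)
    then have qH: "Complex x y \<in> H" using QH by auto
    let ?s = "Complex x y"
    have "\<phi> ?s \<le> \<bar>M\<bar>" using M[OF q] by linarith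
    then have bds: "norm (pdx F' ?s) \<le> \<bar>M\<bar>" "norm (pdy F' ?s) \<le> \<bar>M\<bar>" "norm (pdx G' ?s) \<le> \<bar>M\<bar>"
        "norm (pdy G' ?s) \<le> \<bar>M\<bar>"
      "norm (pdx (pdx G') ?s + pdy (pdy G') ?s) \<le> \<bar>M\<bar>"
      unfolding \<phi>_def by (smt (verit) norm_ge_zero)+
    have eq: "pdx (pdx F') ?s - pdx (pdx G') ?s + (pdy (pdy F') ?s - pdy (pdy G') ?s) =
      (pdx (pdx F') ?s + pdy (pdy F') ?s) - (pdx (pdx G') ?s + pdy (pdy G') ?s)" by simp
    show "(norm (pdx (pdx F') ?s - pdx (pdx G') ?s + (pdy (pdy F') ?s - pdy (pdy G') ?s)))\<^sup>2
      \<le> c * ((norm (F' ?s - G' ?s))\<^sup>2 + (norm (pdx F' ?s - pdx G' ?s))\<^sup>2 + (norm (pdy F' ?s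
          - pdy G' ?s))\<^sup>2)"
      unfolding eq using c[OF FX[OF qH] h[OF qH] bds] .
  qed
  then show ?thesis by (simp add: F'_def G'_def zxy)
qed

text \<open>The domain is a bare open subset of the plane: harmonicity depends on the conformal
  structure alone, so the class is stable under holomorphic changes of variable, injective or
  not.\<close>

definition harmonic_plane ::
    "'b topology \<Rightarrow> ('b, 'h::euclidean_space) chart set \<Rightarrow> ('b, 'h) metric \<Rightarrow> complex set \<Rightarrow> (complex \<Rightarrow>
        'b) \<Rightarrow> bool"
  where "harmonic_plane Y B \<nu> S F \<longleftrightarrow> open S \<and> continuous_map (top_of_set S) Y F \<and>
    (\<forall>d\<in>B. C2_on (\<lambda>z. snd d (F z)) {z\<in>S. F z \<in> fst d} \<and>
      (\<forall>z\<in>S. F z \<in> fst d \<longrightarrow> harmonic_at (\<nu> d) (\<lambda>z. snd d (F z)) z))"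

lemma smooth_manifold_chart:
  assumes "smooth_manifold Y B" "d \<in> B"
  shows "openin Y (fst d)" "open (snd d ` fst d)" "inj_on (snd d) (fst d)"
    "homeomorphic_map (subtopology Y (fst d)) (top_of_set (snd d ` fst d)) (snd d)"
proof -
  have "is_chart Y d" using assms by (auto simp: smooth_manifold_def topological_manifold_def)
  then show *: "openin Y (fst d)" "open (snd d ` fst d)"
    "homeomorphic_map (subtopology Y (fst d)) (top_of_set (snd d ` fst d)) (snd d)"
    by (auto simp: is_chart_def)
  from homeomorphic_imp_injective_map[OF *(3)] show "inj_on (snd d) (fst d)"
    using openin_subset[OF *(1)] by (simp add: inf_absorb2)
qed

lemma smooth_manifold_cover: "smooth_manifold Y B \<Longrightarrow> y \<in> topspace Y \<Longrightarrow> \<exists>d\<in>B. y \<in> fst d"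
  unfolding smooth_manifold_def topological_manifold_def by blast

lemma riemannian_metric_on:
  assumes "smooth_manifold Y B" "C2_riemannian_metric B \<nu>" "d \<in> B"
  shows "metric_on (snd d ` fst d) (\<nu> d)"
  using assms(2,3) smooth_manifold_chart(2)[OF assms(1,3)]
  unfolding metric_on_def C2_riemannian_metric_def by blast

lemma harmonic_planeD:
  assumes "harmonic_plane Y B \<nu> S F" "smooth_manifold Y B"
  shows "open S" "continuous_map (top_of_set S) Y F"
    and "\<And>d. d \<in> B \<Longrightarrow> C2_on (\<lambda>z. snd d (F z)) {z\<in>S. F z \<in> fst d}"
    and "\<And>d z. d \<in> B \<Longrightarrow> z \<in> S \<Longrightarrow> F z \<in> fst d \<Longrightarrow> harmonic_at (\<nu> d) (\<lambda>z. snd d (F z)) z"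
    and "\<And>d. d \<in> B \<Longrightarrow> open {z\<in>S. F z \<in> fst d}"
    and "\<And>z. z \<in> S \<Longrightarrow> \<exists>d\<in>B. F z \<in> fst d"
proof -
  show 1: "open S" "continuous_map (top_of_set S) Y F" using assms by (auto simp: harmonic_plane_def)
  show "open {z\<in>S. F z \<in> fst d}" if "d \<in> B" for d
    using openin_continuous_map_preimage[OF 1(2) smooth_manifold_chart(1)[OF assms(2) that]] 1(1)
    by (auto intro: openin_open_trans)
  show "\<exists>d\<in>B. F z \<in> fst d" if "z \<in> S" for z
    using smooth_manifold_cover[OF assms(2)] continuous_map_image_subset_topspace[OF 1(2)] that by force
qed (use assms in \<open>auto simp: harmonic_plane_def\<close>)

lemma harmonic_plane_compose:
  assumes B: "smooth_manifold Y B" "C2_riemannian_metric B \<nu>"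
    and F: "harmonic_plane Y B \<nu> T F" and g: "g holomorphic_on S" "open S" "g ` S \<subseteq> T"
  shows "harmonic_plane Y B \<nu> S (\<lambda>z. F (g z))"
  unfolding harmonic_plane_def
proof (intro conjI ballI impI)
  note D = harmonic_planeD[OF F B(1)]
  show "open S" by fact
  have "continuous_map (top_of_set S) (top_of_set T) g"
    using holomorphic_on_imp_continuous_on[OF g(1)] g(3) by (auto simp: continuous_map_in_subtopology)
  from continuous_map_compose[OF this D(2)]
  show cont: "continuous_map (top_of_set S) Y (\<lambda>z. F (g z))" by (simp add: o_def)
  fix d assume d: "d \<in> B"
  let ?S = "{z\<in>S. F (g z) \<in> fst d}" and ?T = "{z\<in>T. F z \<in> fst d}"
  have "openin (top_of_set S) ?S"
    using openin_continuous_map_preimage[OF cont smooth_manifold_chart(1)[OF B(1) d]] by simp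
  then have o: "open ?S" using g(2) by (rule openin_open_trans)
  have g': "g holomorphic_on ?S" "g ` ?S \<subseteq> ?T" using g by (auto elim: holomorphic_on_subset)
  show "C2_on (\<lambda>z. snd d (F (g z))) ?S" by (rule C2_on_compose[OF D(3)[OF d] g'(1) o g'(2)])
  fix z assume z: "z \<in> S" "F (g z) \<in> fst d"
  show "harmonic_at (\<nu> d) (\<lambda>z. snd d (F (g z))) z"
    by (rule harmonic_at_compose[OF riemannian_metric_on[OF B d] D(3)[OF d] g'(1) o g'(2)])
      (use z D(4)[OF d] g in auto)
qed

text \<open>The interior \<open>E\<close> of the coincidence set is shown to be closed in
  \<open>S\<close>. Near a limit point of \<open>E\<close> both maps run in one chart of the target,
  and there the result for balls spreads agreement from a small ball in \<open>E\<close> to a ball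
  that contains the limit point.\<close>

theorem harmonic_unique_continuation:
  assumes B: "smooth_manifold Y B" "C2_riemannian_metric B \<nu>"
    and F: "harmonic_plane Y B \<nu> S F" and G: "harmonic_plane Y B \<nu> S G" and S: "connected S"
    and N: "open N" "N \<noteq> {}" "N \<subseteq> S" "\<And>z. z \<in> N \<Longrightarrow> F z = G z"
    and z: "z \<in> S"
  shows "F z = G z"
proof -
  note D = harmonic_planeD[OF F B(1)] and D' = harmonic_planeD[OF G B(1)]
  define E where "E = interior {z\<in>S. F z = G z}"
  have ES: "E \<subseteq> S" unfolding E_def using interior_subset by blast
  have "openin (top_of_set S) E"
    by (rule open_subset[OF ES]) (simp add: E_def)
  moreover have "closedin (top_of_set S) E"
    unfolding closedin_limpt
  proof (intro conjI allI impI ES)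
    fix z assume "z islimpt E \<and> z \<in> S"
    then have lim: "z islimpt E" and z: "z \<in> S" by auto
    have "Hausdorff_space Y" using B(1) by (auto simp: smooth_manifold_def topological_manifold_def)
    from closedin_continuous_maps_eq[OF this D(2) D'(2)]
    have "closedin (top_of_set S) {z\<in>S. F z = G z}" by simp
    moreover have "z islimpt {z\<in>S. F z = G z}"
      using lim interior_subset unfolding E_def by (rule islimpt_subset)
    ultimately have eq: "F z = G z" using z unfolding closedin_limpt by blast
    obtain d where d: "d \<in> B" "F z \<in> fst d" using D(6)[OF z] by blast
    define V where "V = snd d ` fst d"
    note ch = smooth_manifold_chart[OF B(1) d(1)]
    have "open V" "snd d (F z) \<in> V" using ch d by (auto simp: V_def)
    then obtain \<rho> where \<rho>: "\<rho> > 0" "cball (snd d (F z)) \<rho> \<subseteq> V" using open_contains_cball by blast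
    \<comment> \<open>Confines the values to a coordinate ball: the local result asks for a compact
      convex set that contains both images.\<close>
    define W where "W H = {w\<in>S. H w \<in> fst d} \<inter> (\<lambda>w. snd d (H w)) -` ball (snd d (F z)) \<rho>" for H
    have o: "open (W F)" "open (W G)"
      unfolding W_def
      by (rule continuous_open_preimage[OF C1_on_continuous[OF C2_on_C1_on[OF D(3)[OF d(1)]]]
          D(5)[OF d(1)] open_ball]
          continuous_open_preimage[OF C1_on_continuous[OF C2_on_C1_on[OF D'(3)[OF d(1)]]] D'(5)[OF
              d(1)] open_ball])+
    have "z \<in> W F \<inter> W G" using z d eq \<rho> by (auto simp: W_def)
    with open_Int[OF o] obtain e where e: "e > 0" "ball z e \<subseteq> W F \<inter> W G" using openE by blast
    \<comment> \<open>With distance below \<open>e / 2\<close>, the ball of radius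
      \<open>e / 2\<close> about \<open>z'\<close> stays inside \<open>ball z e\<close> and still
      contains \<open>z\<close>.\<close>
    obtain z' where z': "z' \<in> E" "dist z' z < e / 2" using lim e(1) unfolding islimpt_approachable
      by (metis half_gt_zero)
    have sub: "ball z' (e / 2) \<subseteq> ball z e"
    proof
      fix w assume "w \<in> ball z' (e / 2)"
      then show "w \<in> ball z e" using z'(2) dist_triangle[of z w z'] by (simp add: dist_commute)
    qed
    have "open E" by (simp add: E_def)
    then obtain r where r: "r > 0" "ball z' r \<subseteq> E" using z'(1) openE by blast
    have all: "F w = G w" if w: "w \<in> ball z' (e / 2)" for w
    proof -
      have "snd d (F w) = snd d (G w)"
      proof (rule harmonic_ball_unique_continuation[where F = "\<lambda>z. snd d (F z)" and G =
          "\<lambda>z. snd d (G z)"])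
        show "metric_on V (\<nu> d)" unfolding V_def by (rule riemannian_metric_on[OF B d(1)])
        show "C2_on (\<lambda>z. snd d (F z)) (ball z' (e / 2))" "C2_on (\<lambda>z. snd d (G z)) (ball z' (e / 2))"
          using D(3)[OF d(1)] D'(3)[OF d(1)] sub e(2) by (auto elim!: C2_on_subset simp: W_def)
        show "(\<lambda>z. snd d (F z)) ` ball z' (e / 2) \<subseteq> cball (snd d (F z)) \<rho>"
            "(\<lambda>z. snd d (G z)) ` ball z' (e / 2) \<subseteq> cball (snd d (F z)) \<rho>"
          using sub e(2) by (force simp: W_def)+
        show "harmonic_at (\<nu> d) (\<lambda>z. snd d (F z)) w" "harmonic_at (\<nu> d) (\<lambda>z. snd d (G z)) w"
            if "w \<in> ball z' (e / 2)" for w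
        proof -
          have "w \<in> W F" "w \<in> W G" using that sub e(2) by blast+
          then show "harmonic_at (\<nu> d) (\<lambda>z. snd d (F z)) w" "harmonic_at (\<nu> d) (\<lambda>z. snd d (G z)) w"
            using D(4)[OF d(1)] D'(4)[OF d(1)] unfolding W_def by blast+
        qed
        show "snd d (F w) = snd d (G w)" if "w \<in> ball z' r" for w
          using that r(2) interior_subset unfolding E_def by force
      qed (use \<rho> r w in auto)
      moreover have "F w \<in> fst d" "G w \<in> fst d" using w sub e(2) by (auto simp: W_def)
      ultimately show ?thesis using ch(3) by (auto dest: inj_onD)
    qed
    have "ball z' (e / 2) \<subseteq> {z\<in>S. F z = G z}" using all sub e(2) by (auto simp: W_def)
    then have "ball z' (e / 2) \<subseteq> E" unfolding E_def by (rule interior_maximal) simp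
    then show "z \<in> E" using z'(2) by auto
  qed
  ultimately have "E = {} \<or> E = S" using S connected_clopen by blast
  moreover have "N \<subseteq> E" unfolding E_def using N by (intro interior_maximal) auto
  ultimately have "z \<in> E" using N z by auto
  then show ?thesis unfolding E_def using interior_subset by blast
qed

section \<open>Harmonic maps of Riemann surfaces\<close>

lemma is_chartD:
  assumes "is_chart X c"
  shows "openin X (fst c)" "open (snd c ` fst c)" "inj_on (snd c) (fst c)"
    and "continuous_map (subtopology X (fst c)) euclidean (snd c)"
    and "continuous_map (top_of_set (snd c ` fst c)) X (chart_inv c)"
    and "\<And>p. p \<in> fst c \<Longrightarrow> chart_inv c (snd c p) = p"
    and "\<And>z. z \<in> snd c ` fst c \<Longrightarrow> snd c (chart_inv c z) = z"
    and "\<And>z. z \<in> snd c ` fst c \<Longrightarrow> chart_inv c z \<in> fst c"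
proof -
  show o: "openin X (fst c)" and "open (snd c ` fst c)"
    using assms by (auto simp: is_chart_def)
  have t: "topspace (subtopology X (fst c)) = fst c"
    using openin_subset[OF o] by auto
  have h: "homeomorphic_map (subtopology X (fst c)) (top_of_set (snd c ` fst c)) (snd c)"
    using assms by (auto simp: is_chart_def)
  show i: "inj_on (snd c) (fst c)" using homeomorphic_imp_injective_map[OF h] t by simp
  show "continuous_map (subtopology X (fst c)) euclidean (snd c)"
    using homeomorphic_imp_continuous_map[OF h] by (simp add: continuous_map_in_subtopology)
  show *: "chart_inv c (snd c p) = p" if "p \<in> fst c" for p
    using i that by (simp add: chart_inv_def)
  show "snd c (chart_inv c z) = z" "chart_inv c z \<in> fst c" if "z \<in> snd c ` fst c" for z
    using that * by auto
  obtain g where g: "homeomorphic_maps (subtopology X (fst c)) (top_of_set (snd c ` fst c)) (snd c) g"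
    using h homeomorphic_map_maps by blast
  have "g z = chart_inv c z" if z: "z \<in> snd c ` fst c" for z
  proof -
    obtain p where p: "p \<in> fst c" "z = snd c p" using z by blast
    have "g (snd c p) = p" using g p t unfolding homeomorphic_maps_def by metis
    then show ?thesis using * p by simp
  qed
  moreover have "continuous_map (top_of_set (snd c ` fst c)) X g"
    using g by (simp add: homeomorphic_maps_def continuous_map_in_subtopology)
  ultimately show "continuous_map (top_of_set (snd c ` fst c)) X (chart_inv c)"
    using continuous_map_eq[of "top_of_set (snd c ` fst c)" X g "chart_inv c"]
    unfolding topspace_euclidean_subtopology by blast
qed

lemma is_chart_open_image:
  assumes c: "is_chart X c" and W: "openin X W" "W \<subseteq> fst c"
  shows "open (snd c ` W)"
proof -
  note D = is_chartD[OF c]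
  have "snd c ` W = {z \<in> snd c ` fst c. chart_inv c z \<in> W}"
    using W D(6) by force
  moreover have "openin (top_of_set (snd c ` fst c)) {z \<in> snd c ` fst c. chart_inv c z \<in> W}"
    using openin_continuous_map_preimage[OF D(5) W(1)] by simp
  ultimately show ?thesis using D(2) openin_open_trans by metis
qed

lemma is_chart_open_preimage:
  assumes c: "is_chart X c" and U: "open U" "U \<subseteq> snd c ` fst c"
  shows "openin X (chart_inv c ` U)"
proof -
  note D = is_chartD[OF c]
  have "chart_inv c ` U = {p \<in> fst c. snd c p \<in> U}"
    using U D(6-8) by (auto simp: image_iff) (metis D(6))
  moreover have "topspace (subtopology X (fst c)) = fst c"
    using openin_subset[OF D(1)] by auto
  then have "openin (subtopology X (fst c)) {p \<in> fst c. snd c p \<in> U}"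
    using openin_continuous_map_preimage[OF D(4), of U] U(1) by simp
  ultimately show ?thesis using openin_trans_full[OF _ D(1)] by metis
qed

lemma local_rep_eq: "local_rep c d f = (\<lambda>z. snd d (f (chart_inv c z)))"
  by (auto simp: local_rep_def fun_eq_iff)

lemma local_dom_eq:
  assumes "is_chart X c"
  shows "local_dom c d f W = {z \<in> snd c ` fst c. chart_inv c z \<in> W \<and> f (chart_inv c z) \<in> fst d}"
  unfolding local_dom_def using is_chartD(6-8)[OF assms] by (auto simp: image_iff)

section \<open>From the trace of the second derivative to the coordinate equation\<close>

lemma bilinear_sharp:
  fixes k :: "'h::euclidean_space \<Rightarrow> 'h \<Rightarrow> real"
  assumes k: "bilinear k" and pos: "\<And>u. u \<noteq> 0 \<Longrightarrow> k u u > 0" and a: "linear a"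
  shows "k (sharp k a) v = a v"
proof -
  \<comment> \<open>Lowering an index as a linear endomorphism: definiteness makes it injective,
    hence surjective in finite dimension, which gives the vector that \<open>sharp\<close>
    describes.\<close>
  define T where "T = (\<lambda>w. \<Sum>b\<in>Basis. k w b *\<^sub>R b)"
  have T: "linear T" unfolding T_def
    using k by (intro linearI) (simp_all add: bilinear_ladd bilinear_lmul scaleR_add_left
        sum.distrib scaleR_sum_right)
  have Tb: "T w \<bullet> b = k w b" if "b \<in> Basis" for w b
    unfolding T_def using that by simp
  have kT: "k w v = (\<Sum>b\<in>Basis. (v \<bullet> b) * (T w \<bullet> b))" for w v
  proof -
    have "linear (k w)" using k by (simp add: bilinear_def)
    then have "k w (\<Sum>b\<in>Basis. (v \<bullet> b) *\<^sub>R b) = (\<Sum>b\<in>Basis. (v \<bullet> b) * k w b)"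
      by (simp add: linear_sum linear_scale)
    then show ?thesis by (simp add: euclidean_representation Tb)
  qed
  have "inj T"
    unfolding linear_injective_0[OF T]
  proof (intro allI impI)
    fix w assume "T w = 0"
    then have "k w w = 0" by (simp add: kT)
    then show "w = 0" using pos[of w] by force
  qed
  from linear_injective_imp_surjective[OF T this] obtain w where w: "T w = (\<Sum>b\<in>Basis. a b *\<^sub>R b)"
    by (metis surjD)
  have "k w v = a v" for v
  proof -
    have "k w v = (\<Sum>b\<in>Basis. (v \<bullet> b) * a b)" unfolding kT w by simp
    also have "\<dots> = a (\<Sum>b\<in>Basis. (v \<bullet> b) *\<^sub>R b)" using a by (simp add: linear_sum linear_scale)
    finally show ?thesis by (simp add: euclidean_representation)
  qed
  moreover have "w' = w" if "\<forall>v. k w' v = a v" for w'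
  proof (rule ccontr)
    assume "w' \<noteq> w"
    then have "k (w' - w) (w' - w) > 0" using pos by simp
    moreover have "k (w' - w) (w' - w) = 0"
      using that \<open>\<And>v. k w v = a v\<close> by (simp add: bilinear_lsub[OF k])
    ultimately show False by simp
  qed
  ultimately have "(THE w. \<forall>v. k w v = a v) = w" by (intro the_equality) auto
  then show ?thesis unfolding sharp_def using \<open>\<And>v. k w v = a v\<close> by simp
qed

lemma metric_on_cancel:
  assumes m: "metric_on V K" "x \<in> V" and eq: "\<And>w. K x u w = K x v w"
  shows "u = v"
proof (rule ccontr)
  assume "u \<noteq> v"
  then have "K x (u - v) (u - v) > 0" using metric_onD(4)[OF m] by simp
  then show False using eq by (simp add: bilinear_lsub[OF metric_onD(2)[OF m]])
qed

lemma christoffel_christoffel1: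
  assumes m: "metric_on V K" "x \<in> V"
  shows "K x (christoffel K x u v) w = christoffel1 K x u v w"
proof -
  have "christoffel K x u v = sharp (K x) (\<lambda>w. christoffel1 K x u v w)"
    by (simp add: christoffel_def christoffel1_def metric_deriv_def)
  then show ?thesis
    using bilinear_sharp[OF metric_onD(2)[OF m] metric_onD(4)[OF m] christoffel1_linear(3)[OF m]]
      by simp
qed

lemma christoffel_scale_left:
  assumes m: "metric_on V K" "x \<in> V"
  shows "christoffel K x (r *\<^sub>R u) v = r *\<^sub>R christoffel K x u v"
  by (rule metric_on_cancel[OF m])
    (simp add: christoffel_christoffel1[OF m] bilinear_lmul[OF metric_onD(2)[OF m]]
      linear_scale[OF christoffel1_linear(1)[OF m]])

text \<open>For a metric \<open>\<rho> (u \<bullet> v)\<close> in dimension \<open>n\<close> the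
  traced symbol of the first kind, paired with \<open>w\<close>, is \<open>(2 - n) / 2\<close> times
  the derivative of \<open>\<rho>\<close> in direction \<open>w\<close>. It vanishes precisely
  because the domain is two-dimensional.\<close>

lemma conformal_christoffel_trace:
  fixes K :: "complex \<Rightarrow> complex \<Rightarrow> complex \<Rightarrow> real"
  assumes m: "metric_on V K" "x \<in> V" and conf: "\<And>z. z \<in> V \<Longrightarrow> \<exists>\<rho>>0. \<forall>u v. K z u v = \<rho> * (u \<bullet> v)"
  shows "christoffel K x 1 1 + christoffel K x \<i> \<i> = 0"
proof (rule metric_on_cancel[OF m])
  fix w
  have K: "K z u v = K z 1 1 * (u \<bullet> v)" if "z \<in> V" for z u v
    using conf[OF that] by auto
  have md: "metric_deriv K x a u v = metric_deriv K x a 1 1 * (u \<bullet> v)" for a u v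
  proof (rule metric_deriv_eqI[OF m])
    show "((\<lambda>y. K y u v) has_derivative (\<lambda>a. metric_deriv K x a 1 1 * (u \<bullet> v))) (at x)"
      by (rule has_derivative_transform_within_open[OF has_derivative_mult_left[OF
          metric_deriv_has_derivative[OF m]] metric_onD(1)[OF m(1)] m(2)])
        (simp add: K[symmetric])
  qed
  have l: "linear (\<lambda>a. metric_deriv K x a 1 1)" by (rule metric_deriv_linear(1)[OF m])
  have "w = Re w *\<^sub>R 1 + Im w *\<^sub>R \<i>" by (simp add: complex_eq_iff)
  then have "metric_deriv K x w 1 1 = metric_deriv K x (Re w *\<^sub>R 1 + Im w *\<^sub>R \<i>) 1 1" by simp
  also have "\<dots> = Re w * metric_deriv K x 1 1 1 + Im w * metric_deriv K x \<i> 1 1"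
    by (simp only: linear_add[OF l] linear_scale[OF l] real_scaleR_def)
  finally have w: "metric_deriv K x w 1 1 = Re w * metric_deriv K x 1 1 1
      + Im w * metric_deriv K x \<i> 1 1" .
  have "K x (christoffel K x 1 1 + christoffel K x \<i> \<i>) w
      = christoffel1 K x 1 1 w + christoffel1 K x \<i> \<i> w"
    by (simp add: bilinear_ladd[OF metric_onD(2)[OF m]] christoffel_christoffel1[OF m])
  also have "\<dots> = 0"
    unfolding christoffel1_def
    by (subst (1 2 3 4 5 6) md) (simp add: w inner_complex_def field_simps)
  finally show "K x (christoffel K x 1 1 + christoffel K x \<i> \<i>) w = K x 0 w"
    by (simp add: bilinear_lzero[OF metric_onD(2)[OF m]])
qed

lemma Ck_on_2_C2_on:
  assumes "Ck_on 2 F S"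
  shows "C2_on F S"
proof -
  have 1: "\<And>z. z \<in> S \<Longrightarrow> F differentiable (at z)" "\<And>v. Ck_on 1 (\<lambda>x. frechet_derivative F (at x) v) S"
    using assms by (auto simp: numeral_2_eq_2)
  have 2: "C1_on G S" if "Ck_on 1 G S" for G :: "complex \<Rightarrow> 'a"
    using that by (auto simp: C1_on_def pdx_def[abs_def] pdy_def[abs_def])
  show ?thesis
    unfolding C2_on_def using 1(1) 2[OF 1(2)[of 1]] 2[OF 1(2)[of \<i>]]
    by (auto simp: pdx_def[abs_def] pdy_def[abs_def])
qed

lemma harmonic_at_of_trace:
  assumes m: "metric_on U \<mu>" "z \<in> U" and conf: "\<And>z. z \<in> U \<Longrightarrow> \<exists>\<rho>>0. \<forall>u v. \<mu> z u v = \<rho> * (u \<bullet> v)"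
    and k: "metric_on V K" "F z \<in> V" and F: "C2_on F S" "z \<in> S"
    and t: "metric_trace (\<mu> z) (nabla_d \<mu> K F z) = 0"
  shows "harmonic_at K F z"
proof -
  obtain \<rho> where \<rho>: "\<rho> > 0" "\<And>u v. \<mu> z u v = \<rho> * (u \<bullet> v)" using conf[OF m(2)] by blast
  \<comment> \<open>Raising an index is division by the conformal factor, so the metric trace is the
    Euclidean trace over \<open>1\<close> and \<open>\<i>\<close> divided by
    \<open>\<rho>\<close>.\<close>
  have sh: "sharp (\<mu> z) ((\<bullet>) b) = (1 / \<rho>) *\<^sub>R b" for b
  proof (rule metric_on_cancel[OF m])
    fix w
    have "linear ((\<bullet>) b)" by (simp add: bounded_linear.linear bounded_linear_inner_right)
    from bilinear_sharp[OF metric_onD(2)[OF m] metric_onD(4)[OF m] this]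
    have "\<mu> z (sharp (\<mu> z) ((\<bullet>) b)) w = b \<bullet> w" by blast
    also have "b \<bullet> w = \<mu> z ((1 / \<rho>) *\<^sub>R b) w" unfolding \<rho>(2) using \<rho>(1) by simp
    finally show "\<mu> z (sharp (\<mu> z) ((\<bullet>) b)) w = \<mu> z ((1 / \<rho>) *\<^sub>R b) w" .
  qed
  have d: "F differentiable (at z)" "pdx F differentiable (at z)" "pdy F differentiable (at z)"
    using F by (auto simp: C2_on_def C1_on_def)
  have lF: "linear (frechet_derivative F (at z))" by (rule linear_frechet_derivative[OF d(1)])
  have lx: "linear (frechet_derivative (\<lambda>y. frechet_derivative F (at y) v) (at z))"
      if "v = 1 \<or> v = \<i>" for v
    by (rule linear_frechet_derivative) (use that d in \<open>auto simp: pdx_def[abs_def] pdy_def[abs_def]\<close>)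
  have nb: "nabla_d \<mu> K F z (r *\<^sub>R b) b = r *\<^sub>R nabla_d \<mu> K F z b b" if "b = 1 \<or> b = \<i>" for b r
    unfolding nabla_d_def
    by (simp add: linear_scale[OF lx[OF that]] linear_scale[OF lF] christoffel_scale_left[OF m]
        christoffel_scale_left[OF k] algebra_simps)
  have "metric_trace (\<mu> z) (nabla_d \<mu> K F z) = (1 / \<rho>) *\<^sub>R (nabla_d \<mu> K F z 1 1 + nabla_d \<mu> K F z \<i> \<i>)"
    unfolding metric_trace_def Basis_complex_def sh by (simp add: nb algebra_simps)
  with t \<rho>(1) have "nabla_d \<mu> K F z 1 1 + nabla_d \<mu> K F z \<i> \<i> = 0" by simp
  \<comment> \<open>The connection of the domain drops out after tracing; what remains is the
    Laplacian and the Christoffel terms of the target.\<close>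
  moreover have "frechet_derivative F (at z) (christoffel \<mu> z 1 1)
      + frechet_derivative F (at z) (christoffel \<mu> z \<i> \<i>) = 0"
    using conformal_christoffel_trace[OF m conf] linear_add[OF lF] linear_0[OF lF] by metis
  ultimately have e: "(pdx (pdx F) z + pdy (pdy F) z) + christoffel K (F z) (pdx F z) (pdx F z)
      + christoffel K (F z) (pdy F z) (pdy F z) = 0"
    unfolding nabla_d_def pdx_def pdy_def by (simp add: algebra_simps)
  show ?thesis
    unfolding harmonic_at_def
  proof
    fix w
    have "K (F z) (pdx (pdx F) z + pdy (pdy F) z) w + christoffel1 K (F z) (pdx F z) (pdx F z) w
        + christoffel1 K (F z) (pdy F z) (pdy F z) w
      = K (F z) ((pdx (pdx F) z + pdy (pdy F) z) + christoffel K (F z) (pdx F z) (pdx F z)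
          + christoffel K (F z) (pdy F z) (pdy F z)) w"
      by (simp only: bilinear_ladd[OF metric_onD(2)[OF k]] christoffel_christoffel1[OF k])
    then show "K (F z) (pdx (pdx F) z + pdy (pdy F) z) w
        + christoffel1 K (F z) (pdx F z) (pdx F z) w + christoffel1 K (F z) (pdy F z) (pdy F z) w = 0"
      unfolding e by (simp add: bilinear_lzero[OF metric_onD(2)[OF k]])
  qed
qed

lemma riemann_surface_chart: "riemann_surface X A \<Longrightarrow> c \<in> A \<Longrightarrow> is_chart X c"
  by (auto simp: riemann_surface_def topological_manifold_def)

lemma harmonic_map_chart:
  assumes X: "riemann_surface X A" and \<mu>: "C2_conformal_metric A \<mu>"
    and B: "smooth_manifold Y B" "C2_riemannian_metric B \<nu>"
    and f: "harmonic_map X A \<mu> Y B \<nu> f" and c: "c \<in> A"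
  shows "harmonic_plane Y B \<nu> (snd c ` fst c) (\<lambda>z. f (chart_inv c z))"
  unfolding harmonic_plane_def
proof (intro conjI ballI impI)
  have ch: "is_chart X c" by (rule riemann_surface_chart[OF X c])
  note D = is_chartD[OF ch]
  show "open (snd c ` fst c)" by (rule D(2))
  have "continuous_map X Y f" using f by (auto simp: harmonic_map_def C2_map_def)
  from continuous_map_compose[OF D(5) this]
  show "continuous_map (top_of_set (snd c ` fst c)) Y (\<lambda>z. f (chart_inv c z))" by (simp add: o_def)
  fix d assume d: "d \<in> B"
  have dom: "local_dom c d f UNIV = {z \<in> snd c ` fst c. f (chart_inv c z) \<in> fst d}"
    by (simp add: local_dom_eq[OF ch])
  have "Ck_on 2 (local_rep c d f) (local_dom c d f UNIV)"
    using f c d by (auto simp: harmonic_map_def C2_map_def)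
  then show C2: "C2_on (\<lambda>z. snd d (f (chart_inv c z))) {z \<in> snd c ` fst c. f (chart_inv c z) \<in> fst d}"
    unfolding dom local_rep_eq by (rule Ck_on_2_C2_on)
  fix z assume z: "z \<in> snd c ` fst c" "f (chart_inv c z) \<in> fst d"
  have \<mu>': "C2_riemannian_metric A \<mu>" and conf:
      "\<And>z. z \<in> snd c ` fst c \<Longrightarrow> \<exists>\<rho>>0. \<forall>u v. \<mu> c z u v = \<rho> * (u \<bullet> v)"
    using \<mu> c by (auto simp: C2_conformal_metric_def)
  have m: "metric_on (snd c ` fst c) (\<mu> c)"
    using \<mu>' c D(2) unfolding metric_on_def C2_riemannian_metric_def by blast
  have "metric_trace (\<mu> c z) (nabla_d (\<mu> c) (\<nu> d) (local_rep c d f) z) = 0"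
  proof -
    have "z \<in> local_dom c d f UNIV" using z by (simp add: dom)
    then show ?thesis using f c d unfolding harmonic_map_def by blast
  qed
  then show "harmonic_at (\<nu> d) (\<lambda>z. snd d (f (chart_inv c z))) z"
    unfolding local_rep_eq
    using harmonic_at_of_trace[OF m z(1) conf riemannian_metric_on[OF B d] _ C2] z by blast
qed

section \<open>The Hopf differential\<close>

definition hopf_local :: "('h::euclidean_space \<Rightarrow> 'h \<Rightarrow> 'h \<Rightarrow> real) \<Rightarrow> (complex \<Rightarrow> 'h) \<Rightarrow> complex \<Rightarrow> complex"
  where "hopf_local K F z =
    cbilinear_ext (K (F z)) (clinear_ext (frechet_derivative F (at z)) d_dz) (clinear_ext
        (frechet_derivative F (at z)) d_dz)"

text \<open>The coefficient for maps on plane domains, which can be pulled back by arbitrary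
  holomorphic maps. It repeats the choice of target chart made in \<open>hopf\<close>, so that the
  two agree by unfolding.\<close>

definition hopf_plane ::
    "('b, 'h::euclidean_space) chart set \<Rightarrow> ('b, 'h) metric \<Rightarrow> (complex \<Rightarrow> 'b) \<Rightarrow> complex \<Rightarrow> complex"
  where "hopf_plane B \<nu> F z = (let d = (SOME d. d \<in> B \<and>
      F z \<in> fst d) in hopf_local (\<nu> d) (\<lambda>z. snd d (F z)) z)"

lemma hopf_eq_hopf_plane: "hopf B \<nu> f c z = hopf_plane B \<nu> (\<lambda>z. f (chart_inv c z)) z"
  by (simp add: hopf_def hopf_plane_def hopf_local_def Let_def local_rep_eq)

lemma hopf_local_eq:
  assumes m: "metric_on V K" "F z \<in> V" and d: "F differentiable (at z)"
  shows "hopf_local K F z = Complex ((K (F z) (pdx F z) (pdx F z) - K (F z) (pdy F z) (pdy F z)) / 4)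
    (- K (F z) (pdx F z) (pdy F z) / 2)"
proof -
  note b = metric_onD(2)[OF m]
  have 1: "clinear_ext (frechet_derivative F (at z)) d_dz = ((1/2) *\<^sub>R pdx F z, (- (1/2)) *\<^sub>R pdy F z)"
    unfolding clinear_ext_def d_dz_def by (simp add: frechet_derivative_partials[OF d])
  have s: "K (F z) (pdy F z) (pdx F z) = K (F z) (pdx F z) (pdy F z)" by (rule metric_onD(3)[OF m])
  show ?thesis
    unfolding hopf_local_def 1 cbilinear_ext_def fst_conv snd_conv
    by (simp only: bilinear_lmul[OF b] bilinear_rmul[OF b] s) (simp add: field_simps)
qed

lemma hopf_local_compose:
  assumes m: "metric_on V K" "F (g z) \<in> V" and d: "F differentiable (at (g z))"
    and g: "g holomorphic_on S" "open S" "z \<in> S"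
  shows "hopf_local K (\<lambda>z. F (g z)) z = hopf_local K F (g z) * (deriv g z)\<^sup>2"
proof -
  note b = metric_onD(2)[OF m]
  have d': "(\<lambda>z. F (g z)) differentiable (at z)"
    by (rule has_partials_differentiable[OF has_partials_compose[OF has_partials_pd[OF d]
        holomorphic_derivI[OF g]]])
  define \<alpha> \<beta> where "\<alpha> = Re (deriv g z)" and "\<beta> = Im (deriv g z)"
  define p q where "p = pdx F (g z)" and "q = pdy F (g z)"
  have s: "K (F (g z)) q p = K (F (g z)) p q" by (rule metric_onD(3)[OF m])
  have dg: "deriv g z = Complex \<alpha> \<beta>" by (simp add: \<alpha>_def \<beta>_def)
  have k: "K (F (g z)) (a *\<^sub>R p + b *\<^sub>R q) (c *\<^sub>R p + d *\<^sub>R q) =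
     a * c * K (F (g z)) p p + (a * d + b * c) * K (F (g z)) p q + b * d * K (F (g z)) q q" for a b c d
    by (simp only: bilinear_ladd[OF b] bilinear_radd[OF b] bilinear_lmul[OF b] bilinear_rmul[OF b] s)
      (simp add: algebra_simps)
  show ?thesis
    unfolding hopf_local_eq[where F = "\<lambda>z. F (g z)", OF m d'] hopf_local_eq[OF m d]
        compose_partials[of F g, OF d g]
    unfolding p_def[symmetric] q_def[symmetric] \<alpha>_def[symmetric] \<beta>_def[symmetric] k dg
    by (simp add: complex_eq_iff power2_eq_square field_simps)
qed

lemma hopf_local_cong:
  assumes "open S" "z \<in> S" "\<And>w. w \<in> S \<Longrightarrow> F w = G w"
  shows "hopf_local K F z = hopf_local K G z"
proof -
  have "(F has_derivative D) (at z) \<longleftrightarrow> (G has_derivative D) (at z)" for D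
    using has_derivative_transform_within_open[OF _ assms(1,2), of F D UNIV G]
      has_derivative_transform_within_open[OF _ assms(1,2), of G D UNIV F] assms(3) by auto
  then have "frechet_derivative F (at z) = frechet_derivative G (at z)"
    unfolding frechet_derivative_def by simp
  then show ?thesis unfolding hopf_local_def using assms by simp
qed

lemma hopf_plane_cong:
  assumes "open S" "z \<in> S" "\<And>w. w \<in> S \<Longrightarrow> F w = G w"
  shows "hopf_plane B \<nu> F z = hopf_plane B \<nu> G z"
  unfolding hopf_plane_def Let_def using assms(2,3)
  by (simp add: hopf_local_cong[OF assms(1,2), of "\<lambda>z. snd d (F z)" "\<lambda>z. snd d (G z)" for d])

lemma hopf_plane_some:
  assumes "smooth_manifold Y B" "harmonic_plane Y B \<nu> S F" "z \<in> S"
  obtains d where "d \<in> B" "F z \<in> fst d" "d = (SOME d. d \<in> B \<and> F z \<in> fst d)"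
  using someI_ex[of "\<lambda>d. d \<in> B \<and> F z \<in> fst d"] harmonic_planeD(6)[OF assms(2,1,3)] by blast

lemma hopf_plane_compose:
  assumes B: "smooth_manifold Y B" "C2_riemannian_metric B \<nu>"
    and F: "harmonic_plane Y B \<nu> T F" and g: "g holomorphic_on S" "open S" "z \<in> S" "g z \<in> T"
  shows "hopf_plane B \<nu> (\<lambda>z. F (g z)) z = hopf_plane B \<nu> F (g z) * (deriv g z)\<^sup>2"
proof -
  obtain d where d: "d \<in> B" "F (g z) \<in> fst d" "d = (SOME d. d \<in> B \<and> F (g z) \<in> fst d)"
    using hopf_plane_some[OF B(1) F g(4)] by blast
  have "(\<lambda>z. snd d (F z)) differentiable (at (g z))"
    using harmonic_planeD(3)[OF F B(1) d(1)] g(4) d(2) by (auto simp: C2_on_def)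
  from hopf_local_compose[OF riemannian_metric_on[OF B d(1)] _ this g(1-3)]
  show ?thesis
    unfolding hopf_plane_def d(3)[symmetric] Let_def using d(2) by simp
qed

text \<open>In the overlap the second expression of \<open>F\<close> is the first followed by the
  transition map, so its derivative is transformed just as the tensor \<open>\<nu>\<close>
  prescribes.\<close>

lemma hopf_local_chart:
  assumes B: "smooth_manifold Y B" "C2_riemannian_metric B \<nu>"
    and F: "harmonic_plane Y B \<nu> S F" and z: "z \<in> S" and d: "d \<in> B" "F z \<in> fst d" and d': "d' \<in> B"
        "F z \<in> fst d'"
  shows "hopf_local (\<nu> d) (\<lambda>z. snd d (F z)) z = hopf_local (\<nu> d') (\<lambda>z. snd d' (F z)) z"
proof -
  note D = harmonic_planeD[OF F B(1)]
  let ?F = "\<lambda>z. snd d (F z)" and ?G = "\<lambda>z. snd d' (F z)"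
  let ?t = "local_rep d d' id"
  have ch: "is_chart Y d" using B(1) d(1) by (auto simp: smooth_manifold_def topological_manifold_def)
  have "Ck_on 1 ?t (local_dom d d' id UNIV)"
    using B(1) d d' unfolding smooth_manifold_def by blast
  moreover have "snd d (F z) \<in> local_dom d d' id UNIV" using d d' by (auto simp: local_dom_def)
  ultimately have "?t differentiable (at (?F z))" by simp
  then have dt: "(?t has_derivative frechet_derivative ?t (at (?F z))) (at (?F z))"
    using frechet_derivative_works by blast
  have dF: "?F differentiable (at z)" "?G differentiable (at z)"
    using D(3)[OF d(1)] D(3)[OF d'(1)] z d d' by (auto simp: C2_on_def)
  let ?N = "{z\<in>S. F z \<in> fst d} \<inter> {z\<in>S. F z \<in> fst d'}"
  have N: "open ?N" "z \<in> ?N" using D(5)[OF d(1)] D(5)[OF d'(1)] z d d' by auto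
  have "?t (?F w) = ?G w" if "w \<in> ?N" for w
    using that is_chartD(6)[OF ch] by (simp add: local_rep_eq)
  then have "(?G has_derivative (\<lambda>h. frechet_derivative ?t (at (?F z)) (frechet_derivative ?F (at z)
      h))) (at z)"
    using has_derivative_transform_within_open[OF has_derivative_compose[where f = ?F
        and g = ?t, OF _ dt] N, where g = ?G]
      dF(1) frechet_derivative_works by blast
  then have G: "frechet_derivative ?G (at z) = (\<lambda>h. frechet_derivative ?t (at (?F z))
      (frechet_derivative ?F (at z) h))"
    using frechet_derivative_at by metis
  have "\<nu> d (?F z) u v = \<nu> d' (?G z) (frechet_derivative ?t (at (?F z)) u) (frechet_derivative ?t
      (at (?F z)) v)" for u v
    using B(2) d d' unfolding C2_riemannian_metric_def by blast
  then show ?thesis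
    unfolding hopf_local_eq[where F = ?F, OF riemannian_metric_on[OF B d(1)] imageI[OF d(2)] dF(1)]
      hopf_local_eq[where F = ?G, OF riemannian_metric_on[OF B d'(1)] imageI[OF d'(2)] dF(2)]
    unfolding pdx_def pdy_def G by simp
qed

text \<open>The product rule for \<open>K (F w) (P w) (Q w)\<close>. As \<open>K\<close> is
  differentiable in its point for fixed vectors, the expression is expanded in a basis,
  differentiated termwise and reassembled.\<close>

lemma metric_compose_partials:
  assumes m: "metric_on V K" and N: "open N" "z \<in> N" "\<And>w. w \<in> N \<Longrightarrow> F w \<in> V"
    and F: "has_partials F Fx Fy z" and P: "has_partials P Px Py z" and Q: "has_partials Q Qx Qy z"
  shows "has_partials (\<lambda>w. K (F w) (P w) (Q w))
    (metric_deriv K (F z) Fx (P z) (Q z) + K (F z) Px (Q z) + K (F z) (P z) Qx)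
    (metric_deriv K (F z) Fy (P z) (Q z) + K (F z) Py (Q z) + K (F z) (P z) Qy) z"
proof -
  have FV: "F z \<in> V" using N by auto
  let ?F' = "\<lambda>v. Re v *\<^sub>R Fx + Im v *\<^sub>R Fy" and ?P' = "\<lambda>v. Re v *\<^sub>R Px + Im v *\<^sub>R Py"
    and ?Q' = "\<lambda>v. Re v *\<^sub>R Qx + Im v *\<^sub>R Qy"
  have dF: "(F has_derivative ?F') (at z)" "(P has_derivative ?P') (at z)"
      "(Q has_derivative ?Q') (at z)"
    using F P Q by (simp_all add: has_partials_def)
  have K: "((\<lambda>w. K (F w) b c) has_derivative (\<lambda>h. metric_deriv K (F z) (?F' h) b c)) (at z)" for b c
    using has_derivative_compose[OF dF(1) metric_deriv_has_derivative[OF m FV]] .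
  have bm: "bilinear (metric_deriv K (F z) a)" for a
    unfolding bilinear_def using metric_deriv_linear[OF m FV] by blast
  note bk = metric_onD(2)[OF m]
  have "((\<lambda>w. \<Sum>b\<in>Basis. \<Sum>c\<in>Basis. ((P w \<bullet> b) * (Q w \<bullet> c)) * K (F w) b c) has_derivative
    (\<lambda>h. \<Sum>b\<in>Basis. \<Sum>c\<in>Basis. ((P z \<bullet> b) * (Q z \<bullet> c)) * metric_deriv K (F z) (?F' h) b c
      + ((P z \<bullet> b) * (?Q' h \<bullet> c) + (?P' h \<bullet> b) * (Q z \<bullet> c)) * K (F z) b c)) (at z)"
    by (intro has_derivative_sum has_derivative_mult K has_derivative_inner_left dF)
  also have "(\<lambda>h. \<Sum>b\<in>Basis. \<Sum>c\<in>Basis. ((P z \<bullet> b) * (Q z \<bullet> c)) * metric_deriv K (F z) (?F' h) b c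
      + ((P z \<bullet> b) * (?Q' h \<bullet> c) + (?P' h \<bullet> b) * (Q z \<bullet> c)) * K (F z) b c)
    = (\<lambda>h. metric_deriv K (F z) (?F' h) (P z) (Q z) + K (F z) (?P' h) (Q z) + K (F z) (P z) (?Q' h))"
    by (subst (2 3) bilinear_expand[OF bk[OF FV]], subst bilinear_expand[OF bm])
      (simp add: sum.distrib[symmetric] distrib_right add_ac)
  finally have "((\<lambda>w. K (F w) (P w) (Q w)) has_derivative
     (\<lambda>h. metric_deriv K (F z) (?F' h) (P z) (Q z) + K (F z) (?P' h) (Q z)
         + K (F z) (P z) (?Q' h))) (at z)"
    by (rule has_derivative_transform_within_open[OF _ N(1,2)]) (simp add: bilinear_expand[OF bk] N(3))
  moreover have "(\<lambda>h. metric_deriv K (F z) (?F' h) (P z) (Q z) + K (F z) (?P' h) (Q z)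
      + K (F z) (P z) (?Q' h))
    = (\<lambda>v. Re v *\<^sub>R (metric_deriv K (F z) Fx (P z) (Q z) + K (F z) Px (Q z) + K (F z) (P z) Qx) +
       Im v *\<^sub>R (metric_deriv K (F z) Fy (P z) (Q z) + K (F z) Py (Q z) + K (F z) (P z) Qy))"
    by (auto simp: linear_add[OF metric_deriv_linear(1)[OF m FV]] linear_scale[OF
        metric_deriv_linear(1)[OF m FV]] bilinear_ladd[OF bk[OF FV]] bilinear_radd[OF bk[OF FV]]
        bilinear_lmul[OF bk[OF FV]] bilinear_rmul[OF bk[OF FV]] algebra_simps)
  ultimately show ?thesis unfolding has_partials_def by simp
qed

lemma cauchy_riemann:
  assumes "has_partials u a b z" "has_partials v (- b) a z"
  shows "((\<lambda>w. Complex (u w) (v w)) has_field_derivative Complex a (- b)) (at z)"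
proof -
  have "((\<lambda>w. of_real (u w) + \<i> * of_real (v w)) has_derivative
    (\<lambda>h. of_real (Re h *\<^sub>R a + Im h *\<^sub>R b) + \<i> * of_real (Re h *\<^sub>R (- b) + Im h *\<^sub>R a))) (at z)"
    using assms unfolding has_partials_def
    by (auto intro!: derivative_eq_intros)
  moreover have "(\<lambda>h. complex_of_real (Re h *\<^sub>R a + Im h *\<^sub>R b) + \<i> * complex_of_real (Re h *\<^sub>R (- b)
      + Im h *\<^sub>R a)) = (*) (Complex a (- b))"
    by (auto simp: complex_eq_iff algebra_simps)
  ultimately show ?thesis unfolding has_field_derivative_def Complex_eq by simp
qed

text \<open>In the Cauchy-Riemann equations for the real and imaginary part of the coefficient the
  second derivatives combine to the Laplacian of \<open>F\<close> paired with one of the partial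
  derivatives. The harmonic equation replaces it by Christoffel terms, and these cancel the
  derivatives of the metric.\<close>

lemma hopf_local_differentiable:
  assumes m: "metric_on V K" and N: "open N" "\<And>w. w \<in> N \<Longrightarrow> F w \<in> V"
    and F: "C2_on F N" and z: "z \<in> N" and h: "harmonic_at K F z"
  shows "hopf_local K F field_differentiable (at z)"
proof -
  let ?p = "pdx F" and ?q = "pdy F"
  have d: "F differentiable (at w)" if "w \<in> N" for w using F that by (auto simp: C2_on_def)
  have C: "C1_on (pdx F) N" "C1_on (pdy F) N" "C1_on F N"
    using F C2_on_C1_on[OF F] by (auto simp: C2_on_def)
  note P = C1_on_partials[OF C(1) z] and Q = C1_on_partials[OF C(2) z]
      and FF = C1_on_partials[OF C(3) z]
  have FV: "F z \<in> V" using N z by auto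
  note bk = metric_onD(2)[OF m FV] and s = metric_onD(3)[OF m FV]
  have mx: "pdy (pdx F) z = pdx (pdy F) z" by (rule mixed_partials_commute[OF F N(1) z])
  have M: "has_partials (\<lambda>w. K (F w) (P w) (Q w))
    (metric_deriv K (F z) (pdx F z) (P z) (Q z) + K (F z) Px (Q z) + K (F z) (P z) Qx)
    (metric_deriv K (F z) (pdy F z) (P z) (Q z) + K (F z) Py (Q z) + K (F z) (P z) Qy) z"
    if "has_partials P Px Py z" "has_partials Q Qx Qy z" for P Q Px Py Qx Qy
    by (rule metric_compose_partials[OF m N(1) z N(2) FF that])
  let ?k = "K (F z)" and ?d = "metric_deriv K (F z)"
  have h1: "?k (pdx (pdx F) z) w + ?k (pdy (pdy F) z) w + (?d (?p z) (?p z) w - ?d w (?p z) (?p z) / 2)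
     + (?d (?q z) (?q z) w - ?d w (?q z) (?q z) / 2) = 0" for w
    using h unfolding harmonic_at_def christoffel1_def by (simp add: bilinear_ladd[OF bk] field_simps)
  have sc: "has_partials (\<lambda>w. c * U w) (c * a) (c * b) z" if "has_partials U a b z"
      for U a b and c :: real
    using has_derivative_mult_right[OF that[unfolded has_partials_def], of c]
    unfolding has_partials_def by (simp add: algebra_simps)
  define a where "a = (1/4) * ((?d (?p z) (?p z) (?p z) + ?k (pdx ?p z) (?p z) + ?k (?p z) (pdx ?p z))
       - (?d (?p z) (?q z) (?q z) + ?k (pdx ?q z) (?q z) + ?k (?q z) (pdx ?q z)))"
  define b where "b = (1/4) * ((?d (?q z) (?p z) (?p z) + ?k (pdy ?p z) (?p z) + ?k (?p z) (pdy ?p z))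
       - (?d (?q z) (?q z) (?q z) + ?k (pdy ?q z) (?q z) + ?k (?q z) (pdy ?q z)))"
  have u: "has_partials (\<lambda>w. (1/4) * (K (F w) (?p w) (?p w) - K (F w) (?q w) (?q w))) a b z"
    unfolding a_def b_def by (rule sc[OF has_partials_diff[OF M[OF P P] M[OF Q Q]]])
  have "has_partials (\<lambda>w. (-1/2) * K (F w) (?p w) (?q w))
     ((-1/2) * (?d (?p z) (?p z) (?q z) + ?k (pdx ?p z) (?q z) + ?k (?p z) (pdx ?q z)))
     ((-1/2) * (?d (?q z) (?p z) (?q z) + ?k (pdy ?p z) (?q z) + ?k (?p z) (pdy ?q z))) z"
    by (rule sc[OF M[OF P Q]])
  \<comment> \<open>One Cauchy-Riemann equation is the harmonic equation tested with
    \<open>pdy F z\<close>, the other is the same equation tested with \<open>pdx F z\<close>;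
    \<open>mx\<close> identifies the mixed derivatives.\<close>
  moreover have "(-1/2) * (?d (?p z) (?p z) (?q z) + ?k (pdx ?p z) (?q z) + ?k (?p z) (pdx ?q z)) = - b"
    using h1[of "?q z"] s[of "?p z" "pdx ?q z"] s[of "?q z" "pdy ?q z"] s[of "?p z" "pdy ?p z"]
    unfolding b_def mx by simp
  moreover have "(-1/2) * (?d (?q z) (?p z) (?q z) + ?k (pdy ?p z) (?q z) + ?k (?p z) (pdy ?q z)) = a"
    using h1[of "?p z"] s[of "?p z" "pdx ?p z"] s[of "?q z" "pdx ?q z"] s[of "?p z" "pdy ?q z"]
      metric_deriv_sym[OF m FV, of "?q z" "?p z" "?q z"]
    unfolding a_def mx by (simp add: field_simps)
  ultimately have v: "has_partials (\<lambda>w. (-1/2) * K (F w) (?p w) (?q w)) (- b) a z" by simp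
  from cauchy_riemann[OF u v]
  have "(hopf_local K F has_field_derivative Complex a (- b)) (at z)"
    by (rule DERIV_cong_ev[THEN iffD1, OF refl _ refl, rotated])
      (use N z in \<open>auto simp: eventually_nhds hopf_local_eq[OF m N(2) d] intro!: exI[of _ N]\<close>)
  then show ?thesis using field_differentiable_def by blast
qed

lemma hopf_plane_eq_local:
  assumes B: "smooth_manifold Y B" "C2_riemannian_metric B \<nu>"
    and F: "harmonic_plane Y B \<nu> S F" and z: "z \<in> S" and d: "d \<in> B" "F z \<in> fst d"
  shows "hopf_plane B \<nu> F z = hopf_local (\<nu> d) (\<lambda>z. snd d (F z)) z"
proof -
  obtain d' where d': "d' \<in> B" "F z \<in> fst d'" "d' = (SOME d. d \<in> B \<and> F z \<in> fst d)"
    using hopf_plane_some[OF B(1) F z] by blast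
  show ?thesis
    unfolding hopf_plane_def d'(3)[symmetric] Let_def
    by (rule hopf_local_chart[OF B F z d'(1,2) d])
qed

lemma hopf_plane_holomorphic:
  assumes B: "smooth_manifold Y B" "C2_riemannian_metric B \<nu>"
    and F: "harmonic_plane Y B \<nu> S F"
  shows "hopf_plane B \<nu> F holomorphic_on S"
proof -
  note D = harmonic_planeD[OF F B(1)]
  have "hopf_plane B \<nu> F field_differentiable (at z)" if z: "z \<in> S" for z
  proof -
    obtain d where d: "d \<in> B" "F z \<in> fst d" using D(6)[OF z] by blast
    let ?N = "{z \<in> S. F z \<in> fst d}"
    have "hopf_local (\<nu> d) (\<lambda>z. snd d (F z)) field_differentiable (at z)"
      by (rule hopf_local_differentiable[OF riemannian_metric_on[OF B d(1)] D(5)[OF d(1)] _ D(3)[OF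
          d(1)]])
        (use z d D(4)[OF d(1)] in auto)
    then obtain e where "(hopf_local (\<nu> d) (\<lambda>z. snd d (F z)) has_field_derivative e) (at z)"
      using field_differentiable_def by blast
    from has_field_derivative_transform_within_open[OF this D(5)[OF d(1)], of "hopf_plane B \<nu> F"]
    have "(hopf_plane B \<nu> F has_field_derivative e) (at z)"
      using z d hopf_plane_eq_local[OF B F _ d(1)] by auto
    then show ?thesis using field_differentiable_def by blast
  qed
  then show ?thesis by (simp add: holomorphic_on_def field_differentiable_at_within)
qed

section \<open>Germs of holomorphic maps between charts\<close>

locale harmonic_surface_map =
  fixes X :: "'a topology" and A :: "('a, complex) chart set" and \<mu> :: "('a, complex) metric"
    and Y :: "'b topology" and B :: "('b, 'h::euclidean_space) chart set"
    and \<nu> :: "('b, 'h) metric" and f :: "'a \<Rightarrow> 'b"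
  assumes surface: "riemann_surface X A" and conformal: "C2_conformal_metric A \<mu>"
    and target: "smooth_manifold Y B" "C2_riemannian_metric B \<nu>"
    and harmonic: "harmonic_map X A \<mu> Y B \<nu> f"
    and hopf_nonzero: "\<exists>c\<in>A. \<exists>z \<in> snd c ` fst c. hopf B \<nu> f c z \<noteq> 0"
begin

abbreviation U :: "('a, complex) chart \<Rightarrow> complex set" where "U c \<equiv> snd c ` fst c"
abbreviation F :: "('a, complex) chart \<Rightarrow> complex \<Rightarrow> 'b" where "F c z \<equiv> f (chart_inv c z)"
abbreviation \<Phi> :: "('a, complex) chart \<Rightarrow> complex \<Rightarrow> complex" where "\<Phi> c \<equiv> hopf B \<nu> f c"
abbreviation \<Z> :: "'a set" where "\<Z> \<equiv> hopf_zeros A B \<nu> f"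

lemma chart: "c \<in> A \<Longrightarrow> is_chart X c"
  by (rule riemann_surface_chart[OF surface])

lemma F_harmonic: "c \<in> A \<Longrightarrow> harmonic_plane Y B \<nu> (U c) (F c)"
  by (rule harmonic_map_chart[OF surface conformal target harmonic])

lemma \<Phi>_eq: "\<Phi> c = hopf_plane B \<nu> (F c)"
  by (rule ext) (rule hopf_eq_hopf_plane)

lemma \<Phi>_holomorphic: "c \<in> A \<Longrightarrow> \<Phi> c holomorphic_on U c"
  unfolding \<Phi>_eq by (rule hopf_plane_holomorphic[OF target F_harmonic])

lemma cover: "p \<in> topspace X \<Longrightarrow> \<exists>c\<in>A. p \<in> fst c"
  using surface unfolding riemann_surface_def topological_manifold_def by blast

lemma transition:
  assumes c: "c \<in> A" and d: "d \<in> A"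
  shows "open (snd c ` (fst c \<inter> fst d))"
    and "(\<lambda>z. snd d (chart_inv c z)) holomorphic_on snd c ` (fst c \<inter> fst d)"
    and "inj_on (\<lambda>z. snd d (chart_inv c z)) (snd c ` (fst c \<inter> fst d))"
proof -
  note C = is_chartD[OF chart[OF c]] and D = is_chartD[OF chart[OF d]]
  show "open (snd c ` (fst c \<inter> fst d))"
    by (rule is_chart_open_image[OF chart[OF c]]) (use C(1) D(1) in auto)
  have "local_rep c d id holomorphic_on local_dom c d id UNIV"
    using surface c d by (auto simp: riemann_surface_def)
  moreover have "local_dom c d id UNIV = snd c ` (fst c \<inter> fst d)" by (auto simp: local_dom_def)
  ultimately show "(\<lambda>z. snd d (chart_inv c z)) holomorphic_on snd c ` (fst c \<inter> fst d)"
    by (simp add: local_rep_eq)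
  show "inj_on (\<lambda>z. snd d (chart_inv c z)) (snd c ` (fst c \<inter> fst d))"
    using C(6) D(3) by (auto simp: inj_on_def)
qed

text \<open>A change of chart multiplies the coefficient by the square of the derivative of the
  transition map, which is injective and so has no critical points. Hence zeros may be tested in any
  chart around the point.\<close>

lemma hopf_transition:
  assumes c: "c \<in> A" and d: "d \<in> A" and p: "p \<in> fst c" "p \<in> fst d"
  shows "\<Phi> c (snd c p) = 0 \<longleftrightarrow> \<Phi> d (snd d p) = 0"
proof -
  note C = is_chartD[OF chart[OF c]] and D = is_chartD[OF chart[OF d]]
  let ?t = "\<lambda>z. snd d (chart_inv c z)" and ?N = "snd c ` (fst c \<inter> fst d)"
  note t = transition[OF c d]
  have z: "snd c p \<in> ?N" using p by auto
  have "hopf_plane B \<nu> (\<lambda>z. F d (?t z)) (snd c p)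
      = hopf_plane B \<nu> (F d) (?t (snd c p)) * (deriv ?t (snd c p))\<^sup>2"
    by (rule hopf_plane_compose[OF target F_harmonic[OF d] t(2,1) z]) (use p C in auto)
  moreover have "hopf_plane B \<nu> (\<lambda>z. F d (?t z)) (snd c p) = hopf_plane B \<nu> (F c) (snd c p)"
    by (rule hopf_plane_cong[OF t(1) z]) (use C(6) D(6) in auto)
  moreover have "deriv ?t (snd c p) \<noteq> 0"
    by (rule holomorphic_injective_imp_regular[OF t(2,1,3) z])
  ultimately show ?thesis unfolding \<Phi>_eq using p C(6) by simp
qed

lemma hopf_zeros_iff:
  assumes "c \<in> A" "p \<in> fst c"
  shows "p \<in> \<Z> \<longleftrightarrow> \<Phi> c (snd c p) = 0"
  unfolding hopf_zeros_def using assms hopf_transition by blast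

text \<open>The identity theorem on a connected surface. The union \<open>E\<close> of all open sets
  of zeros is also closed: around a point of its closure lies a coordinate disc that meets
  \<open>E\<close> in a nonempty open set, and analytic continuation makes the coefficient vanish on
  the whole disc.\<close>

lemma not_locally_zero:
  assumes c: "c \<in> A" and W: "open W" "W \<subseteq> U c" "W \<noteq> {}"
  shows "\<exists>z\<in>W. \<Phi> c z \<noteq> 0"
proof (rule ccontr)
  assume "\<not> (\<exists>z\<in>W. \<Phi> c z \<noteq> 0)"
  then have W0: "\<And>z. z \<in> W \<Longrightarrow> \<Phi> c z = 0" by blast
  define E where "E = \<Union>{V. openin X V \<and> V \<subseteq> \<Z>}"
  have oE: "openin X E" unfolding E_def by (auto intro: openin_Union)
  have in_zeros: "chart_inv d z \<in> \<Z> \<longleftrightarrow> \<Phi> d z = 0" if "d \<in> A" "z \<in> U d" for d z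
    using hopf_zeros_iff[OF that(1)] is_chartD(7,8)[OF chart[OF that(1)]] that(2) by metis
  have EX: "E \<subseteq> topspace X" using openin_subset[OF oE] .
  have "closedin X E"
    unfolding closure_of_subset_eq[symmetric]
  proof (intro conjI EX subsetI)
    fix p assume p: "p \<in> X closure_of E"
    then have "p \<in> topspace X" using closure_of_subset_topspace[of X E] by blast
    then obtain d where d: "d \<in> A" "p \<in> fst d" using cover by blast
    note D = is_chartD[OF chart[OF d(1)]]
    obtain r where r: "r > 0" "ball (snd d p) r \<subseteq> U d" using D(2) d(2) by (meson imageI openE)
    let ?N = "chart_inv d ` ball (snd d p) r"
    have N: "openin X ?N" by (rule is_chart_open_preimage[OF chart[OF d(1)] open_ball r(2)])
    have "p \<in> ?N" using D(6)[OF d(2)] r(1) by (metis centre_in_ball imageI)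
    then obtain q where q: "q \<in> E" "q \<in> ?N" using p N unfolding in_closure_of by blast
    have EN: "openin X (E \<inter> ?N)" using oE N by blast
    have Nd: "?N \<subseteq> fst d" using r(2) D(8) by blast
    have O: "open (snd d ` (E \<inter> ?N))"
      by (rule is_chart_open_image[OF chart[OF d(1)] EN]) (use Nd in auto)
    have sub: "snd d ` (E \<inter> ?N) \<subseteq> ball (snd d p) r" using D(7) r(2) by force
    have "\<Phi> d z = 0" if z: "z \<in> ball (snd d p) r" for z
    proof (rule analytic_continuation_open[OF O open_ball _ _ sub, of "\<Phi> d" "\<lambda>_. 0"])
      show "snd d ` (E \<inter> ?N) \<noteq> {}" using q by auto
      show "\<Phi> d holomorphic_on ball (snd d p) r"
        by (rule holomorphic_on_subset[OF \<Phi>_holomorphic[OF d(1)] r(2)])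
      show "\<Phi> d z = 0" if "z \<in> snd d ` (E \<inter> ?N)" for z
        using that hopf_zeros_iff[OF d(1)] Nd unfolding E_def by blast
    qed (use z in auto)
    then have "?N \<subseteq> \<Z>" using in_zeros[OF d(1)] r(2) by blast
    then show "p \<in> E" unfolding E_def using N \<open>p \<in> ?N\<close> by blast
  qed
  moreover have "connected_space X" using surface by (auto simp: riemann_surface_def)
  ultimately have "E = {} \<or> E = topspace X" using oE by (auto simp: connected_space_clopen_in)
  moreover have "chart_inv c ` W \<subseteq> E"
  proof -
    have "chart_inv c w \<in> \<Z>" if "w \<in> W" for w
      using in_zeros[OF c, of w] W0[OF that] W(2) that by blast
    then have "chart_inv c ` W \<subseteq> \<Z>" by blast
    then show ?thesis
      unfolding E_def using is_chart_open_preimage[OF chart[OF c] W(1,2)] by (intro Union_upper) simp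
  qed
  ultimately have "E = topspace X" using W(3) by blast
  moreover obtain d z where d: "d \<in> A" "z \<in> U d" "\<Phi> d z \<noteq> 0" using hopf_nonzero by blast
  moreover have "chart_inv d z \<in> topspace X"
    using openin_subset[OF is_chartD(1)[OF chart[OF d(1)]]] is_chartD(8)[OF chart[OF d(1)] d(2)]
      by blast
  moreover have "E \<subseteq> \<Z>" unfolding E_def by blast
  ultimately show False using in_zeros[OF d(1,2)] by blast
qed

text \<open>Expresses the relation in coordinates: the domain of the diffeomorphism is shrunk to a
  disc in the chart \<open>c\<close> whose image fits into the chart \<open>d\<close>.\<close>

lemma sim_regular_germ:
  assumes s: "sim_regular X A B \<nu> f p q" and c: "c \<in> A" "p \<in> fst c" and d: "d \<in> A" "q \<in> fst d"
  obtains r k where "r > 0" "ball (snd c p) r \<subseteq> U c" "k holomorphic_on ball (snd c p) r"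
    "inj_on k (ball (snd c p) r)" "k ` ball (snd c p) r \<subseteq> U d" "k (snd c p) = snd d q"
    "\<And>z. z \<in> ball (snd c p) r \<Longrightarrow> F c z = F d (k z)"
proof -
  note C = is_chartD[OF chart[OF c(1)]] and D = is_chartD[OF chart[OF d(1)]]
  from s obtain W1 W2 h where W: "openin X W1" "p \<in> W1" "openin X W2" "q \<in> W2"
    and h: "holomorphic_diffeo X A W1 W2 h" "h p = q" "\<And>q. q \<in> W1 \<Longrightarrow> f q = f (h q)"
    unfolding sim_regular_def by blast
  have cont: "continuous_map (subtopology X W1) X h"
    using h(1) homeomorphic_imp_continuous_map unfolding holomorphic_diffeo_def
    by (metis continuous_map_in_subtopology)
  define P where "P = {p \<in> fst c \<inter> W1. h p \<in> fst d}"
  have tW: "topspace (subtopology X W1) = W1" using openin_subset[OF W(1)] by auto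
  have "openin (subtopology X W1) {x \<in> W1. h x \<in> fst d}"
    using openin_continuous_map_preimage[OF cont D(1)] unfolding tW .
  then have "openin X {x \<in> W1. h x \<in> fst d}" using W(1) openin_trans_full by blast
  moreover have "P = {x \<in> W1. h x \<in> fst d} \<inter> fst c" by (auto simp: P_def)
  ultimately have "openin X P" using C(1) by auto
  then have "open (snd c ` P)" by (rule is_chart_open_image[OF chart[OF c(1)]]) (auto simp: P_def)
  moreover have "snd c p \<in> snd c ` P" using c W h d by (auto simp: P_def)
  ultimately obtain r where r: "r > 0" "ball (snd c p) r \<subseteq> snd c ` P" using openE by blast
  have "local_rep c d h holomorphic_on snd c ` P"
    using h(1) c(1) d(1) unfolding holomorphic_diffeo_def holomorphic_between_def local_dom_def
        P_def by blast
  then have hol: "local_rep c d h holomorphic_on ball (snd c p) r" using r(2) holomorphic_on_subset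
    by blast
  show ?thesis
  proof (rule that[OF r(1) _ hol])
    show "ball (snd c p) r \<subseteq> U c" using r(2) by (auto simp: P_def)
    show "local_rep c d h ` ball (snd c p) r \<subseteq> U d"
      using r(2) C(6) by (force simp: P_def local_rep_eq)
    show "local_rep c d h (snd c p) = snd d q" using C(6)[OF c(2)] h(2) by (simp add: local_rep_eq)
    have "homeomorphic_map (subtopology X W1) (subtopology X W2) h" using h(1)
      by (simp add: holomorphic_diffeo_def)
    from homeomorphic_imp_injective_map[OF this] have inj: "inj_on h W1" unfolding tW .
    have "inj_on (local_rep c d h) (snd c ` P)"
    proof (rule inj_onI, clarify)
      fix x y assume xy: "x \<in> P" "y \<in> P" "local_rep c d h (snd c x) = local_rep c d h (snd c y)"
      then have "snd d (h x) = snd d (h y)" using C(6) by (simp add: local_rep_eq P_def)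
      then have "h x = h y" using xy(1,2) D(3) by (auto simp: P_def dest: inj_onD)
      then have "x = y" using xy(1,2) inj by (auto simp: P_def dest: inj_onD)
      then show "snd c x = snd c y" by simp
    qed
    then show "inj_on (local_rep c d h) (ball (snd c p) r)" using r(2) inj_on_subset by blast
    fix z assume "z \<in> ball (snd c p) r"
    then obtain p' where "p' \<in> P" "z = snd c p'" using r(2) by blast
    then show "F c z = F d (local_rep c d h z)"
      using C(6) D(6) h(3) by (simp add: P_def local_rep_eq)
  qed
qed

lemma chart_homeomorphic_maps:
  assumes c: "c \<in> A" and S: "S \<subseteq> U c"
  shows "homeomorphic_maps (subtopology X (chart_inv c ` S)) (top_of_set S) (snd c) (chart_inv c)"
proof -
  note C = is_chartD[OF chart[OF c]]
  have sub: "chart_inv c ` S \<subseteq> fst c" using S C(8) by blast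
  have "continuous_map (subtopology X (chart_inv c ` S)) euclidean (snd c)"
    using continuous_map_from_subtopology_mono[OF C(4) sub] .
  moreover have "continuous_map (top_of_set S) X (chart_inv c)"
    using continuous_map_from_subtopology_mono[OF C(5) S] .
  ultimately show ?thesis
    unfolding homeomorphic_maps_def using S C(6,7,8)
    by (auto simp: continuous_map_in_subtopology image_subset_iff subset_iff)
qed

text \<open>One coordinate expression suffices, since those in all other charts differ from it by
  transition maps on either side.\<close>

lemma holomorphic_between_chart:
  assumes c: "c \<in> A" and d: "d \<in> A" and W: "W \<subseteq> fst c" "snd c ` W \<subseteq> S"
    and k: "k holomorphic_on S" "k ` S \<subseteq> U d" and h: "\<And>p. p \<in> W \<Longrightarrow> h p = chart_inv d (k (snd c p))"
  shows "holomorphic_between A W h"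
  unfolding holomorphic_between_def
proof (intro ballI)
  fix a b assume a: "a \<in> A" and b: "b \<in> A"
  note D = is_chartD[OF chart[OF d]]
  note A' = is_chartD[OF chart[OF a]]
  let ?L = "local_dom a b h W"
  have L: "?L = snd a ` {p \<in> fst a \<inter> W. h p \<in> fst b}" by (simp add: local_dom_def)
  have 1: "(\<lambda>z. snd c (chart_inv a z)) holomorphic_on ?L"
    by (rule holomorphic_on_subset[OF transition(2)[OF a c]]) (use W in \<open>auto simp: L\<close>)
  have 2: "(\<lambda>z. k (snd c (chart_inv a z))) holomorphic_on ?L"
    by (rule holomorphic_on_compose_gen[OF 1 k(1), unfolded o_def]) (use W A'(6) in \<open>auto simp: L\<close>)
  have 3: "(\<lambda>z. snd b (chart_inv d (k (snd c (chart_inv a z))))) holomorphic_on ?L"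
  proof (rule holomorphic_on_compose_gen[OF 2 transition(2)[OF d b], unfolded o_def])
    show "(\<lambda>z. k (snd c (chart_inv a z))) ` ?L \<subseteq> snd d ` (fst d \<inter> fst b)"
    proof
      fix y assume "y \<in> (\<lambda>z. k (snd c (chart_inv a z))) ` ?L"
      then obtain p where p: "p \<in> fst a" "p \<in> W" "h p \<in> fst b" "y = k (snd c p)"
        using A'(6) by (auto simp: L)
      then have "y \<in> U d" using W k(2) by blast
      moreover have "chart_inv d y \<in> fst b" using h p by metis
      ultimately show "y \<in> snd d ` (fst d \<inter> fst b)" using D(7,8) by (metis IntI imageI)
    qed
  qed
  show "local_rep a b h holomorphic_on ?L"
    by (rule holomorphic_transform[OF 3]) (use A'(6) h in \<open>auto simp: L local_rep_eq\<close>)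
qed

text \<open>Converse to \<open>sim_regular_germ\<close>. The second open set is the image of the
  first, and an injective holomorphic map has a holomorphic inverse on its image, so the lift to the
  surface is a diffeomorphism.\<close>

lemma germ_sim_regular:
  assumes c: "c \<in> A" and d: "d \<in> A" and S: "open S" "S \<subseteq> U c" "z \<in> S"
    and k: "k holomorphic_on S" "inj_on k S" "k ` S \<subseteq> U d"
    and eq: "\<And>z. z \<in> S \<Longrightarrow> F c z = F d (k z)"
    and nz: "chart_inv c z \<notin> \<Z>" "chart_inv d (k z) \<notin> \<Z>"
  shows "sim_regular X A B \<nu> f (chart_inv c z) (chart_inv d (k z))"
proof -
  note C = is_chartD[OF chart[OF c]] and D = is_chartD[OF chart[OF d]]
  have oS: "open (k ` S)" by (rule open_mapping_thm3[OF k(1) S(1) k(2)])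
  obtain k' where k': "k' holomorphic_on k ` S" "\<And>z. z \<in> S \<Longrightarrow> k' (k z) = z"
    using holomorphic_has_inverse[OF k(1) S(1) k(2)] by metis
  let ?W1 = "chart_inv c ` S" and ?W2 = "chart_inv d ` k ` S"
  let ?h = "chart_inv d \<circ> (k \<circ> snd c)" and ?g = "(chart_inv c \<circ> k') \<circ> snd d"
  have "homeomorphic_maps (top_of_set S) (top_of_set (k ` S)) k k'"
    using k(1) k' by (auto simp: homeomorphic_maps_def continuous_map_in_subtopology intro:
        holomorphic_on_imp_continuous_on)
  from homeomorphic_maps_compose[OF conjI[OF homeomorphic_maps_compose[OF conjI[OF
      chart_homeomorphic_maps[OF c S(2)] this]]
      homeomorphic_maps_sym[THEN iffD1, OF chart_homeomorphic_maps[OF d k(3)]]]]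
  have hm: "homeomorphic_maps (subtopology X ?W1) (subtopology X ?W2) ?h ?g" .
  have o1: "openin X ?W1" "openin X ?W2"
    by (rule is_chart_open_preimage[OF chart[OF c] S(1,2)] is_chart_open_preimage[OF chart[OF d] oS
        k(3)])+
  have hp: "?h (chart_inv c w) = chart_inv d (k w)" if "w \<in> S" for w using that S(2) C(7) by auto
  have inj: "inj_on ?h ?W1"
    using homeomorphic_imp_injective_map[OF homeomorphic_maps_imp_map[OF hm]] openin_subset[OF
        o1(1)] by (simp add: inf_absorb2)
  have inv: "inv_into ?W1 ?h q = chart_inv c (k' (snd d q))" if q: "q \<in> ?W2" for q
  proof -
    obtain w where w: "w \<in> S" "q = chart_inv d (k w)" using q by blast
    have "inv_into ?W1 ?h (?h (chart_inv c w)) = chart_inv c w" using inj w by (intro inv_into_f_f) auto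
    moreover have "snd d (chart_inv d (k w)) = k w" using w(1) k(3) by (intro D(7)) blast
    ultimately show ?thesis using w hp k'(2) by simp
  qed
  have "holomorphic_diffeo X A ?W1 ?W2 ?h"
    unfolding holomorphic_diffeo_def
  proof (intro conjI)
    show "homeomorphic_map (subtopology X ?W1) (subtopology X ?W2) ?h"
      by (rule homeomorphic_maps_imp_map[OF hm])
    show "holomorphic_between A ?W1 ?h"
      by (rule holomorphic_between_chart[OF c d _ _ k(1,3)]) (use C(7,8) S(2) in auto)
    have "?W2 \<subseteq> fst d" using D(8) k(3) by blast
    moreover have "snd d ` ?W2 \<subseteq> k ` S"
    proof (clarify)
      fix w assume "w \<in> S"
      then have "snd d (chart_inv d (k w)) = k w" using k(3) by (intro D(7)) blast
      then show "snd d (chart_inv d (k w)) \<in> k ` S" using \<open>w \<in> S\<close> by simp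
    qed
    moreover have "k' ` k ` S \<subseteq> U c" using k'(2) S(2) by auto
    ultimately show "holomorphic_between A ?W2 (inv_into ?W1 ?h)"
      by (rule holomorphic_between_chart[OF d c _ _ k'(1) _ inv])
  qed
  moreover have "\<forall>q\<in>?W1. f q = f (?h q)" using eq hp by auto
  ultimately show ?thesis
    unfolding sim_regular_def using nz o1 hp[OF S(3)] S(3) by blast
qed

end

section \<open>Normal form of the Hopf differential\<close>

text \<open>Solved coefficient by coefficient: the power series of \<open>\<gamma>\<close> is
  divided termwise by \<open>n + \<alpha>\<close>. As \<open>\<alpha>\<close> is positive the
  divisors stay away from 0, so the series for \<open>G\<close> converges on the same disc.\<close>

lemma euler_equation_holomorphic:
  fixes \<gamma> :: "complex \<Rightarrow> complex" and \<alpha> :: real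
  assumes \<gamma>: "\<gamma> holomorphic_on ball 0 r" and \<alpha>: "\<alpha> > 0"
  obtains G where "G holomorphic_on ball 0 r"
    "\<And>x. x \<in> ball 0 r \<Longrightarrow> x * deriv G x + of_real \<alpha> * G x = \<gamma> x"
proof -
  define a where "a = (\<lambda>n. (deriv ^^ n) \<gamma> 0 / fact n)"
  define c where "c = (\<lambda>n. a n / (of_nat n + of_real \<alpha>))"
  have sums_a: "(\<lambda>n. a n * x ^ n) sums \<gamma> x" if "x \<in> ball 0 r" for x
    using holomorphic_power_series[OF \<gamma> that] by (simp add: a_def)
  have nz: "of_nat n + complex_of_real \<alpha> \<noteq> 0" for n
  proof -
    have "Re (of_nat n + complex_of_real \<alpha>) > 0" using \<alpha> by simp
    then show ?thesis by force
  qed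
  have nc: "norm (c n) \<le> norm (a n) / \<alpha>" for n
  proof -
    have "\<alpha> \<le> Re (of_nat n + complex_of_real \<alpha>)" by simp
    also have "\<dots> \<le> norm (of_nat n + complex_of_real \<alpha>)" by (rule complex_Re_le_cmod)
    finally show ?thesis unfolding c_def norm_divide using \<alpha>
      by (intro divide_left_mono mult_pos_pos) auto
  qed
  have sum_c: "summable (\<lambda>n. c n * x ^ n)" if x: "x \<in> ball 0 r" for x
  proof -
    obtain K where K: "norm x < K" "K < r" using x dense by (auto simp: dist_norm)
    have K0: "K > 0" using K norm_ge_zero[of x] by linarith
    have "summable (\<lambda>n. norm (a n * x ^ n))"
    proof (rule powser_insidea[of a "of_real K"])
      have "of_real K \<in> ball (0::complex) r" using K K0 by simp
      then show "summable (\<lambda>n. a n * of_real K ^ n)" using sums_a sums_summable by blast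
    qed (use K K0 in auto)
    then have "summable (\<lambda>n. norm (a n * x ^ n) / \<alpha>)" by (rule summable_divide)
    then show ?thesis
      by (rule summable_comparison_test'[of _ 0])
        (use nc in \<open>auto simp: norm_mult norm_power mult_right_mono simp flip: times_divide_eq_left\<close>)
  qed
  define G where "G = (\<lambda>x. \<Sum>n. c n * x ^ n)"
  have dG: "(G has_field_derivative (\<Sum>n. diffs c n * x ^ n)) (at x)" and eq:
      "x * (\<Sum>n. diffs c n * x ^ n) + of_real \<alpha> * G x = \<gamma> x"
    if x: "x \<in> ball 0 r" for x
  proof -
    obtain K where K: "norm x < K" "K < r" using x dense by (auto simp: dist_norm)
    have K0: "K > 0" using K norm_ge_zero[of x] by linarith
    have sK: "summable (\<lambda>n. c n * of_real K ^ n)" by (rule sum_c) (use K K0 in \<open>auto simp: dist_norm\<close>)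
    show "(G has_field_derivative (\<Sum>n. diffs c n * x ^ n)) (at x)"
      unfolding G_def by (rule termdiffs_strong[OF sK]) (use K K0 in simp)
    have "summable (\<lambda>n. diffs c n * x ^ n)"
      by (rule termdiff_converges[of _ "K"]) (use K K0 sum_c in \<open>auto simp: dist_norm\<close>)
    from sums_mult[OF diffs_equiv[OF this], of x]
    have "(\<lambda>n. of_nat n * c n * x ^ n) sums (x * (\<Sum>n. diffs c n * x ^ n))"
    proof (rule sums_cong[THEN iffD1, rotated])
      fix n show "x * (of_nat n * c n * x ^ (n - Suc 0)) = of_nat n * c n * x ^ n"
        by (cases n) auto
    qed
    moreover have "(\<lambda>n. of_real \<alpha> * (c n * x ^ n)) sums (of_real \<alpha> * G x)"
      unfolding G_def by (intro sums_mult summable_sums sum_c x)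
    ultimately have "(\<lambda>n. of_nat n * c n * x ^ n
        + of_real \<alpha> * (c n * x ^ n)) sums (x * (\<Sum>n. diffs c n * x ^ n) + of_real \<alpha> * G x)"
      by (rule sums_add)
    moreover have "of_nat n * c n * x ^ n + of_real \<alpha> * (c n * x ^ n) = a n * x ^ n" for n
    proof -
      have "of_nat n * c n * x ^ n + of_real \<alpha> * (c n * x ^ n) = (of_nat n + of_real \<alpha>) * c n * x ^ n"
        by (simp add: algebra_simps)
      also have "(of_nat n + of_real \<alpha>) * c n = a n" using nz[of n] by (simp add: c_def)
      finally show ?thesis .
    qed
    ultimately show "x * (\<Sum>n. diffs c n * x ^ n) + of_real \<alpha> * G x = \<gamma> x"
      using sums_a[OF x] by (metis (no_types, lifting) sums_cong sums_unique2)
  qed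
  show ?thesis
  proof (rule that)
    show "G holomorphic_on ball 0 r"
      using dG by (subst holomorphic_on_open) blast+
    show "x * deriv G x + of_real \<alpha> * G x = \<gamma> x" if "x \<in> ball 0 r" for x
      using eq[OF that] DERIV_imp_deriv[OF dG[OF that]] by simp
  qed
qed

lemma contractible_ball: "contractible (ball (z::complex) r)"
  by (rule convex_imp_contractible) simp

lemma factor_order:
  assumes \<phi>: "\<phi> holomorphic_on ball 0 r" and r: "r > 0" and nz:
      "\<And>e. 0 < e \<Longrightarrow> \<exists>z\<in>ball 0 e \<inter> ball 0 r. \<phi> z \<noteq> 0"
  obtains g \<rho> m where "0 < \<rho>" "\<rho> \<le> r" "g holomorphic_on ball 0 \<rho>"
    "\<And>w. w \<in> ball 0 \<rho> \<Longrightarrow> \<phi> w = w ^ m * g w" "\<And>w. w \<in> ball 0 \<rho> \<Longrightarrow> g w \<noteq> 0" "\<phi> 0 = 0 \<longleftrightarrow> m > 0"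
proof (cases "\<phi> 0 = 0")
  case True
  have "\<not> \<phi> constant_on ball 0 r"
  proof
    assume "\<phi> constant_on ball 0 r"
    then obtain y where y: "\<And>z. z \<in> ball 0 r \<Longrightarrow> \<phi> z = y" unfolding constant_on_def by blast
    then have "y = 0" using True r by force
    then show False using nz[OF r] y by blast
  qed
  note nc = this
  have c0: "0 \<in> ball (0::complex) r" using r by simp
  obtain g \<rho> n where
    *: "0 < n" "0 < \<rho>" "ball (0::complex) \<rho> \<subseteq> ball 0 r" "g holomorphic_on ball 0 \<rho>"
    "\<And>w. w \<in> ball 0 \<rho> \<Longrightarrow> \<phi> w = (w - 0) ^ n * g w" "\<And>w. w \<in> ball 0 \<rho> \<Longrightarrow> g w \<noteq> 0"
    by (rule holomorphic_factor_zero_nonconstant[OF \<phi> open_ball connected_ball c0 True nc]) (rule that)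
  have "\<rho> \<le> r" using *(2,3) r by (simp add: ball_subset_ball_iff)
  then show ?thesis using that[of \<rho> g n] * True by auto
next
  case False
  have "continuous (at 0) \<phi>"
    using holomorphic_on_imp_continuous_on[OF \<phi>] r by (simp add: continuous_on_eq_continuous_at)
  from continuous_at_avoid[OF this False] obtain d where d: "d > 0" "\<And>y. dist 0 y < d \<Longrightarrow> \<phi> y \<noteq> 0"
    by blast
  define \<rho> where "\<rho> = min d r"
  have \<rho>: "\<rho> > 0" "ball 0 \<rho> \<subseteq> {z \<in> ball 0 r. \<phi> z \<noteq> 0}" "\<rho> \<le> r" using d r by (auto simp: \<rho>_def)
  have "ball 0 \<rho> \<subseteq> ball (0::complex) r" using \<rho>(2) by blast
  moreover have "\<phi> w \<noteq> 0" if "w \<in> ball 0 \<rho>" for w using \<rho>(2) that by blast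
  ultimately show ?thesis
    using False by (intro that[OF \<rho>(1,3), of \<phi> 0] holomorphic_on_subset[OF \<phi>]) auto
qed

text \<open>The conclusion says that \<open>\<phi> dz\<^sup>2 = dw\<^sup>2\<close> with \<open>w = x\<^bsup>(m+2)/2\<^esup>\<close>,
  where \<open>z = \<psi>(x)\<close>. Writing \<open>\<phi> = z\<^sup>m \<gamma>\<^sup>2\<close>, one looks for \<open>w = z\<^bsup>(m+2)/2\<^esup> G\<close>, and \<open>dw\<^sup>2 = \<phi> dz\<^sup>2\<close>
  becomes Euler's equation for \<open>G\<close>, which does not involve fractional powers.\<close>

lemma quadratic_differential_normal_form:
  assumes \<phi>: "\<phi> holomorphic_on V" and V: "open V" "z0 \<in> V"
    and nz: "\<And>W. open W \<Longrightarrow> W \<subseteq> V \<Longrightarrow> W \<noteq> {} \<Longrightarrow> \<exists>z\<in>W. \<phi> z \<noteq> 0"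
  obtains m :: nat and e :: real and \<psi> where "e > 0" "\<psi> holomorphic_on ball 0 e" "inj_on \<psi> (ball 0 e)"
    "\<psi> ` ball 0 e \<subseteq> V" "\<psi> 0 = z0" "\<phi> z0 = 0 \<longleftrightarrow> m > 0"
    "\<And>x. x \<in> ball 0 e \<Longrightarrow> \<phi> (\<psi> x) * (deriv \<psi> x)\<^sup>2 = of_real ((m + 2) / 2) ^ 2 * x ^ m"
proof -
  obtain r where r: "r > 0" "ball z0 r \<subseteq> V" using V openE by blast
  have sh: "(\<lambda>x. z0 + x) ` ball 0 r' = ball z0 r'" for r' :: real
    using ball_translation[of z0 0 r'] by simp
  define \<phi>0 where "\<phi>0 = (\<lambda>x. \<phi> (z0 + x))"
  have \<phi>0: "\<phi>0 holomorphic_on ball 0 r"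
    unfolding \<phi>0_def
    by (rule holomorphic_on_compose_gen[OF _ \<phi>, of "\<lambda>x. z0 + x", unfolded o_def])
      (use r sh in \<open>auto intro!: holomorphic_intros\<close>)
  have nz0: "\<exists>z\<in>ball 0 e \<inter> ball 0 r. \<phi>0 z \<noteq> 0" if "e > 0" for e
  proof -
    have "\<exists>z\<in>ball z0 (min e r). \<phi> z \<noteq> 0" by (rule nz) (use r that in auto)
    then obtain z where "z \<in> ball z0 (min e r)" "\<phi> z \<noteq> 0" by blast
    then show ?thesis by (intro bexI[of _ "z - z0"]) (auto simp: \<phi>0_def dist_norm norm_minus_commute)
  qed
  obtain g \<rho> m where g: "0 < \<rho>" "\<rho> \<le> r" "g holomorphic_on ball 0 \<rho>"
    "\<And>w. w \<in> ball 0 \<rho> \<Longrightarrow> \<phi>0 w = w ^ m * g w" "\<And>w. w \<in> ball 0 \<rho> \<Longrightarrow> g w \<noteq> 0" "\<phi>0 0 = 0 \<longleftrightarrow> m > 0"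
    by (rule factor_order[OF \<phi>0 r(1) nz0]) (assumption | rule that)+
  obtain \<gamma> where \<gamma>: "\<gamma> holomorphic_on ball 0 \<rho>" "\<And>w. w \<in> ball 0 \<rho> \<Longrightarrow> g w = \<gamma> w ^ 2"
    by (rule contractible_imp_holomorphic_sqrt[OF g(3) contractible_ball g(5)]) (assumption | rule
        that)+
  \<comment> \<open>A square root of the differential grows like \<open>z\<close> to the power
    \<open>m / 2\<close>; integration raises the exponent by one.\<close>
  define \<alpha> :: real where "\<alpha> = (real m + 2) / 2"
  have \<alpha>: "\<alpha> > 0" by (simp add: \<alpha>_def)
  obtain G where G: "G holomorphic_on ball 0 \<rho>"
    "\<And>x. x \<in> ball 0 \<rho> \<Longrightarrow> x * deriv G x + of_real \<alpha> * G x = \<gamma> x"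
    by (rule euler_equation_holomorphic[OF \<gamma>(1) \<alpha>]) (assumption | rule that)+
  have "\<gamma> 0 \<noteq> 0" using g(1) g(5)[of 0] \<gamma>(2)[of 0] by auto
  then have G0: "G 0 \<noteq> 0" using G(2)[of 0] g(1) by auto
  have "\<exists>d>0. \<forall>x\<in>ball 0 d \<inter> ball 0 \<rho>. G x \<noteq> 0"
  proof -
    have "continuous (at 0) G"
      using holomorphic_on_imp_continuous_on[OF G(1)] g(1) by (simp add: continuous_on_eq_continuous_at)
    from continuous_at_avoid[OF this G0] show ?thesis by (auto simp: dist_commute)
  qed
  then obtain d where d: "d > 0" "\<And>x. x \<in> ball 0 d \<Longrightarrow> x \<in> ball 0 \<rho> \<Longrightarrow> G x \<noteq> 0" by blast
  define \<sigma> where "\<sigma> = min d \<rho>"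
  have \<sigma>: "\<sigma> > 0" "\<sigma> \<le> \<rho>" "ball 0 \<sigma> \<subseteq> ball (0::complex) \<rho>" "\<And>x. x \<in> ball 0 \<sigma> \<Longrightarrow> G x \<noteq> 0"
    using d g(1) by (auto simp: \<sigma>_def)
  obtain L where L: "L holomorphic_on ball 0 \<sigma>" "\<And>x. x \<in> ball 0 \<sigma> \<Longrightarrow> G x = exp (L x)"
    by (rule contractible_imp_holomorphic_log[OF holomorphic_on_subset[OF G(1) \<sigma>(3)]
        contractible_ball \<sigma>(4)]) (assumption | rule that)+
  \<comment> \<open>Here \<open>w = x\<^sup>\<alpha> G(x)\<close> is to be the power
    \<open>\<alpha>\<close> of a coordinate. A logarithm \<open>L\<close> of \<open>G\<close> makes
    that coordinate, \<open>x\<close> times \<open>G\<close> to the power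
    \<open>1 / \<alpha>\<close>, single-valued; its inverse, translated to \<open>z0\<close>, is the
    \<open>\<psi>\<close> sought.\<close>
  define \<zeta> where "\<zeta> = (\<lambda>x. x * exp (L x / of_real \<alpha>))"
  have d\<zeta>: "(\<zeta> has_field_derivative exp (L x / of_real \<alpha>) * (1 + x * deriv L x / of_real \<alpha>)) (at x)"
      if "x \<in> ball 0 \<sigma>" for x
    unfolding \<zeta>_def
    using holomorphic_derivI[OF L(1) open_ball that] \<alpha>
    by (auto intro!: derivative_eq_intros simp: field_simps)
  have \<zeta>: "\<zeta> holomorphic_on ball 0 \<sigma>" using d\<zeta> by (subst holomorphic_on_open) blast+
  have key: "\<phi>0 x = of_real \<alpha> ^ 2 * \<zeta> x ^ m * (deriv \<zeta> x)\<^sup>2" if x: "x \<in> ball 0 \<sigma>" for x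
  proof -
    have x': "x \<in> ball 0 \<rho>" using x \<sigma>(3) by blast
    have "((\<lambda>x. exp (L x)) has_field_derivative exp (L x) * deriv L x) (at x)"
      using holomorphic_derivI[OF L(1) open_ball x] by (auto intro!: derivative_eq_intros)
    from has_field_derivative_transform_within_open[OF this open_ball x, of G]
    have dG: "deriv G x = G x * deriv L x" using L(2) x by (auto intro: DERIV_imp_deriv)
    have a0: "complex_of_real \<alpha> \<noteq> 0" using \<alpha> by simp
    have "of_real \<alpha> * (1 + x * deriv L x / of_real \<alpha>) = of_real \<alpha> + x * deriv L x"
      using a0 by (simp add: field_simps)
    then have "of_real \<alpha> * G x * (1 + x * deriv L x / of_real \<alpha>) = G x * (of_real \<alpha> + x * deriv L x)"
      by (simp add: mult.commute mult.left_commute)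
    then have "\<gamma> x = of_real \<alpha> * G x * (1 + x * deriv L x / of_real \<alpha>)"
      using G(2)[OF x'] unfolding dG by (simp add: algebra_simps)
    then have ph: "\<phi>0 x = x ^ m * (of_real \<alpha> * G x * (1 + x * deriv L x / of_real \<alpha>)) ^ 2"
      using g(4)[OF x'] \<gamma>(2)[OF x'] by simp
    \<comment> \<open>The exponents fit because \<open>m + 2 = 2 * \<alpha>\<close>.\<close>
    have "exp (L x / of_real \<alpha>) ^ m * exp (L x / of_real \<alpha>) ^ 2 = exp (L x / of_real \<alpha>) ^ (m + 2)"
      by (simp only: power_add)
    also have "\<dots> = exp (of_nat (m + 2) * (L x / of_real \<alpha>))" by (rule exp_of_nat_mult[symmetric])
    also have "of_nat (m + 2) = 2 * complex_of_real \<alpha>" by (simp add: \<alpha>_def)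
    also have "2 * complex_of_real \<alpha> * (L x / of_real \<alpha>) = 2 * L x" using a0 by simp
    also have "exp (2 * L x) = G x ^ 2" using L(2)[OF x] by (simp add: exp_double)
    finally have ex: "exp (L x / of_real \<alpha>) ^ m * exp (L x / of_real \<alpha>) ^ 2 = G x ^ 2" .
    have "of_real \<alpha> ^ 2 * \<zeta> x ^ m * (deriv \<zeta> x)\<^sup>2 =
      x ^ m * of_real \<alpha> ^ 2 * (exp (L x / of_real \<alpha>) ^ m * exp (L x / of_real \<alpha>) ^ 2) * (1
          + x * deriv L x / of_real \<alpha>) ^ 2"
      unfolding DERIV_imp_deriv[OF d\<zeta>[OF x]] by (simp only: \<zeta>_def power_mult_distrib mult_ac)
    then show ?thesis unfolding ex ph by (simp only: power_mult_distrib mult_ac)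
  qed
  have "deriv \<zeta> 0 \<noteq> 0" using DERIV_imp_deriv[OF d\<zeta>[of 0]] \<sigma>(1) by simp
  from has_complex_derivative_locally_injective[OF \<zeta> _ open_ball this] \<sigma>(1)
  obtain t where t: "t > 0" "ball (0::complex) t \<subseteq> ball 0 \<sigma>" "inj_on \<zeta> (ball 0 t)" by auto
  have \<zeta>t: "\<zeta> holomorphic_on ball 0 t" by (rule holomorphic_on_subset[OF \<zeta> t(2)])
  have o: "open (\<zeta> ` ball 0 t)" by (rule open_mapping_thm3[OF \<zeta>t open_ball t(3)])
  have "0 \<in> \<zeta> ` ball 0 t" using t(1) by (intro image_eqI[of _ _ 0]) (auto simp: \<zeta>_def)
  then obtain e where e: "e > 0" "ball 0 e \<subseteq> \<zeta> ` ball 0 t" using o openE by blast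
  obtain \<eta> where \<eta>: "\<eta> holomorphic_on (\<zeta> ` ball 0 t)"
    "\<And>z. z \<in> ball 0 t \<Longrightarrow> deriv \<zeta> z * deriv \<eta> (\<zeta> z) = 1" "\<And>z. z \<in> ball 0 t \<Longrightarrow> \<eta> (\<zeta> z) = z"
    by (rule holomorphic_has_inverse[OF \<zeta>t open_ball t(3)]) (assumption | rule that)+
  have h: "\<eta> holomorphic_on ball 0 e" by (rule holomorphic_on_subset[OF \<eta>(1) e(2)])
  have mem: "\<eta> x \<in> ball 0 t" "\<zeta> (\<eta> x) = x" if "x \<in> ball 0 e" for x
    using that e(2) \<eta>(3) by force+
  show ?thesis
  proof (rule that[of e "\<lambda>x. z0 + \<eta> x" m])
    show "0 < e" by (rule e(1))
    show "(\<lambda>x. z0 + \<eta> x) holomorphic_on ball 0 e" by (intro holomorphic_intros h)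
    show "inj_on (\<lambda>x. z0 + \<eta> x) (ball 0 e)" using mem(2) by (auto simp: inj_on_def) metis
    show "(\<lambda>x. z0 + \<eta> x) ` ball 0 e \<subseteq> V"
    proof (rule image_subsetI)
      fix x :: complex assume "x \<in> ball 0 e"
      then have "\<eta> x \<in> ball 0 r" using mem(1) t(2) \<sigma>(3) g(2) by fastforce
      then have "z0 + \<eta> x \<in> ball z0 r" by (simp add: dist_norm)
      then show "z0 + \<eta> x \<in> V" using r(2) by blast
    qed
    have "\<zeta> 0 = 0" by (simp add: \<zeta>_def)
    then show "z0 + \<eta> 0 = z0" using \<eta>(3)[of 0] t(1) by simp
    show "\<phi> z0 = 0 \<longleftrightarrow> m > 0" using g(6) by (simp add: \<phi>0_def)
    fix x :: complex assume x: "x \<in> ball 0 e"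
    have "((\<lambda>x. z0 + \<eta> x) has_field_derivative deriv \<eta> x) (at x)"
      using holomorphic_derivI[OF h open_ball x] by (auto intro!: derivative_eq_intros)
    then have 1: "deriv (\<lambda>x. z0 + \<eta> x) x = deriv \<eta> x" by (rule DERIV_imp_deriv)
    have 2: "deriv \<zeta> (\<eta> x) * deriv \<eta> x = 1" using \<eta>(2)[OF mem(1)[OF x]] mem(2)[OF x] by simp
    have "\<phi> (z0 + \<eta> x) = of_real \<alpha> ^ 2 * x ^ m * (deriv \<zeta> (\<eta> x))\<^sup>2"
      using key[of "\<eta> x"] mem[OF x] t(2) by (auto simp: \<phi>0_def)
    then have "\<phi> (z0 + \<eta> x) * (deriv \<eta> x)\<^sup>2 = of_real \<alpha> ^ 2 * x ^ m * (deriv \<zeta> (\<eta> x) * deriv \<eta> x)\<^sup>2"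
      by (simp only: power_mult_distrib mult_ac)
    then show "\<phi> (z0 + \<eta> x) * (deriv (\<lambda>x. z0 + \<eta> x) x)\<^sup>2 = of_real ((m + 2) / 2) ^ 2 * x ^ m"
      unfolding 1 2 by (simp add: \<alpha>_def add.commute)
  qed
qed

section \<open>Continuation of germs\<close>

text \<open>The domain on which \<open>s + Ln (1 - a * exp (- s))\<close>, a logarithm of
  \<open>exp s - a\<close>, is holomorphic. For \<open>a \<noteq> 0\<close> the excluded points form
  horizontal half-lines running to the left from the solutions of \<open>exp s = a\<close>.\<close>

definition slit_plane :: "real \<Rightarrow> complex \<Rightarrow> complex set"
  where "slit_plane R a = {s. Re s < R \<and> 1 - a * exp (- s) \<notin> \<real>\<^sub>\<le>\<^sub>0}"

lemma open_slit_plane: "open (slit_plane R a)"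
proof -
  have "open ((\<lambda>s. 1 - a * exp (- s)) -` (- \<real>\<^sub>\<le>\<^sub>0))"
    by (rule open_vimage) (auto intro!: continuous_intros)
  moreover have "slit_plane R a = {s. Re s < R} \<inter> (\<lambda>s. 1 - a * exp (- s)) -` (- \<real>\<^sub>\<le>\<^sub>0)"
    by (auto simp: slit_plane_def)
  ultimately show ?thesis using open_halfspace_Re_lt by auto
qed

lemma slit_plane_large:
  assumes "norm a < exp (Re s)" "Re s < R"
  shows "s \<in> slit_plane R a"
proof -
  have "norm (a * exp (- s)) = norm a * exp (- Re s)" by (simp add: norm_mult)
  also have "\<dots> < exp (Re s) * exp (- Re s)" using assms(1) by (intro mult_strict_right_mono) auto
  also have "\<dots> = 1" by (simp flip: exp_add)
  finally have "norm (a * exp (- s)) < 1" .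
  then have "Re (a * exp (- s)) < 1" using complex_Re_le_cmod le_less_trans by blast
  then have "1 - a * exp (- s) \<notin> \<real>\<^sub>\<le>\<^sub>0" by (auto simp: complex_nonpos_Reals_iff)
  then show ?thesis using assms by (simp add: slit_plane_def)
qed

text \<open>A point is on a slit if \<open>a * exp (- s)\<close> is real and at least 1. Moving left
  by \<open>t\<close> multiplies this number by \<open>exp t \<ge> 1\<close>, so everything to the
  left of such a point is on the slit as well.\<close>

lemma slit_plane_right:
  assumes s: "s \<in> slit_plane R a" and "0 \<le> t" "Re s + t < R"
  shows "s + of_real t \<in> slit_plane R a"
proof (rule ccontr)
  assume "s + of_real t \<notin> slit_plane R a"
  then have "1 - a * exp (- (s + of_real t)) \<in> \<real>\<^sub>\<le>\<^sub>0" using assms by (simp add: slit_plane_def)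
  then obtain y where y: "y \<le> 0" "1 - a * exp (- (s + of_real t)) = of_real y"
    by (auto elim: nonpos_Reals_cases)
  have "- (s + complex_of_real t) = - s + of_real (- t)" by simp
  then have "a * exp (- (s + of_real t)) = a * exp (- s) * of_real (exp (- t))"
    by (simp only: exp_add exp_of_real mult.assoc)
  moreover have "z = of_real (1 - y)" if "1 - z = of_real y" for z :: complex
    using that by (simp add: algebra_simps)
  ultimately have "a * exp (- s) * of_real (exp (- t)) = of_real (1 - y)" using y(2) by metis
  then have "a * exp (- s) * of_real (exp (- t)) * of_real (exp t) = of_real ((1 - y) * exp t)" by simp
  moreover have "of_real (exp (- t)) * of_real (exp t) = (1::complex)"
    by (simp flip: of_real_mult exp_add)
  ultimately have e: "a * exp (- s) = of_real ((1 - y) * exp t)" by (simp add: mult.assoc)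
  have "1 * 1 \<le> (1 - y) * exp t" using y(1) assms(2) by (intro mult_mono) auto
  then have "1 - a * exp (- s) \<in> \<real>\<^sub>\<le>\<^sub>0" unfolding e by (auto simp: complex_nonpos_Reals_iff)
  then show False using s by (simp add: slit_plane_def)
qed

text \<open>A horizontal segment to the right joins each point to the convex strip \<open>C\<close>,
  which lies beyond the ends of all slits. The bound on \<open>a\<close> ensures that the line
  \<open>Re s = R - 1 / 2\<close> belongs to \<open>C\<close>.\<close>

lemma connected_slit_plane:
  assumes a: "norm a \<le> exp (R - 1)"
  shows "connected (slit_plane R a)"
proof -
  define C where "C = {s. norm a < exp (Re s) \<and> Re s < R}"
  have "C = {s. Re s < R} \<inter> {s. norm a < exp (Re s)}" by (auto simp: C_def)
  moreover have "norm a < exp x \<longleftrightarrow> ln (norm a) < x" if "a \<noteq> 0" for x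
    using that by (metis exp_ln exp_less_cancel_iff zero_less_norm_iff)
  then have "{s. norm a < exp (Re s)} = (if a = 0 then UNIV else {s. Re s > ln (norm a)})"
    by auto
  ultimately have "convex C"
    by (auto intro!: convex_Int convex_halfspace_Re_lt convex_halfspace_Re_gt)
  then have cC: "connected C" by (rule convex_connected)
  define D where "D s = C \<union> (if Re s < R - 1 / 2 then closed_segment s (s + of_real (R - 1 / 2
      - Re s)) else {})" for s
  have CS: "C \<subseteq> slit_plane R a" using slit_plane_large by (auto simp: C_def)
  have big: "norm a < exp t" if "R - 1 / 2 \<le> t" for t :: real
  proof -
    have "exp (R - 1) < exp (R - 1 / 2)" by simp
    then have "norm a < exp (R - 1 / 2)" using a by linarith
    also have "\<dots> \<le> exp t" using that by simp
    finally show ?thesis .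
  qed
  have D: "connected (D s) \<and> C \<subseteq> D s \<and> s \<in> D s \<and> D s \<subseteq> slit_plane R a" if s: "s \<in> slit_plane R a" for s
  proof (cases "Re s < R - 1 / 2")
    case False
    then have "s \<in> C" using big[of "Re s"] s by (auto simp: C_def slit_plane_def)
    then show ?thesis using False cC CS by (auto simp: D_def)
  next
    case True
    let ?e = "s + of_real (R - 1 / 2 - Re s)"
    have "?e \<in> C" using big[of "R - 1/2"] by (auto simp: C_def)
    then have "connected (closed_segment s ?e \<union> C)"
      by (intro connected_Un cC) auto
    moreover have "closed_segment s ?e \<subseteq> slit_plane R a"
    proof
      fix z assume "z \<in> closed_segment s ?e"
      then obtain u where u: "0 \<le> u" "u \<le> 1" "z = (1 - u) *\<^sub>R s + u *\<^sub>R ?e"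
        by (auto simp: closed_segment_def)
      then have z: "z = s + of_real (u * (R - 1 / 2 - Re s))"
        by (simp add: complex_eq_iff algebra_simps)
      have "u * (R - 1 / 2 - Re s) \<le> R - 1 / 2 - Re s"
        using u True by (intro mult_left_le_one_le) auto
      moreover have "Re s + w < R" if "w \<le> R - 1 / 2 - Re s" for w using that by simp
      ultimately have "Re s + u * (R - 1 / 2 - Re s) < R" by blast
      moreover have "0 \<le> u * (R - 1 / 2 - Re s)" using u True by (intro mult_nonneg_nonneg) auto
      ultimately show "z \<in> slit_plane R a"
        unfolding z by (intro slit_plane_right[OF s])
    qed
    ultimately show ?thesis using True CS by (auto simp: D_def Un_commute)
  qed
  have "slit_plane R a = \<Union> (D ` slit_plane R a)" using D by blast
  moreover have "connected (\<Union> (D ` slit_plane R a))"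
  proof (rule connected_Union)
    have "of_real (R - 1 / 2) \<in> C" using big[of "R - 1/2"] by (auto simp: C_def)
    then show "\<Inter> (D ` slit_plane R a) \<noteq> {}" using D by blast
  qed (use D in blast)
  ultimately show ?thesis by simp
qed

text \<open>A small vertical shift rotates \<open>a * exp (- s)\<close> off the real axis. This is
  for germs whose centre happens to lie on a slit.\<close>

lemma slit_plane_dense:
  assumes "r > 0" "Re s < R"
  shows "\<exists>s'\<in>ball s r. s' \<in> slit_plane R a"
proof (cases "s \<in> slit_plane R a")
  case True then show ?thesis using assms by auto
next
  case False
  then have "1 - a * exp (- s) \<in> \<real>\<^sub>\<le>\<^sub>0" using assms by (simp add: slit_plane_def)
  then obtain y where y: "y \<le> 0" "1 - a * exp (- s) = of_real y" by (auto elim: nonpos_Reals_cases)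
  define e where "e = min (r / 2) 1"
  have e: "0 < e" "e < r" "e < pi" using assms pi_gt3 by (auto simp: e_def)
  have as: "a * exp (- s) = of_real (1 - y)" using y(2) by (simp add: algebra_simps)
  have "- (s + \<i> * of_real e) = - s + - (\<i> * of_real e)" by simp
  then have "a * exp (- (s + \<i> * of_real e)) = a * exp (- s) * exp (- (\<i> * of_real e))"
    by (simp only: exp_add mult.assoc)
  then have "Im (1 - a * exp (- (s + \<i> * of_real e))) = (1 - y) * sin e"
    unfolding as by (simp add: Im_exp)
  moreover have "(1 - y) * sin e > 0" using y(1) e sin_gt_zero[of e] by (intro mult_pos_pos) auto
  ultimately have "1 - a * exp (- (s + \<i> * of_real e)) \<notin> \<real>\<^sub>\<le>\<^sub>0" by (auto simp: complex_nonpos_Reals_iff)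
  then have "s + \<i> * of_real e \<in> slit_plane R a" using assms by (simp add: slit_plane_def)
  moreover have "s + \<i> * of_real e \<in> ball s r" using e by (simp add: dist_norm norm_mult)
  ultimately show ?thesis by blast
qed

section \<open>Germs that preserve the differential, and their limits\<close>

lemma exp_eq_1_small:
  assumes "exp w = 1" "norm w < 1"
  shows "w = (0::complex)"
proof -
  obtain n :: int where n: "Re w = 0" "Im w = of_int (2 * n) * pi" using assms(1) exp_eq_1 by auto
  have "\<bar>Im w\<bar> < 1" using assms(2) abs_Im_le_cmod le_less_trans by blast
  moreover have "\<bar>Im w\<bar> \<ge> 1" if "n \<noteq> 0"
  proof -
    have "1 * 1 \<le> \<bar>real_of_int (2 * n)\<bar> * pi"
      using that pi_gt3 by (intro mult_mono) auto
    then show ?thesis unfolding n(2) abs_mult using pi_gt3 by simp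
  qed
  ultimately have "n = 0" by linarith
  then show ?thesis using n by (simp add: complex_eq_iff)
qed

text \<open>The hypothesis says that \<open>exp \<circ> g\<close> and \<open>exp\<close> have
  derivatives with equal squares. Their quotient \<open>q\<close> is continuous with values
  \<open>1\<close> and \<open>-1\<close>, hence constant, and integration leaves an additive
  constant. In the coordinate \<open>exp s\<close> the germ is an orientation-preserving isometry of
  the plane with linear part \<open>1\<close> or \<open>-1\<close>.\<close>

lemma isometric_germ:
  assumes g: "g holomorphic_on ball s1 r" and r: "r > 0"
    and eq: "\<And>s. s \<in> ball s1 r \<Longrightarrow> exp (2 * s) = exp (2 * g s) * (deriv g s)\<^sup>2"
  obtains \<sigma> a where "\<sigma> = 1 \<or> \<sigma> = -1" "\<And>s. s \<in> ball s1 r \<Longrightarrow> exp (g s) = \<sigma> * (exp s - a)"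
    "norm a \<le> norm (exp (g s1)) + norm (exp s1)"
proof -
  define q where "q = (\<lambda>s. exp (g s - s) * deriv g s)"
  have "q s ^ 2 = 1" if "s \<in> ball s1 r" for s
  proof -
    have "q s ^ 2 = exp (2 * g s) * (deriv g s)\<^sup>2 / exp (2 * s)"
      unfolding q_def power_mult_distrib by (simp add: exp_diff power_divide flip: exp_double)
    then show ?thesis unfolding eq[OF that, symmetric] by simp
  qed
  then have q1: "q s = 1 \<or> q s = -1" if "s \<in> ball s1 r" for s using that by (simp add: power2_eq_1_iff)
  then have "q ` ball s1 r \<subseteq> {1, -1}" by blast
  then have "finite (q ` ball s1 r)" using finite_subset by blast
  moreover have "continuous_on (ball s1 r) q"
    unfolding q_def using g
    by (intro continuous_intros holomorphic_on_imp_continuous_on holomorphic_deriv) auto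
  ultimately have "q constant_on ball s1 r" by (intro continuous_finite_range_constant) auto
  then obtain \<sigma> where \<sigma>: "\<And>s. s \<in> ball s1 r \<Longrightarrow> q s = \<sigma>" unfolding constant_on_def by blast
  have \<sigma>1: "\<sigma> = 1 \<or> \<sigma> = -1" using q1[of s1] \<sigma>[of s1] r by auto
  have "((\<lambda>s. exp (g s) - \<sigma> * exp s) has_field_derivative 0) (at s within ball s1 r)"
      if s: "s \<in> ball s1 r" for s
  proof -
    have "((\<lambda>s. exp (g s) - \<sigma> * exp s) has_field_derivative exp (g s) * deriv g s - \<sigma> * exp s) (at s)"
      using holomorphic_derivI[OF g open_ball s] by (auto intro!: derivative_eq_intros)
    moreover have "exp (g s) * deriv g s = \<sigma> * exp s"
      using \<sigma>[OF s] by (simp add: q_def exp_diff field_simps)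
    ultimately show ?thesis by (simp add: has_field_derivative_at_within)
  qed
  from has_field_derivative_zero_constant[OF convex_ball this]
  obtain c where c: "\<And>s. s \<in> ball s1 r \<Longrightarrow> exp (g s) - \<sigma> * exp s = c" by blast
  show ?thesis
  \<comment> \<open>The additive constant \<open>c\<close> is brought inside the bracket; since
    \<open>\<sigma>\<close> squares to 1, dividing by it is multiplying by it.\<close>
  proof (rule that[OF \<sigma>1, of "- \<sigma> * c"])
    show "exp (g s) = \<sigma> * (exp s - - \<sigma> * c)" if "s \<in> ball s1 r" for s
      using c[OF that] \<sigma>1 by (auto simp: algebra_simps)
    have "c = exp (g s1) - \<sigma> * exp s1" using c[of s1] r by simp
    then have "norm c \<le> norm (exp (g s1)) + norm (\<sigma> * exp s1)" using norm_triangle_ineq4 by blast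
    then show "norm (- \<sigma> * c) \<le> norm (exp (g s1)) + norm (exp s1)" using \<sigma>1 by (auto simp: norm_mult)
  qed
qed

text \<open>Up to the sign \<open>\<sigma>\<close>, both \<open>g\<close> and the principal branch
  are logarithms of \<open>exp s - a\<close>. They differ by a multiple of \<open>\<i> * pi\<close>
  whose parity records \<open>\<sigma>\<close>; near \<open>s'\<close> the difference
  \<open>d\<close> is too small to jump, so the multiple is constant there.\<close>

lemma log_branch_of_isometric_germ:
  assumes g: "g holomorphic_on ball s1 r" and \<sigma>: "\<sigma> = 1 \<or> \<sigma> = -1"
    and eq: "\<And>s. s \<in> ball s1 r \<Longrightarrow> exp (g s) = \<sigma> * (exp s - a)"
    and s': "s' \<in> ball s1 r" "s' \<in> slit_plane R a"
  obtains N :: "complex set" and k :: int where "open N" "s' \<in> N" "N \<subseteq> ball s1 r \<inter> slit_plane R a"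
    "\<And>s. s \<in> N \<Longrightarrow> g s = s + Ln (1 - a * exp (- s)) + \<i> * of_real pi * of_int k"
proof -
  define E where "E = (\<lambda>s. s + Ln (1 - a * exp (- s)))"
  have nz: "1 - a * exp (- s) \<noteq> 0" if "s \<in> slit_plane R a" for s
    using that by (auto simp: slit_plane_def)
  have eE: "exp (E s) = exp s - a" if "s \<in> slit_plane R a" for s
  proof -
    have "exp (E s) = exp s * (1 - a * exp (- s))" using nz[OF that] by (simp add: E_def exp_add)
    also have "\<dots> = exp s - a * (exp s * exp (- s))" by (simp add: algebra_simps)
    finally show ?thesis by (simp flip: exp_add)
  qed
  obtain k0 :: int where k0: "exp (\<i> * of_real pi * of_int k0) = \<sigma>"
  proof (cases "\<sigma> = 1")
    case True then show ?thesis using that[of 0] by simp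
  next
    case False then show ?thesis using that[of 1] \<sigma> by (simp add: exp_pi_i')
  qed
  have "exp (g s') = exp (E s' + \<i> * of_real pi * of_int k0)"
    using eq[OF s'(1)] eE[OF s'(2)] k0 by (simp add: exp_add mult.commute)
  then obtain n :: int where n: "g s' = E s' + \<i> * of_real pi * of_int k0 + (of_int (2 * n) * pi) * \<i>"
    using exp_eq by blast
  define k where "k = k0 + 2 * n"
  have gk: "g s' = E s' + \<i> * of_real pi * of_int k" unfolding n k_def by (simp add: algebra_simps)
  have ek: "exp (\<i> * of_real pi * of_int k) = \<sigma>"
  proof -
    have "exp (\<i> * of_real pi * of_int k) = exp (\<i> * of_real pi * of_int k0) * exp (of_real (of_int
        (2 * n) * pi) * \<i>)"
      unfolding k_def by (simp add: algebra_simps flip: exp_add)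
    also have "exp (complex_of_real (real_of_int (2 * n) * pi) * \<i>) = 1" unfolding exp_eq_1 by auto
    finally show ?thesis using k0 by simp
  qed
  define d where "d = (\<lambda>s. g s - (E s + \<i> * of_real pi * of_int k))"
  let ?S = "ball s1 r \<inter> slit_plane R a"
  have oS: "open ?S" by (intro open_Int open_ball open_slit_plane)
  have "continuous_on ?S d"
    unfolding d_def E_def
    using holomorphic_on_imp_continuous_on[OF g]
    by (auto intro!: continuous_intros intro: continuous_on_subset simp: slit_plane_def)
  from continuous_open_preimage[OF this oS open_ball[of 0 1]]
  have oN: "open (?S \<inter> d -` ball 0 1)" .
  show ?thesis
  proof (rule that[OF oN, of k])
    show "s' \<in> ?S \<inter> d -` ball 0 1" using s' by (simp add: d_def gk)
    fix s assume s: "s \<in> ?S \<inter> d -` ball 0 1"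
    have "exp (d s) = exp (g s) / (exp (E s) * exp (\<i> * of_real pi * of_int k))"
      by (simp add: d_def exp_diff exp_add)
    also have "\<dots> = 1"
    proof -
      have "exp (g s) = \<sigma> * exp (E s)" using eq eE s by auto
      then show ?thesis unfolding ek using \<sigma> by auto
    qed
    finally have "d s = 0" using s by (intro exp_eq_1_small) auto
    then show "g s = s + Ln (1 - a * exp (- s)) + \<i> * of_real pi * of_int k" by (simp add: d_def E_def)
  qed auto
qed

text \<open>The germ agrees on some open set with a formula that makes sense on the whole slit
  plane, and unique continuation carries \<open>G1 = G2 \<circ> E\<close> along. \<open>R'\<close>
  has to be smaller than \<open>R\<close> because \<open>E\<close> can move points to the right:
  \<open>exp (Re (E s))\<close> is \<open>norm (exp s - a)\<close>, which the last condition on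
  \<open>N\<close> keeps below \<open>exp R\<close>. The condition before it makes the slit plane
  connected.\<close>

lemma germ_continuation:
  assumes B: "smooth_manifold Y B" "C2_riemannian_metric B \<nu>"
    and G1: "harmonic_plane Y B \<nu> {s. Re s < R} G1" and G2: "harmonic_plane Y B \<nu> {s. Re s < R} G2"
    and h: "\<And>s. Re s < R \<Longrightarrow> hopf_plane B \<nu> G1 s = exp (2 * s)"
        "\<And>s. Re s < R \<Longrightarrow> hopf_plane B \<nu> G2 s = exp (2 * s)"
    and per: "\<And>s (j::int). G2 (s + \<i> * of_real pi * of_int (int M * j)) = G2 s" and M: "M > 0"
    and r: "r > 0" "ball s1 r \<subseteq> {s. Re s < R}" and g: "g holomorphic_on ball s1 r"
        "g ` ball s1 r \<subseteq> {s. Re s < R}"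
    and eq: "\<And>s. s \<in> ball s1 r \<Longrightarrow> G1 s = G2 (g s)"
    and N: "Re s1 < N" "Re (g s1) < N" "2 * exp N \<le> exp (R' - 1)" "2 * exp N \<le> exp R - exp R'"
  shows "\<exists>k<M. \<exists>a. norm a \<le> 2 * exp N \<and> (\<forall>s\<in>slit_plane R' a. G1 s
      = G2 (s + Ln (1 - a * exp (- s)) + \<i> * of_real pi * of_nat k))"
proof -
  have "0 < exp N" by simp
  then have "exp R' < exp R" using N(4) by linarith
  then have RR: "R' < R" by simp
  have "exp N < exp R'"
  proof -
    have "exp N < 2 * exp N" by simp
    also have "\<dots> \<le> exp (R' - 1)" by (rule N(3))
    also have "\<dots> < exp R'" by simp
    finally show ?thesis .
  qed
  then have s1R: "Re s1 < R'" using N(1) by simp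
  have "exp (2 * s) = exp (2 * g s) * (deriv g s)\<^sup>2" if s: "s \<in> ball s1 r" for s
  proof -
    have "s \<in> {s. Re s < R}" "g s \<in> {s. Re s < R}" using s r(2) g(2) by blast+
    then have "Re s < R" "Re (g s) < R" by auto
    then have "exp (2 * s) = hopf_plane B \<nu> G1 s" using h by simp
    also have "\<dots> = hopf_plane B \<nu> (\<lambda>s. G2 (g s)) s" by (rule hopf_plane_cong[OF open_ball s eq])
    also have "\<dots> = hopf_plane B \<nu> G2 (g s) * (deriv g s)\<^sup>2"
      by (rule hopf_plane_compose[OF B G2 g(1) open_ball s]) (use \<open>Re (g s) < R\<close> in simp)
    finally show ?thesis using h(2)[of "g s"] \<open>Re (g s) < R\<close> by simp
  qed
  from isometric_germ[OF g(1) r(1) this] obtain \<sigma> a where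
    \<sigma>: "\<sigma> = 1 \<or> \<sigma> = -1" and ga: "\<And>s. s \<in> ball s1 r \<Longrightarrow> exp (g s) = \<sigma> * (exp s - a)"
    and na: "norm a \<le> norm (exp (g s1)) + norm (exp s1)" by metis
  have na2: "norm a \<le> 2 * exp N" using na N(1,2) by (smt (verit) exp_less_cancel_iff norm_exp_eq_Re)
  obtain s' where s': "s' \<in> ball s1 r" "s' \<in> slit_plane R' a" using slit_plane_dense[OF r(1) s1R]
    by blast
  obtain W k where W: "open W" "s' \<in> W" "W \<subseteq> ball s1 r \<inter> slit_plane R' a"
    and gk: "\<And>s. s \<in> W \<Longrightarrow> g s = s + Ln (1 - a * exp (- s)) + \<i> * of_real pi * of_int k"
    using log_branch_of_isometric_germ[OF g(1) \<sigma> ga s'] by metis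
  define E where "E = (\<lambda>s. s + Ln (1 - a * exp (- s)) + \<i> * of_real pi * of_int k)"
  have E: "E holomorphic_on slit_plane R' a"
    unfolding E_def by (intro holomorphic_intros) (auto simp: slit_plane_def)
  have EL: "E ` slit_plane R' a \<subseteq> {s. Re s < R}"
  proof (rule image_subsetI)
    fix s assume s: "s \<in> slit_plane R' a"
    then have nz: "1 - a * exp (- s) \<noteq> 0" by (auto simp: slit_plane_def)
    have "exp (Re (E s)) = norm (exp (s + Ln (1 - a * exp (- s))))"
      by (simp add: E_def)
    also have "exp (s + Ln (1 - a * exp (- s))) = exp s - a"
      using nz by (simp add: exp_add algebra_simps) (simp flip: exp_add)
    also have "norm (exp s - a) \<le> exp (Re s) + norm a" using norm_triangle_ineq4[of "exp s" a] by simp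
    also have "\<dots> < exp R' + norm a" using s by (simp add: slit_plane_def)
    also have "\<dots> \<le> exp R" using na2 N(4) by linarith
    finally show "E s \<in> {s. Re s < R}" by simp
  qed
  have sub: "slit_plane R' a \<subseteq> {s. Re s < R}" using RR by (auto simp: slit_plane_def)
  have H1: "harmonic_plane Y B \<nu> (slit_plane R' a) G1"
    by (rule harmonic_plane_compose[OF B G1 _ open_slit_plane, of
        "\<lambda>s. s"]) (use sub in \<open>auto intro: holomorphic_on_ident\<close>)
  have H2: "harmonic_plane Y B \<nu> (slit_plane R' a) (\<lambda>s. G2 (E s))"
    by (rule harmonic_plane_compose[OF B G2 E open_slit_plane EL])
  have conn: "connected (slit_plane R' a)" by (rule connected_slit_plane) (use na2 N(3) in linarith)
  have all: "G1 s = G2 (E s)" if "s \<in> slit_plane R' a" for s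
    by (rule harmonic_unique_continuation[OF B H1 H2 conn W(1) _ _ _ that])
      (use W eq gk in \<open>auto simp: E_def\<close>)
  \<comment> \<open>Reduction modulo the period leaves finitely many candidates for
    \<open>k\<close>, whatever the germ.\<close>
  define k' where "k' = nat (k mod int M)"
  have k': "k = int M * (k div int M) + int k'" "k' < M"
    using M by (auto simp: k'_def nat_less_iff)
  have "G2 (E s) = G2 (s + Ln (1 - a * exp (- s)) + \<i> * of_real pi * of_nat k')" for s
  proof -
    have "E s = (s + Ln (1 - a * exp (- s)) + \<i> * of_real pi * of_nat k')
        + \<i> * of_real pi * of_int (int M * (k div int M))"
      unfolding E_def by (subst k'(1)) (simp add: algebra_simps)
    then show ?thesis using per by simp
  qed
  with all na2 k'(2) show ?thesis by auto
qed

text \<open>Germs arbitrarily far to the left give arbitrarily small \<open>a\<close>. By the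
  pigeonhole principle one \<open>k < M\<close> occurs with \<open>a\<close> as small as desired;
  for fixed \<open>s\<close> the slits then pass to the left of \<open>s\<close> and the logarithm
  tends to 0.\<close>

lemma germ_limit:
  assumes B: "smooth_manifold Y B" "C2_riemannian_metric B \<nu>"
    and G1: "harmonic_plane Y B \<nu> {s. Re s < R} G1" and G2: "harmonic_plane Y B \<nu> {s. Re s < R} G2"
    and h: "\<And>s. Re s < R \<Longrightarrow> hopf_plane B \<nu> G1 s = exp (2 * s)"
        "\<And>s. Re s < R \<Longrightarrow> hopf_plane B \<nu> G2 s = exp (2 * s)"
    and per: "\<And>s (j::int). G2 (s + \<i> * of_real pi * of_int (int M * j)) = G2 s" and M: "M > 0"
    and germs: "\<And>N. \<exists>s1 r g. r > 0 \<and> ball s1 r \<subseteq> {s. Re s < R} \<and> g holomorphic_on ball s1 r \<and>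
      g ` ball s1 r \<subseteq> {s. Re s < R} \<and> (\<forall>s\<in>ball s1 r. G1 s = G2 (g s)) \<and> Re s1 < N \<and> Re (g s1) < N"
    and R': "R' < R"
  shows "\<exists>k<M. \<forall>s. Re s < R' \<longrightarrow> G1 s = G2 (s + \<i> * of_real pi * of_nat k)"
proof -
  define Q where "Q k \<delta> \<longleftrightarrow> (\<exists>a. norm a < \<delta> \<and> (\<forall>s\<in>slit_plane R' a. G1 s
      = G2 (s + Ln (1 - a * exp (- s)) + \<i> * of_real pi * of_nat k)))" for k and \<delta> :: real
  have ex: "\<exists>k<M. Q k \<delta>" if d: "\<delta> > 0" for \<delta>
  proof -
    \<comment> \<open>The size \<open>2 * exp N\<close> that bounds \<open>a\<close>: small enough
      for \<open>germ_continuation\<close> and below \<open>\<delta>\<close>.\<close>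
    define t where "t = min (\<delta> / 2) (min (exp (R' - 1)) (exp R - exp R'))"
    have t: "t > 0" "t < \<delta>" "t \<le> exp (R' - 1)" "t \<le> exp R - exp R'" using d R' by (auto simp: t_def)
    define N where "N = ln (t / 2)"
    have eN: "2 * exp N = t" using t by (simp add: N_def)
    obtain s1 r g where *: "r > 0" "ball s1 r \<subseteq> {s. Re s < R}" "g holomorphic_on ball s1 r"
      "g ` ball s1 r \<subseteq> {s. Re s < R}" "\<And>s. s \<in> ball s1 r \<Longrightarrow> G1 s = G2 (g s)" "Re s1 < N" "Re (g s1) < N"
      using germs[of N] by metis
    have "\<exists>k<M. \<exists>a. norm a \<le> 2 * exp N \<and> (\<forall>s\<in>slit_plane R' a. G1 s
        = G2 (s + Ln (1 - a * exp (- s)) + \<i> * of_real pi * of_nat k))"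
      by (rule germ_continuation[OF B G1 G2 h per M *]) (use eN t in simp_all)
    then show ?thesis unfolding Q_def using eN t(2) by force
  qed
  have mono: "Q k \<delta>'" if "Q k \<delta>" "\<delta> \<le> \<delta>'" for k \<delta> \<delta>'
    using that unfolding Q_def by force
  have "\<exists>k<M. \<forall>\<delta>>0. Q k \<delta>"
  proof (rule ccontr)
    assume "\<not> ?thesis"
    then obtain \<delta> where \<delta>: "\<And>k. k < M \<Longrightarrow> \<delta> k > 0 \<and> \<not> Q k (\<delta> k)" by metis
    \<comment> \<open>If each \<open>k\<close> failed at its own threshold, none would work at the
      least one, as \<open>Q k\<close> is monotone in \<open>\<delta>\<close>.\<close>
    define m where "m = Min (\<delta> ` {..<M})"
    have fin: "finite (\<delta> ` {..<M})" "\<delta> ` {..<M} \<noteq> {}" using M by auto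
    have "m > 0" unfolding m_def using fin \<delta> by (subst Min_gr_iff) auto
    then obtain k where k: "k < M" "Q k m" using ex by blast
    have "m \<le> \<delta> k" unfolding m_def using fin k(1) by (intro Min_le) auto
    then show False using mono[OF k(2)] \<delta>[OF k(1)] by blast
  qed
  then obtain k where k: "k < M" "\<And>\<delta>. \<delta> > 0 \<Longrightarrow> Q k \<delta>" by blast
  have "G1 s = G2 (s + \<i> * of_real pi * of_nat k)" if s: "Re s < R'" for s
  proof (rule ccontr)
    let ?s = "s + \<i> * of_real pi * of_nat k"
    assume ne: "G1 s \<noteq> G2 ?s"
    note D1 = harmonic_planeD[OF G1 B(1)] and D2 = harmonic_planeD[OF G2 B(1)]
    have sR: "Re s < R" "Re ?s < R" using s R' by auto
    have "G1 s \<in> topspace Y" "G2 ?s \<in> topspace Y"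
      using continuous_map_image_subset_topspace[OF D1(2)] continuous_map_image_subset_topspace[OF
          D2(2)] sR by auto
    moreover have "Hausdorff_space Y" using B(1)
      by (auto simp: smooth_manifold_def topological_manifold_def)
    ultimately obtain P1 P2 where P: "openin Y P1" "openin Y P2" "G1 s \<in> P1" "G2 ?s \<in> P2" "disjnt P1 P2"
      using ne unfolding Hausdorff_space_def by metis
    have "openin (top_of_set {s. Re s < R}) {t \<in> {s. Re s < R}. G2 t \<in> P2}"
      using openin_continuous_map_preimage[OF D2(2) P(2)] by simp
    then have "open {t \<in> {s. Re s < R}. G2 t \<in> P2}" using open_halfspace_Re_lt
      by (rule openin_open_trans)
    then obtain \<eta> where \<eta>: "\<eta> > 0" "ball ?s \<eta> \<subseteq> {t \<in> {s. Re s < R}. G2 t \<in> P2}"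
      using sR P(4) by (metis (mono_tags, lifting) mem_Collect_eq openE)
    \<comment> \<open>A small \<open>a\<close> moves the argument of \<open>G2\<close> into the
      preimage of \<open>P2\<close>, whereas the value there is \<open>G1 s\<close>, which lies in
      the disjoint set \<open>P1\<close>.\<close>
    have "((\<lambda>a. Ln (1 - a * exp (- s))) \<longlongrightarrow> Ln (1 - 0 * exp (- s))) (at 0)"
      by (intro tendsto_intros) (auto simp: complex_nonpos_Reals_iff)
    then obtain \<delta> where \<delta>: "\<delta> > 0" "\<And>a. a \<noteq> 0 \<Longrightarrow> norm a < \<delta> \<Longrightarrow> norm (Ln (1 - a * exp (- s))) < \<eta>"
      using \<eta>(1) by (auto simp: LIM_def dist_norm)
    obtain a where a: "norm a < min \<delta> (exp (Re s))"
      "\<forall>s\<in>slit_plane R' a. G1 s = G2 (s + Ln (1 - a * exp (- s)) + \<i> * of_real pi * of_nat k)"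
      using k(2)[of "min \<delta> (exp (Re s))"] \<delta>(1) unfolding Q_def by auto
    have "s \<in> slit_plane R' a" by (rule slit_plane_large) (use a s in auto)
    then have "G1 s = G2 (s + Ln (1 - a * exp (- s)) + \<i> * of_real pi * of_nat k)" using a(2) by blast
    moreover have "norm (Ln (1 - a * exp (- s))) < \<eta>" using \<delta>(2)[of a] a(1) \<eta>(1) by (cases "a = 0") auto
    then have "s + Ln (1 - a * exp (- s)) + \<i> * of_real pi * of_nat k \<in> ball ?s \<eta>"
      by (simp add: dist_norm)
    then have "s + Ln (1 - a * exp (- s)) + \<i> * of_real pi * of_nat k \<in> {t \<in> {s. Re s < R}. G2 t \<in> P2}"
      using \<eta>(2) by blast
    ultimately have "G1 s \<in> P2" by simp
    then show False using P(3,5) by (auto simp: disjnt_def)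
  qed
  then show ?thesis using k(1) by blast
qed

section \<open>Cone parametrizations\<close>

text \<open>With \<open>\<alpha> = (m + 2) / 2\<close> the argument of \<open>\<psi>\<close> is the
  \<open>x\<close> whose power \<open>\<alpha>\<close> is \<open>exp s\<close>. A half-plane thus
  covers the punctured disc, and the quadratic differential becomes the square of
  \<open>d (exp s)\<close>.\<close>

definition cone :: "nat \<Rightarrow> (complex \<Rightarrow> complex) \<Rightarrow> complex \<Rightarrow> complex"
  where "cone m \<psi> s = \<psi> (exp (s / of_real ((real m + 2) / 2)))"

definition cone_log :: "nat \<Rightarrow> complex \<Rightarrow> complex"
  where "cone_log m x = of_real ((real m + 2) / 2) * Ln x"

text \<open>\<open>height\<close> and \<open>radius\<close> translate between the bound
  \<open>Re s < \<rho>\<close> in the half-plane and the radius of the disc that it covers; they are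
  inverse to each other.\<close>

definition height :: "nat \<Rightarrow> real \<Rightarrow> real"
  where "height m e = (real m + 2) / 2 * ln e"

definition radius :: "nat \<Rightarrow> real \<Rightarrow> real"
  where "radius m \<rho> = exp (\<rho> / ((real m + 2) / 2))"

lemma radius_pos [simp]: "radius m \<rho> > 0"
  by (simp add: radius_def)

lemma radius_le: "e > 0 \<Longrightarrow> radius m \<rho> \<le> e \<longleftrightarrow> \<rho> \<le> height m e"
  unfolding radius_def height_def by (subst ln_ge_iff[symmetric]) (auto simp: field_simps)

lemma norm_cone_exp: "norm (exp (s / of_real ((real m + 2) / 2))) = radius m (Re s)"
  by (simp only: norm_exp_eq_Re Re_divide_of_real radius_def)

lemma radius_less: "radius m \<rho> < radius m \<rho>' \<longleftrightarrow> \<rho> < \<rho>'"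
  by (simp add: radius_def divide_less_cancel)

lemma cone_exponent_nonzero: "complex_of_real ((real m + 2) / 2) \<noteq> 0"
  unfolding of_real_eq_0_iff by simp

lemma exp_cone_log: "x \<noteq> 0 \<Longrightarrow> exp (cone_log m x / of_real ((real m + 2) / 2)) = x"
  unfolding cone_log_def nonzero_mult_div_cancel_left[OF cone_exponent_nonzero] by simp

lemma cone_cone_log: "x \<noteq> 0 \<Longrightarrow> cone m \<psi> (cone_log m x) = \<psi> x"
  unfolding cone_def by (subst exp_cone_log) auto

lemma Re_cone_log: "x \<noteq> 0 \<Longrightarrow> x \<in> ball 0 (radius m \<rho>) \<Longrightarrow> Re (cone_log m x) < \<rho>"
  using norm_cone_exp[of "cone_log m x" m] exp_cone_log[of x m] radius_less by (metis mem_ball_0)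

context harmonic_surface_map
begin

text \<open>The normal form of the differential around \<open>p\<close>, with \<open>m\<close> the
  order of its zero there; \<open>m = 0\<close> at regular points.\<close>

definition cone_chart :: "('a, complex) chart \<Rightarrow> 'a \<Rightarrow> nat \<Rightarrow> real \<Rightarrow> (complex \<Rightarrow> complex) \<Rightarrow> bool"
  where "cone_chart c p m e \<psi> \<longleftrightarrow> c \<in> A \<and> p \<in> fst c \<and> e > 0 \<and> \<psi> holomorphic_on ball 0 e \<and>
    inj_on \<psi> (ball 0 e) \<and> \<psi> ` ball 0 e \<subseteq> U c \<and> \<psi> 0 = snd c p \<and> (p \<in> \<Z> \<longleftrightarrow> m > 0) \<and>
    (\<forall>x\<in>ball 0 e. \<Phi> c (\<psi> x) * (deriv \<psi> x)\<^sup>2 = of_real ((real m + 2) / 2) ^ 2 * x ^ m)"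

lemma cone_chart_exists:
  assumes "p \<in> topspace X"
  obtains c m e \<psi> where "cone_chart c p m e \<psi>"
proof -
  obtain c where c: "c \<in> A" "p \<in> fst c" using cover[OF assms] by blast
  obtain m e \<psi> where "e > 0" "\<psi> holomorphic_on ball 0 e" "inj_on \<psi> (ball 0 e)"
    "\<psi> ` ball 0 e \<subseteq> U c" "\<psi> 0 = snd c p" "\<Phi> c (snd c p) = 0 \<longleftrightarrow> m > (0::nat)"
    "\<And>x. x \<in> ball 0 e \<Longrightarrow> \<Phi> c (\<psi> x) * (deriv \<psi> x)\<^sup>2 = of_real (real (m + 2) / 2) ^ 2 * x ^ m"
    by (rule quadratic_differential_normal_form[OF \<Phi>_holomorphic[OF c(1)] is_chartD(2)[OF chart[OF
        c(1)]]
          imageI[OF c(2)] not_locally_zero[OF c(1)]]) (assumption | rule that)+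
  then have "cone_chart c p m e \<psi>"
    unfolding cone_chart_def hopf_zeros_iff[OF c] using c by (simp add: add.commute)
  then show ?thesis by (rule that)
qed

context
  fixes c p m e \<psi>
  assumes cc: "cone_chart c p m e \<psi>"
begin

lemma cone_chartD:
  shows "c \<in> A" "p \<in> fst c" "e > 0" "\<psi> holomorphic_on ball 0 e" "inj_on \<psi> (ball 0 e)"
    "\<psi> ` ball 0 e \<subseteq> U c" "\<psi> 0 = snd c p" "p \<in> \<Z> \<longleftrightarrow> m > 0"
    "\<And>x. x \<in> ball 0 e \<Longrightarrow> \<Phi> c (\<psi> x) * (deriv \<psi> x)\<^sup>2 = of_real ((real m + 2) / 2) ^ 2 * x ^ m"
  using cc unfolding cone_chart_def by blast+

lemma cone_exp_in_ball:
  assumes "Re s < \<rho>"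
  shows "exp (s / of_real ((real m + 2) / 2)) \<in> ball 0 (radius m \<rho>)"
  using assms by (simp only: mem_ball_0 norm_cone_exp radius_less)

lemma ball_radius_subset: "\<rho> \<le> height m e \<Longrightarrow> ball (0::complex) (radius m \<rho>) \<subseteq> ball 0 e"
  using radius_le[OF cone_chartD(3)] by (intro subset_ball) simp

lemma cone_in_ball:
  assumes "Re s < height m e"
  shows "exp (s / of_real ((real m + 2) / 2)) \<in> ball 0 e"
  using cone_exp_in_ball[OF assms] ball_radius_subset[of "height m e"] by blast

lemma cone_holomorphic: "cone m \<psi> holomorphic_on {s. Re s < height m e}"
proof -
  have "(\<lambda>s. exp (s / of_real ((real m + 2) / 2))) holomorphic_on {s. Re s < height m e}"
    using cone_exponent_nonzero by (intro holomorphic_intros) blast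
  from holomorphic_on_compose_gen[OF this cone_chartD(4), unfolded o_def] show ?thesis
    unfolding cone_def[abs_def] using cone_in_ball by blast
qed

lemma cone_image: "cone m \<psi> ` {s. Re s < height m e} \<subseteq> U c"
  using cone_in_ball cone_chartD(6) unfolding cone_def by blast

text \<open>The factor \<open>x / \<alpha>\<close> from the exponential cancels
  \<open>\<alpha>\<^sup>2\<close> and raises \<open>x ^ m\<close> to \<open>x ^ (m + 2)\<close>,
  which is \<open>exp (2 * s)\<close> whatever the order \<open>m\<close>. This makes germs between
  cones of different orders comparable.\<close>

lemma cone_quadratic:
  assumes "Re s < height m e"
  shows "\<Phi> c (cone m \<psi> s) * (deriv (cone m \<psi>) s)\<^sup>2 = exp (2 * s)"
proof -
  define \<alpha> where "\<alpha> = complex_of_real ((real m + 2) / 2)"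
  have a0: "\<alpha> \<noteq> 0" unfolding \<alpha>_def by (rule cone_exponent_nonzero)
  define x where "x = exp (s / \<alpha>)"
  have x: "x \<in> ball 0 e" using cone_in_ball[OF assms] by (simp only: x_def \<alpha>_def)
  have "((\<lambda>s. exp (s / \<alpha>)) has_field_derivative x / \<alpha>) (at s)"
    using a0 by (auto intro!: derivative_eq_intros simp: x_def)
  from DERIV_chain2[OF _ this, of \<psi> "deriv \<psi> x"]
  have "((\<lambda>s. \<psi> (exp (s / \<alpha>))) has_field_derivative deriv \<psi> x * (x / \<alpha>)) (at s)"
    using holomorphic_derivI[OF cone_chartD(4) open_ball x] unfolding x_def by blast
  then have d: "deriv (cone m \<psi>) s = deriv \<psi> x * (x / \<alpha>)"
    unfolding cone_def[abs_def] \<alpha>_def by (rule DERIV_imp_deriv)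
  have "\<Phi> c (cone m \<psi> s) * (deriv (cone m \<psi>) s)\<^sup>2 = \<Phi> c (\<psi> x) * (deriv \<psi> x)\<^sup>2 * (x / \<alpha>)\<^sup>2"
    unfolding d by (simp only: cone_def x_def \<alpha>_def power_mult_distrib mult.assoc)
  also have "\<dots> = (\<alpha>\<^sup>2 * x ^ m) * (x / \<alpha>)\<^sup>2" using cone_chartD(9)[OF x] by (simp only: \<alpha>_def)
  also have "\<dots> = x ^ (m + 2)" using a0 by (simp add: power_add power_divide power2_eq_square)
  also have "\<dots> = exp (of_nat (m + 2) * (s / \<alpha>))" unfolding x_def by (rule exp_of_nat_mult[symmetric])
  also have "of_nat (m + 2) = 2 * \<alpha>" by (simp add: \<alpha>_def)
  also have "2 * \<alpha> * (s / \<alpha>) = 2 * s" using a0 by simp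
  finally show ?thesis .
qed

text \<open>A product equal to \<open>exp (2 * s)\<close> has no vanishing factor: the punctured
  neighbourhood contains no zero of the differential, and \<open>cone\<close> is locally
  invertible.\<close>

lemma cone_nonzero:
  assumes "Re s < height m e"
  shows "chart_inv c (cone m \<psi> s) \<notin> \<Z>" "deriv (cone m \<psi>) s \<noteq> 0"
proof -
  have "exp (2 * s) \<noteq> 0" by simp
  then have "\<Phi> c (cone m \<psi> s) \<noteq> 0" "deriv (cone m \<psi>) s \<noteq> 0" using cone_quadratic[OF assms] by auto
  moreover have z: "cone m \<psi> s \<in> U c" using cone_image assms by blast
  note C = is_chartD[OF chart[OF cone_chartD(1)]]
  ultimately show "chart_inv c (cone m \<psi> s) \<notin> \<Z>" "deriv (cone m \<psi>) s \<noteq> 0"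
    using hopf_zeros_iff[OF cone_chartD(1) C(8)[OF z]] C(7)[OF z] by auto
qed

lemma cone_harmonic:
  assumes "R \<le> height m e"
  shows "harmonic_plane Y B \<nu> {s. Re s < R} (\<lambda>s. F c (cone m \<psi> s))"
  by (rule harmonic_plane_compose[OF target F_harmonic[OF cone_chartD(1)]
        holomorphic_on_subset[OF cone_holomorphic] open_halfspace_Re_lt])
    (use assms cone_image in auto)

lemma cone_hopf:
  assumes "Re s < height m e"
  shows "hopf_plane B \<nu> (\<lambda>s. F c (cone m \<psi> s)) s = exp (2 * s)"
proof -
  have "hopf_plane B \<nu> (\<lambda>s. F c (cone m \<psi> s)) s
      = hopf_plane B \<nu> (F c) (cone m \<psi> s) * (deriv (cone m \<psi>) s)\<^sup>2"
    by (rule hopf_plane_compose[OF target F_harmonic[OF cone_chartD(1)] cone_holomorphic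
        open_halfspace_Re_lt])
      (use assms cone_image in auto)
  then show ?thesis using cone_quadratic[OF assms] by (simp add: \<Phi>_eq)
qed

lemma cone_local_inverse:
  assumes "Re s < R" "R \<le> height m e"
  obtains r \<beta> where "r > 0" "ball s r \<subseteq> {s. Re s < R}" "inj_on (cone m \<psi>) (ball s r)"
    "open (cone m \<psi> ` ball s r)" "\<beta> holomorphic_on cone m \<psi> ` ball s r"
    "\<And>t. t \<in> ball s r \<Longrightarrow> \<beta> (cone m \<psi> t) = t"
proof -
  have h: "cone m \<psi> holomorphic_on {s. Re s < R}"
    by (rule holomorphic_on_subset[OF cone_holomorphic]) (use assms in auto)
  have "deriv (cone m \<psi>) s \<noteq> 0" using cone_nonzero(2) assms by simp
  from has_complex_derivative_locally_injective[OF h _ open_halfspace_Re_lt this] assms(1)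
  obtain r where r: "r > 0" "ball s r \<subseteq> {s. Re s < R}" "inj_on (cone m \<psi>) (ball s r)" by auto
  have h': "cone m \<psi> holomorphic_on ball s r" by (rule holomorphic_on_subset[OF h r(2)])
  have o: "open (cone m \<psi> ` ball s r)" by (rule open_mapping_thm3[OF h' open_ball r(3)])
  obtain \<beta> where "\<beta> holomorphic_on cone m \<psi> ` ball s r" "\<And>t. t \<in> ball s r \<Longrightarrow> \<beta> (cone m \<psi> t) = t"
    using holomorphic_has_inverse[OF h' open_ball r(3)] by metis
  then show ?thesis using that r o by blast
qed

lemma open_image_ball:
  assumes "\<rho> \<le> e"
  shows "open (\<psi> ` ball 0 \<rho>)" "\<psi> ` ball 0 \<rho> \<subseteq> U c"
proof -
  have s: "ball (0::complex) \<rho> \<subseteq> ball 0 e" using assms by (rule subset_ball)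
  show "open (\<psi> ` ball 0 \<rho>)"
    by (rule open_mapping_thm3[OF holomorphic_on_subset[OF cone_chartD(4) s] open_ball
        inj_on_subset[OF cone_chartD(5) s]])
  show "\<psi> ` ball 0 \<rho> \<subseteq> U c" using s cone_chartD(6) by blast
qed

text \<open>The exponential omits only 0, which corresponds to \<open>p\<close>; so a half-plane
  parametrizes precisely the punctured neighbourhood that clause (2) of the relation speaks
  of.\<close>

lemma cone_nbhd:
  assumes "\<rho> \<le> height m e"
  shows "openin X (chart_inv c ` \<psi> ` ball 0 (radius m \<rho>))" "p \<in> chart_inv c ` \<psi> ` ball 0 (radius m \<rho>)"
    "chart_inv c ` \<psi> ` ball 0 (radius m \<rho>) - {p} = (\<lambda>s. chart_inv c (cone m \<psi> s)) ` {s. Re s < \<rho>}"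
proof -
  note C = is_chartD[OF chart[OF cone_chartD(1)]]
  have re: "radius m \<rho> \<le> e" using assms radius_le[OF cone_chartD(3)] by simp
  note o = open_image_ball[OF re]
  show "openin X (chart_inv c ` \<psi> ` ball 0 (radius m \<rho>))"
    by (rule is_chart_open_preimage[OF chart[OF cone_chartD(1)] o])
  have p0: "chart_inv c (\<psi> 0) = p" using cone_chartD(2,7) C(6) by simp
  show "p \<in> chart_inv c ` \<psi> ` ball 0 (radius m \<rho>)" using p0 by (force intro!: image_eqI[of p _ "\<psi> 0"])
  have inj: "chart_inv c (\<psi> x) \<noteq> p" if "x \<in> ball 0 (radius m \<rho>)" "x \<noteq> 0" for x
  proof
    assume "chart_inv c (\<psi> x) = p"
    then have "snd c (chart_inv c (\<psi> x)) = \<psi> 0" using cone_chartD(7) by simp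
    moreover have "\<psi> x \<in> U c" using o(2) that(1) by blast
    ultimately have "\<psi> x = \<psi> 0" using C(7) by simp
    moreover have "x \<in> ball 0 e" "0 \<in> ball (0::complex) e"
      using that(1) ball_radius_subset[OF assms] cone_chartD(3) by auto
    ultimately show False using that(2) cone_chartD(5) by (auto dest: inj_onD)
  qed
  show "chart_inv c ` \<psi> ` ball 0 (radius m \<rho>) - {p} = (\<lambda>s. chart_inv c (cone m \<psi> s)) ` {s. Re s < \<rho>}"
  proof (intro equalityI subsetI)
    fix q assume "q \<in> chart_inv c ` \<psi> ` ball 0 (radius m \<rho>) - {p}"
    then obtain x where x: "x \<in> ball 0 (radius m \<rho>)" "q = chart_inv c (\<psi> x)" "q \<noteq> p" by blast
    then have "x \<noteq> 0" using p0 by auto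
    then show "q \<in> (\<lambda>s. chart_inv c (cone m \<psi> s)) ` {s. Re s < \<rho>}"
      using x Re_cone_log[OF _ x(1)] cone_cone_log by (intro image_eqI[of _ _ "cone_log m x"]) auto
  next
    fix q assume "q \<in> (\<lambda>s. chart_inv c (cone m \<psi> s)) ` {s. Re s < \<rho>}"
    then obtain s where s: "Re s < \<rho>" "q = chart_inv c (cone m \<psi> s)" by blast
    have "q \<noteq> p" using inj[OF cone_exp_in_ball[OF s(1)] exp_not_eq_zero] unfolding s(2) cone_def .
    then show "q \<in> chart_inv c ` \<psi> ` ball 0 (radius m \<rho>) - {p}"
      using cone_exp_in_ball[OF s(1)] unfolding s(2) cone_def by blast
  qed
qed

lemma cone_nbhd_small:
  assumes W: "openin X W" "p \<in> W"
  shows "\<exists>\<rho>0. \<forall>\<rho>\<le>\<rho>0. chart_inv c ` \<psi> ` ball 0 (radius m \<rho>) \<subseteq> W"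
proof -
  note C = is_chartD[OF chart[OF cone_chartD(1)]]
  have "continuous_map (top_of_set (ball 0 e)) (top_of_set (U c)) \<psi>"
    using holomorphic_on_imp_continuous_on[OF cone_chartD(4)] cone_chartD(6)
      by (auto simp: continuous_map_in_subtopology)
  from continuous_map_compose[OF this C(5)]
  have "openin (top_of_set (ball 0 e)) {x \<in> ball 0 e. chart_inv c (\<psi> x) \<in> W}"
    using openin_continuous_map_preimage[OF _ W(1)] by (fastforce simp: o_def)
  then have "open {x \<in> ball 0 e. chart_inv c (\<psi> x) \<in> W}" using open_ball by (rule openin_open_trans)
  moreover have "0 \<in> {x \<in> ball 0 e. chart_inv c (\<psi> x) \<in> W}" using cone_chartD(2,3,7) C(6) W(2) by simp
  ultimately obtain \<delta> where \<delta>: "\<delta> > 0" "ball 0 \<delta> \<subseteq> {x \<in> ball 0 e. chart_inv c (\<psi> x) \<in> W}"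
    using openE by blast
  have "chart_inv c ` \<psi> ` ball 0 (radius m \<rho>) \<subseteq> W" if "\<rho> \<le> height m \<delta>" for \<rho>
  proof -
    have "ball (0::complex) (radius m \<rho>) \<subseteq> ball 0 \<delta>" using radius_le[OF \<delta>(1)] that
      by (intro subset_ball) simp
    then show ?thesis using \<delta>(2) by blast
  qed
  then show ?thesis by blast
qed

end

text \<open>Division by \<open>(m + 2) / 2\<close> turns the shift into a multiple of
  \<open>2 * pi * \<i>\<close>. Therefore translations by multiples of \<open>\<i> * pi\<close> fall
  into at most \<open>m + 2\<close> classes.\<close>

lemma cone_periodic: "cone m \<psi> (s + \<i> * of_real pi * of_int (int (m + 2) * j)) = cone m \<psi> s"
proof -
  define \<alpha> where "\<alpha> = complex_of_real ((real m + 2) / 2)"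
  have a0: "\<alpha> \<noteq> 0" unfolding \<alpha>_def by (rule cone_exponent_nonzero)
  have "of_int (int (m + 2) * j) = 2 * \<alpha> * of_int j" by (simp add: \<alpha>_def)
  then have "(s + \<i> * of_real pi * of_int (int (m + 2) * j)) / \<alpha> = s / \<alpha> + (of_int (2 * j) * pi) * \<i>"
    using a0 by (simp add: field_simps)
  then have "exp ((s + \<i> * of_real pi * of_int (int (m + 2) * j)) / \<alpha>) = exp (s / \<alpha>)"
    unfolding exp_eq by blast
  then show ?thesis unfolding cone_def \<alpha>_def by simp
qed

text \<open>The local diffeomorphism is an inverse branch of the first cone, then the translation,
  then the second cone; its germ exists because neither cone map has critical points.\<close>

lemma cone_translation_sim_regular:
  assumes c1: "cone_chart c1 p1 m1 e1 \<psi>1" and c2: "cone_chart c2 p2 m2 e2 \<psi>2"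
    and R: "R \<le> height m1 e1" "R \<le> height m2 e2" and \<tau>: "Re \<tau> = 0"
    and eq: "\<And>s. Re s < R \<Longrightarrow> F c1 (cone m1 \<psi>1 s) = F c2 (cone m2 \<psi>2 (s + \<tau>))" and s: "Re s < R"
  shows "sim_regular X A B \<nu> f (chart_inv c1 (cone m1 \<psi>1 s)) (chart_inv c2 (cone m2 \<psi>2 (s + \<tau>)))"
proof -
  have s': "Re (s + \<tau>) < R" using s \<tau> by simp
  obtain r1 \<beta> where r1: "r1 > 0" "ball s r1 \<subseteq> {s. Re s < R}" "inj_on (cone m1 \<psi>1) (ball s r1)"
    "open (cone m1 \<psi>1 ` ball s r1)" "\<beta> holomorphic_on cone m1 \<psi>1 ` ball s r1"
    "\<And>t. t \<in> ball s r1 \<Longrightarrow> \<beta> (cone m1 \<psi>1 t) = t"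
    using cone_local_inverse[OF c1 s R(1)] by metis
  obtain r2 where r2: "r2 > 0" "ball (s + \<tau>) r2 \<subseteq> {s. Re s < R}" "inj_on (cone m2 \<psi>2) (ball (s + \<tau>) r2)"
    using cone_local_inverse[OF c2 s' R(2)] by metis
  \<comment> \<open>Small enough for the first cone map to be injective on the disc and the second
    on its translate, so that \<open>k\<close> is injective.\<close>
  define r where "r = min r1 r2"
  have r: "r > 0" "ball s r \<subseteq> ball s r1" "\<And>t. t \<in> ball s r \<Longrightarrow> t + \<tau> \<in> ball (s + \<tau>) r2"
    using r1(1) r2(1) by (auto simp: r_def dist_norm)
  define S where "S = cone m1 \<psi>1 ` ball s r"
  define k where "k = (\<lambda>z. cone m2 \<psi>2 (\<beta> z + \<tau>))"
  have SR: "ball s r \<subseteq> {s. Re s < R}" using r r1(2) by blast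
  have h1: "cone m1 \<psi>1 holomorphic_on ball s r"
    by (rule holomorphic_on_subset[OF cone_holomorphic[OF c1]]) (use SR R in auto)
  have i1: "inj_on (cone m1 \<psi>1) (ball s r)" using inj_on_subset[OF r1(3) r(2)] .
  have \<beta>: "\<beta> (cone m1 \<psi>1 t) = t" if "t \<in> ball s r" for t using r1(6) r(2) that by blast
  have kt: "k (cone m1 \<psi>1 t) = cone m2 \<psi>2 (t + \<tau>)" if "t \<in> ball s r" for t using \<beta>[OF that]
    by (simp add: k_def)
  have sr: "s \<in> ball s r" using r(1) by simp
  have "sim_regular X A B \<nu> f (chart_inv c1 (cone m1 \<psi>1 s)) (chart_inv c2 (k (cone m1 \<psi>1 s)))"
  proof (rule germ_sim_regular[OF cone_chartD(1)[OF c1] cone_chartD(1)[OF c2]])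
    show "open S" unfolding S_def by (rule open_mapping_thm3[OF h1 open_ball i1])
    show "S \<subseteq> U c1" unfolding S_def using cone_image[OF c1] SR R(1) by fastforce
    show "cone m1 \<psi>1 s \<in> S" unfolding S_def using sr by blast
    have \<beta>h: "(\<lambda>z. \<beta> z + \<tau>) holomorphic_on S"
      unfolding S_def using r(2) by (intro holomorphic_intros holomorphic_on_subset[OF r1(5)]) auto
    show "k holomorphic_on S"
      unfolding k_def
      by (rule holomorphic_on_compose_gen[OF \<beta>h cone_holomorphic[OF c2], unfolded o_def])
        (use \<beta> SR R(2) \<tau> in \<open>auto simp: S_def subset_iff\<close>)
    show "inj_on k S"
    proof (rule inj_onI)
      fix x y assume "x \<in> S" "y \<in> S" and e: "k x = k y"
      then obtain t u where tu: "t \<in> ball s r" "u \<in> ball s r" "x = cone m1 \<psi>1 t" "y = cone m1 \<psi>1 u"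
        unfolding S_def by blast
      then have "t + \<tau> = u + \<tau>" using e kt r(3) r2(3) by (auto dest: inj_onD)
      then show "x = y" using tu by simp
    qed
    show "k ` S \<subseteq> U c2"
    proof (clarsimp simp only: S_def)
      fix t assume t: "t \<in> ball s r"
      then have "Re (t + \<tau>) < height m2 e2" using SR R(2) \<tau> by auto
      then show "k (cone m1 \<psi>1 t) \<in> U c2" unfolding kt[OF t] using cone_image[OF c2] by blast
    qed
    show "F c1 z = F c2 (k z)" if zS: "z \<in> S" for z
    proof -
      obtain t where t: "t \<in> ball s r" "z = cone m1 \<psi>1 t" using zS unfolding S_def by blast
      then have "Re t < R" using SR by blast
      then show ?thesis using eq t kt by simp
    qed
    show "chart_inv c1 (cone m1 \<psi>1 s) \<notin> \<Z>" using cone_nonzero(1)[OF c1] s R by simp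
    show "chart_inv c2 (k (cone m1 \<psi>1 s)) \<notin> \<Z>" unfolding kt[OF sr] using cone_nonzero(1)[OF c2] s' R
      by simp
  qed
  then show ?thesis unfolding kt[OF sr] .
qed

end

section \<open>The relations\<close>

context harmonic_surface_map
begin

text \<open>If one of the related points is a zero, clause (2), applied with \<open>U1\<close> and
  \<open>U2\<close> as the given neighbourhoods, produces a related pair of regular points in them,
  provided that a punctured neighbourhood is not empty.\<close>

lemma sim'_imp_sim_regular_nearby:
  assumes s: "sim' X A B \<nu> f p1 p2"
    and U: "openin X U1" "p1 \<in> U1" "openin X U2" "p2 \<in> U2"
  shows "\<exists>q1\<in>U1. \<exists>q2\<in>U2. sim_regular X A B \<nu> f q1 q2"
proof -
  obtain q1 q2 where q: "q1 \<in> U1" "q2 \<in> U2" "sim X A B \<nu> f q1 q2"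
    using s U unfolding sim'_def by blast
  show ?thesis
  proof (cases "q1 \<notin> \<Z> \<and> q2 \<notin> \<Z>")
    case True
    then show ?thesis using q unfolding sim_def by auto
  next
    case False
    have pre: "openin X U1 \<and> q1 \<in> U1 \<and> openin X U2 \<and> q2 \<in> U2" using U q(1,2) by blast
    from q(3)[unfolded sim_def if_not_P[OF False], THEN spec, THEN spec, THEN mp, OF pre]
    obtain V1 V2 where V: "openin X V1" "q1 \<in> V1" "V1 \<subseteq> U1" "V2 \<subseteq> U2"
      "\<And>r1. r1 \<in> V1 - {q1} \<Longrightarrow> \<exists>r2 \<in> V2 - {q2}. sim_regular X A B \<nu> f r1 r2" by metis
    have "q1 \<in> topspace X" using V openin_subset by blast
    then obtain c m e \<psi> where cc: "cone_chart c q1 m e \<psi>" by (rule cone_chart_exists)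
    obtain \<rho>0 where \<rho>0: "\<And>\<rho>. \<rho> \<le> \<rho>0 \<Longrightarrow> chart_inv c ` \<psi> ` ball 0 (radius m \<rho>) \<subseteq> V1"
      using cone_nbhd_small[OF cc V(1,2)] by blast
    define \<rho> where "\<rho> = min \<rho>0 (height m e)"
    have \<rho>: "\<rho> \<le> \<rho>0" "\<rho> \<le> height m e" by (auto simp: \<rho>_def)
    \<comment> \<open>Any number with real part below \<open>\<rho>\<close> exhibits a point of
      \<open>V1\<close> other than \<open>q1\<close>.\<close>
    have "chart_inv c (cone m \<psi> (of_real (\<rho> - 1))) \<in> chart_inv c ` \<psi> ` ball 0 (radius m \<rho>) - {q1}"
      unfolding cone_nbhd(3)[OF cc \<rho>(2)] by (intro imageI) simp
    then have "chart_inv c (cone m \<psi> (of_real (\<rho> - 1))) \<in> V1 - {q1}" using \<rho>0[OF \<rho>(1)] by blast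
    then show ?thesis using V by blast
  qed
qed

text \<open>Lifts a germ from the surface to the half-planes. The lift breaks down where a point is
  the centre of its cone, and the related points may well be \<open>p1\<close> or \<open>p2\<close>;
  so it is taken at a nearby point of the domain of the germ.\<close>

lemma cone_germs:
  assumes s: "sim' X A B \<nu> f p1 p2"
    and c1: "cone_chart c1 p1 m1 e1 \<psi>1" and c2: "cone_chart c2 p2 m2 e2 \<psi>2"
    and R: "R \<le> height m1 e1" "R \<le> height m2 e2"
  shows "\<exists>s1 r g. r > 0 \<and> ball s1 r \<subseteq> {s. Re s < R} \<and> g holomorphic_on ball s1 r \<and>
      g ` ball s1 r \<subseteq> {s. Re s < R} \<and> (\<forall>s\<in>ball s1 r. F c1 (cone m1 \<psi>1 s) = F c2 (cone m2 \<psi>2 (g s))) \<and>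
      Re s1 < N \<and> Re (g s1) < N"
proof -
  define N' where "N' = min N R"
  have N': "N' \<le> N" "N' \<le> R" "N' \<le> height m1 e1" "N' \<le> height m2 e2" using R by (auto simp: N'_def)
  let ?B1 = "\<psi>1 ` ball 0 (radius m1 N')" and ?B2 = "\<psi>2 ` ball 0 (radius m2 N')"
  note n1 = cone_nbhd[OF c1 N'(3)] and n2 = cone_nbhd[OF c2 N'(4)]
  note D1 = cone_chartD[OF c1] and D2 = cone_chartD[OF c2]
  note C1 = is_chartD[OF chart[OF D1(1)]] and C2 = is_chartD[OF chart[OF D2(1)]]
  have re: "radius m1 N' \<le> e1" "radius m2 N' \<le> e2" using radius_le D1(3) D2(3) N' by auto
  note o1 = open_image_ball[OF c1 re(1)] and o2 = open_image_ball[OF c2 re(2)]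
  obtain q1 q2 where q: "q1 \<in> chart_inv c1 ` ?B1" "q2 \<in> chart_inv c2 ` ?B2"
      "sim_regular X A B \<nu> f q1 q2"
    using sim'_imp_sim_regular_nearby[OF s n1(1,2) n2(1,2)] by blast
  have q1: "q1 \<in> fst c1" "snd c1 q1 \<in> ?B1" using q(1) o1(2) C1(7,8) by auto
  have q2: "q2 \<in> fst c2" "snd c2 q2 \<in> ?B2" using q(2) o2(2) C2(7,8) by auto
  obtain r k where k: "r > 0" "ball (snd c1 q1) r \<subseteq> U c1" "k holomorphic_on ball (snd c1 q1) r"
    "inj_on k (ball (snd c1 q1) r)" "k ` ball (snd c1 q1) r \<subseteq> U c2" "k (snd c1 q1) = snd c2 q2"
    "\<And>z. z \<in> ball (snd c1 q1) r \<Longrightarrow> F c1 z = F c2 (k z)"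
    by (rule sim_regular_germ[OF q(3) D1(1) q1(1) D2(1) q2(1)]) (assumption | rule that)+
  let ?b = "ball (snd c1 q1) r"
  have ck: "continuous_on ?b k" using k(3) by (rule holomorphic_on_imp_continuous_on)
  \<comment> \<open>The points near the first centre whose images are near the second. This set is
    open and nonempty, hence infinite, while only finitely many points lie at, or are mapped to, a
    centre, because \<open>k\<close> is injective.\<close>
  define T where "T = (?b \<inter> k -` ?B2) \<inter> ?B1"
  have oT: "open T" unfolding T_def by (intro open_Int continuous_open_preimage[OF ck open_ball
      o2(1)] o1(1))
  have "snd c1 q1 \<in> T" using q1(2) q2(2) k(1,6) by (simp add: T_def)
  then have "infinite T" using oT finite_imp_not_open by blast
  moreover have "finite ({\<psi>1 0} \<union> {z \<in> ?b. k z = \<psi>2 0})"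
  proof -
    have "finite (k -` {\<psi>2 0} \<inter> ?b)" using k(4) by (intro finite_vimage_IntI) auto
    moreover have "{z \<in> ?b. k z = \<psi>2 0} = k -` {\<psi>2 0} \<inter> ?b" by auto
    ultimately show ?thesis by simp
  qed
  ultimately have "T - ({\<psi>1 0} \<union> {z \<in> ?b. k z = \<psi>2 0}) \<noteq> {}"
    by (metis Diff_infinite_finite finite.emptyI)
  then obtain z where z: "z \<in> T" "z \<noteq> \<psi>1 0" "\<not> (z \<in> ?b \<and> k z = \<psi>2 0)" by blast
  have zb: "z \<in> ?b" using z(1) by (simp add: T_def)
  obtain x1 where x1: "x1 \<in> ball 0 (radius m1 N')" "z = \<psi>1 x1" using z(1) unfolding T_def by blast
  obtain x2 where x2: "x2 \<in> ball 0 (radius m2 N')" "k z = \<psi>2 x2" using z(1) unfolding T_def by blast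
  have nz: "x1 \<noteq> 0" "x2 \<noteq> 0" using z(2,3) zb x1 x2 by auto
  define s1 where "s1 = cone_log m1 x1"
  define s2 where "s2 = cone_log m2 x2"
  have s1: "cone m1 \<psi>1 s1 = z" "Re s1 < N'" unfolding s1_def
    using cone_cone_log[OF nz(1)] Re_cone_log[OF nz(1) x1(1)] x1(2) by auto
  have s2: "cone m2 \<psi>2 s2 = k z" "Re s2 < N'" unfolding s2_def
    using cone_cone_log[OF nz(2)] Re_cone_log[OF nz(2) x2(1)] x2(2) by auto
  have s2R: "Re s2 < R" using s2(2) N'(2) by simp
  obtain r2 \<beta> where \<beta>: "r2 > 0" "ball s2 r2 \<subseteq> {s. Re s < R}" "inj_on (cone m2 \<psi>2) (ball s2 r2)"
    "open (cone m2 \<psi>2 ` ball s2 r2)" "\<beta> holomorphic_on cone m2 \<psi>2 ` ball s2 r2"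
    "\<And>t. t \<in> ball s2 r2 \<Longrightarrow> \<beta> (cone m2 \<psi>2 t) = t"
    by (rule cone_local_inverse[OF c2 s2R R(2)]) (assumption | rule that)+
  let ?L = "{s. Re s < R}"
  have h1: "cone m1 \<psi>1 holomorphic_on ?L"
    by (rule holomorphic_on_subset[OF cone_holomorphic[OF c1]]) (use R in auto)
  define P where "P = ?b \<inter> k -` (cone m2 \<psi>2 ` ball s2 r2)"
  have oP: "open P" unfolding P_def by (rule continuous_open_preimage[OF ck open_ball \<beta>(4)])
  have "open (?L \<inter> cone m1 \<psi>1 -` P)"
    by (rule continuous_open_preimage[OF holomorphic_on_imp_continuous_on[OF h1]
        open_halfspace_Re_lt oP])
  moreover have "k z \<in> cone m2 \<psi>2 ` ball s2 r2" using s2(1) \<beta>(1) by (intro image_eqI[of _ _ s2]) auto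
  then have "s1 \<in> ?L \<inter> cone m1 \<psi>1 -` P" using s1 N'(2) zb by (auto simp: P_def)
  ultimately obtain r1 where r1: "r1 > 0" "ball s1 r1 \<subseteq> ?L \<inter> cone m1 \<psi>1 -` P" using openE by blast
  have inP: "cone m1 \<psi>1 s \<in> P" if "s \<in> ball s1 r1" for s using r1(2) that by blast
  \<comment> \<open>The germ in the parameters: first cone, \<open>k\<close>, then the local inverse
    \<open>\<beta>\<close> of the second cone around \<open>s2\<close>.\<close>
  define g where "g = (\<lambda>s. \<beta> (k (cone m1 \<psi>1 s)))"
  have g: "g s \<in> ball s2 r2 \<and> cone m2 \<psi>2 (g s) = k (cone m1 \<psi>1 s)" if "s \<in> ball s1 r1" for s
  proof -
    have "k (cone m1 \<psi>1 s) \<in> cone m2 \<psi>2 ` ball s2 r2" using inP[OF that] by (simp add: P_def)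
    then obtain t where "t \<in> ball s2 r2" "k (cone m1 \<psi>1 s) = cone m2 \<psi>2 t" by blast
    then show ?thesis using \<beta>(6) by (simp add: g_def)
  qed
  have "(\<lambda>s. k (cone m1 \<psi>1 s)) holomorphic_on ball s1 r1"
  proof (rule holomorphic_on_compose_gen[OF _ k(3), unfolded o_def])
    show "cone m1 \<psi>1 holomorphic_on ball s1 r1"
      by (rule holomorphic_on_subset[OF h1]) (use r1(2) in blast)
    show "cone m1 \<psi>1 ` ball s1 r1 \<subseteq> ?b" using inP by (auto simp: P_def)
  qed
  then have hg: "g holomorphic_on ball s1 r1"
    unfolding g_def
    by (rule holomorphic_on_compose_gen[OF _ \<beta>(5), unfolded o_def]) (use inP in \<open>auto simp: P_def\<close>)
  have "s1 \<in> ball s1 r1" using r1(1) by simp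
  have gs1: "g s1 = s2"
    unfolding g_def s1(1) s2(1)[symmetric] using \<beta>(1) by (intro \<beta>(6)) simp
  have "F c1 (cone m1 \<psi>1 s) = F c2 (cone m2 \<psi>2 (g s))" if "s \<in> ball s1 r1" for s
    using g[OF that] k(7) inP[OF that] by (simp add: P_def)
  moreover have "g ` ball s1 r1 \<subseteq> ?L" using g \<beta>(2) by blast
  moreover have "ball s1 r1 \<subseteq> ?L" using r1(2) by blast
  ultimately show ?thesis
    using r1(1) hg gs1 s1(2) s2(2) N'(1) by (intro exI[of _ s1] exI[of _ r1] exI[of _ g]) auto
qed

theorem sim'_imp_sim:
  assumes s: "sim' X A B \<nu> f p1 p2" and p: "p1 \<in> topspace X" "p2 \<in> topspace X"
  shows "sim X A B \<nu> f p1 p2"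
proof -
  obtain c1 m1 e1 \<psi>1 where c1: "cone_chart c1 p1 m1 e1 \<psi>1" by (rule cone_chart_exists[OF p(1)])
  obtain c2 m2 e2 \<psi>2 where c2: "cone_chart c2 p2 m2 e2 \<psi>2" by (rule cone_chart_exists[OF p(2)])
  note D1 = cone_chartD[OF c1] and D2 = cone_chartD[OF c2]
  note C1 = is_chartD[OF chart[OF D1(1)]] and C2 = is_chartD[OF chart[OF D2(1)]]
  define R where "R = min (height m1 e1) (height m2 e2)"
  have R: "R \<le> height m1 e1" "R \<le> height m2 e2" by (auto simp: R_def)
  \<comment> \<open>Any number below \<open>R\<close> serves; \<open>germ_limit\<close> needs a
    margin.\<close>
  define R' where "R' = R - 1"
  have R': "R' < R" "R' \<le> height m1 e1" "R' \<le> height m2 e2" using R by (auto simp: R'_def)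
  have "\<exists>k<m2 + 2. \<forall>s. Re s < R' \<longrightarrow> F c1 (cone m1 \<psi>1 s)
      = F c2 (cone m2 \<psi>2 (s + \<i> * of_real pi * of_nat k))"
  proof (rule germ_limit[OF target cone_harmonic[OF c1 R(1)] cone_harmonic[OF c2 R(2)] _ _ _ _ _ R'(1)])
    show "hopf_plane B \<nu> (\<lambda>s. F c1 (cone m1 \<psi>1 s)) s = exp (2 * s)" if "Re s < R" for s
      using cone_hopf[OF c1] that R by simp
    show "hopf_plane B \<nu> (\<lambda>s. F c2 (cone m2 \<psi>2 s)) s = exp (2 * s)" if "Re s < R" for s
      using cone_hopf[OF c2] that R by simp
    show "F c2 (cone m2 \<psi>2 (s + \<i> * of_real pi * of_int (int (m2 + 2) * j))) = F c2 (cone m2 \<psi>2 s)"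
        for s j
      by (simp only: cone_periodic)
    show "0 < m2 + 2" by simp
  qed (rule cone_germs[OF s c1 c2 R])
  then obtain k :: nat where k: "\<And>s. Re s < R' \<Longrightarrow>
      F c1 (cone m1 \<psi>1 s) = F c2 (cone m2 \<psi>2 (s + \<i> * of_real pi * of_nat k))"
    by blast
  define \<tau> where "\<tau> = \<i> * of_real pi * of_nat k"
  have \<tau>: "Re \<tau> = 0" "Re (- \<tau>) = 0" by (simp_all add: \<tau>_def)
  have eq: "F c1 (cone m1 \<psi>1 s) = F c2 (cone m2 \<psi>2 (s + \<tau>))" if "Re s < R'" for s
    using k[OF that] by (simp add: \<tau>_def)
  have eq': "F c2 (cone m2 \<psi>2 s) = F c1 (cone m1 \<psi>1 (s + - \<tau>))" if "Re s < R'" for s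
    using eq[of "s + - \<tau>"] that \<tau> by simp
  show ?thesis
  proof (cases "p1 \<notin> \<Z> \<and> p2 \<notin> \<Z>")
    case True
    then have m0: "m1 = 0" "m2 = 0" using D1(8) D2(8) by auto
    \<comment> \<open>At regular points the exponent \<open>(m + 2) / 2\<close> is 1. The
      translation by \<open>\<tau>\<close> becomes multiplication by
      \<open>\<sigma> = exp \<tau>\<close> in the coordinate \<open>x = exp s\<close>, which is
      defined at the centre too.\<close>
    have cone0: "cone 0 \<psi> s = \<psi> (exp s)" for \<psi> s by (simp add: cone_def)
    define \<epsilon> where "\<epsilon> = exp R'"
    have \<epsilon>: "\<epsilon> > 0" "\<epsilon> \<le> e1" "\<epsilon> \<le> e2"
      using R' radius_le[OF D1(3), of 0 R'] radius_le[OF D2(3), of 0 R'] m0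
        by (auto simp: \<epsilon>_def radius_def)
    define \<sigma> where "\<sigma> = exp \<tau>"
    have n\<sigma>: "norm \<sigma> = 1" using \<tau> by (simp add: \<sigma>_def)
    have \<sigma>b: "\<sigma> * x \<in> ball 0 \<epsilon>" if "x \<in> ball 0 \<epsilon>" for x using that n\<sigma> by (simp add: norm_mult)
    have b: "ball (0::complex) \<epsilon> \<subseteq> ball 0 e1" "ball (0::complex) \<epsilon> \<subseteq> ball 0 e2" using \<epsilon>
      by (auto intro: subset_ball)
    have h1: "\<psi>1 holomorphic_on ball 0 \<epsilon>" and h2: "\<psi>2 holomorphic_on ball 0 \<epsilon>"
      using holomorphic_on_subset[OF D1(4) b(1)] holomorphic_on_subset[OF D2(4) b(2)] by blast+
    have i1: "inj_on \<psi>1 (ball 0 \<epsilon>)" and i2: "inj_on \<psi>2 (ball 0 \<epsilon>)"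
      using inj_on_subset[OF D1(5) b(1)] inj_on_subset[OF D2(5) b(2)] by blast+
    have sub1: "\<psi>1 ` ball 0 \<epsilon> \<subseteq> U c1" and sub2: "\<psi>2 ` ball 0 \<epsilon> \<subseteq> U c2" using b D1(6) D2(6) by blast+
    have h2\<sigma>: "(\<lambda>x. \<psi>2 (\<sigma> * x)) holomorphic_on ball 0 \<epsilon>"
      by (rule holomorphic_on_compose_gen[OF _ h2, unfolded o_def]) (use \<sigma>b in \<open>auto intro!:
          holomorphic_intros\<close>)
    have sub2\<sigma>: "(\<lambda>x. \<psi>2 (\<sigma> * x)) ` ball 0 \<epsilon> \<subseteq> U c2" using sub2 \<sigma>b by blast
    have punctured: "F c1 (\<psi>1 x) = F c2 (\<psi>2 (\<sigma> * x))" if x: "x \<in> ball 0 \<epsilon> - {0}" for x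
    proof -
      have "Re (Ln x) < R'" using x by (simp add: \<epsilon>_def) (metis exp_less_cancel_iff exp_ln
          zero_less_norm_iff)
      from eq[OF this] show ?thesis using x unfolding m0 cone0 by (simp add: \<sigma>_def exp_add mult.commute)
    qed
    \<comment> \<open>The half-plane misses the centres, but clause (1) asks for a germ at
      \<open>p1\<close> itself; unique continuation from the punctured disc fills the gap.\<close>
    have all: "F c1 (\<psi>1 x) = F c2 (\<psi>2 (\<sigma> * x))" if x: "x \<in> ball 0 \<epsilon>" for x
    proof (rule harmonic_unique_continuation[OF target
        harmonic_plane_compose[OF target F_harmonic[OF D1(1)] h1 open_ball sub1]
        harmonic_plane_compose[OF target F_harmonic[OF D2(1)] h2\<sigma> open_ball sub2\<sigma>]
        connected_ball _ _ _ punctured x])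
      show "open (ball 0 \<epsilon> - {0::complex})" by (simp add: open_Diff)
      have "of_real (\<epsilon> / 2) \<in> ball 0 \<epsilon> - {0::complex}" using \<epsilon>(1) by simp
      then show "ball 0 \<epsilon> - {0::complex} \<noteq> {}" by blast
    qed auto
    obtain \<zeta> where \<zeta>: "\<zeta> holomorphic_on \<psi>1 ` ball 0 \<epsilon>" "\<And>x. x \<in> ball 0 \<epsilon> \<Longrightarrow> \<zeta> (\<psi>1 x) = x"
      using holomorphic_has_inverse[OF h1 open_ball i1] by metis
    define h where "h = (\<lambda>z. \<psi>2 (\<sigma> * \<zeta> z))"
    have c0: "0 \<in> ball (0::complex) \<epsilon>" using \<epsilon>(1) by simp
    have "sim_regular X A B \<nu> f (chart_inv c1 (\<psi>1 0)) (chart_inv c2 (h (\<psi>1 0)))"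
    proof (rule germ_sim_regular[OF D1(1) D2(1) open_mapping_thm3[OF h1 open_ball i1] sub1 imageI[OF
        c0]])
      show "h holomorphic_on \<psi>1 ` ball 0 \<epsilon>"
        unfolding h_def by (rule holomorphic_on_compose_gen[OF \<zeta>(1) h2\<sigma>, unfolded o_def]) (use \<zeta>(2)
            in auto)
      show "inj_on h (\<psi>1 ` ball 0 \<epsilon>)"
      proof (rule inj_onI)
        fix z w assume "z \<in> \<psi>1 ` ball 0 \<epsilon>" "w \<in> \<psi>1 ` ball 0 \<epsilon>" and hh: "h z = h w"
        then obtain x y where xy: "x \<in> ball 0 \<epsilon>" "y \<in> ball 0 \<epsilon>" "z = \<psi>1 x" "w = \<psi>1 y" by blast
        then have "\<psi>2 (\<sigma> * x) = \<psi>2 (\<sigma> * y)" using hh \<zeta>(2) by (simp add: h_def)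
        then have "\<sigma> * x = \<sigma> * y" using inj_onD[OF i2] \<sigma>b xy(1,2) by blast
        then show "z = w" using xy by (simp add: \<sigma>_def)
      qed
      show "h ` \<psi>1 ` ball 0 \<epsilon> \<subseteq> U c2"
        using sub2\<sigma> \<zeta>(2) unfolding h_def by auto
      show "F c1 z = F c2 (h z)" if "z \<in> \<psi>1 ` ball 0 \<epsilon>" for z
        using that all \<zeta>(2) by (auto simp: h_def)
      show "chart_inv c1 (\<psi>1 0) \<notin> \<Z>" using True D1(2,7) C1(6) by simp
      show "chart_inv c2 (h (\<psi>1 0)) \<notin> \<Z>" using True D2(2,7) C2(6) \<zeta>(2)[OF c0] by (simp add: h_def)
    qed
    then have "sim_regular X A B \<nu> f p1 p2"
      using D1(2,7) C1(6) D2(2,7) C2(6) \<zeta>(2)[OF c0] by (simp add: h_def)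
    then show ?thesis unfolding sim_def using True by simp
  next
    case False
    show ?thesis
      unfolding sim_def if_not_P[OF False]
    proof (intro allI impI)
      fix W1 W2 assume W: "openin X W1 \<and> p1 \<in> W1 \<and> openin X W2 \<and> p2 \<in> W2"
      obtain a1 where a1: "\<And>\<rho>. \<rho> \<le> a1 \<Longrightarrow> chart_inv c1 ` \<psi>1 ` ball 0 (radius m1 \<rho>) \<subseteq> W1"
        using cone_nbhd_small[OF c1] W by blast
      obtain a2 where a2: "\<And>\<rho>. \<rho> \<le> a2 \<Longrightarrow> chart_inv c2 ` \<psi>2 ` ball 0 (radius m2 \<rho>) \<subseteq> W2"
        using cone_nbhd_small[OF c2] W by blast
      \<comment> \<open>One \<open>\<rho>\<close> for both sides: translation by the imaginary
        number \<open>\<tau>\<close> preserves \<open>Re s < \<rho>\<close>, so it matches the two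
        punctured neighbourhoods, whatever their orders, in both directions.\<close>
      define \<rho> where "\<rho> = min R' (min a1 a2)"
      have \<rho>: "\<rho> \<le> R'" "\<rho> \<le> a1" "\<rho> \<le> a2" "\<rho> \<le> height m1 e1" "\<rho> \<le> height m2 e2"
        using R' by (auto simp: \<rho>_def)
      define V1 where "V1 = chart_inv c1 ` \<psi>1 ` ball 0 (radius m1 \<rho>)"
      define V2 where "V2 = chart_inv c2 ` \<psi>2 ` ball 0 (radius m2 \<rho>)"
      note n1 = cone_nbhd[OF c1 \<rho>(4), folded V1_def] and n2 = cone_nbhd[OF c2 \<rho>(5), folded V2_def]
      have nz1: "(V1 - {p1}) \<inter> \<Z> = {}" unfolding n1(3) using cone_nonzero(1)[OF c1] \<rho>(4) by auto
      have nz2: "(V2 - {p2}) \<inter> \<Z> = {}" unfolding n2(3) using cone_nonzero(1)[OF c2] \<rho>(5) by auto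
      have f12: "\<forall>q1\<in>V1 - {p1}. \<exists>q2\<in>V2 - {p2}. sim_regular X A B \<nu> f q1 q2"
      proof
        fix q1 assume "q1 \<in> V1 - {p1}"
        then obtain s where s: "Re s < \<rho>" "q1 = chart_inv c1 (cone m1 \<psi>1 s)" unfolding n1(3) by blast
        have "sim_regular X A B \<nu> f q1 (chart_inv c2 (cone m2 \<psi>2 (s + \<tau>)))"
          unfolding s(2) by (rule cone_translation_sim_regular[OF c1 c2 R'(2,3) \<tau>(1) eq]) (use s
              \<rho>(1) in auto)
        moreover have "chart_inv c2 (cone m2 \<psi>2 (s + \<tau>)) \<in> V2 - {p2}"
          unfolding n2(3) using s(1) \<tau>(1) by (intro imageI) simp
        ultimately show "\<exists>q2\<in>V2 - {p2}. sim_regular X A B \<nu> f q1 q2" by blast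
      qed
      have f21: "\<forall>q2\<in>V2 - {p2}. \<exists>q1\<in>V1 - {p1}. sim_regular X A B \<nu> f q2 q1"
      proof
        fix q2 assume "q2 \<in> V2 - {p2}"
        then obtain s where s: "Re s < \<rho>" "q2 = chart_inv c2 (cone m2 \<psi>2 s)" unfolding n2(3) by blast
        have "sim_regular X A B \<nu> f q2 (chart_inv c1 (cone m1 \<psi>1 (s + - \<tau>)))"
          unfolding s(2) by (rule cone_translation_sim_regular[OF c2 c1 R'(3,2) \<tau>(2) eq']) (use s
              \<rho>(1) in auto)
        moreover have "chart_inv c1 (cone m1 \<psi>1 (s + - \<tau>)) \<in> V1 - {p1}"
          unfolding n1(3) using s(1) \<tau>(2) by (intro imageI) simp
        ultimately show "\<exists>q1\<in>V1 - {p1}. sim_regular X A B \<nu> f q2 q1" by blast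
      qed
      show "\<exists>V1 V2. openin X V1 \<and> p1 \<in> V1 \<and> V1 \<subseteq> W1 \<and> openin X V2 \<and> p2 \<in> V2 \<and> V2 \<subseteq> W2 \<and>
          (V1 - {p1}) \<inter> \<Z> = {} \<and> (V2 - {p2}) \<inter> \<Z> = {} \<and>
          (\<forall>q1 \<in> V1 - {p1}. \<exists>q2 \<in> V2 - {p2}. sim_regular X A B \<nu> f q1 q2) \<and>
          (\<forall>q2 \<in> V2 - {p2}. \<exists>q1 \<in> V1 - {p1}. sim_regular X A B \<nu> f q2 q1)"
        using n1(1,2) n2(1,2) a1[OF \<rho>(2)] a2[OF \<rho>(3)] nz1 nz2 f12 f21
        unfolding V1_def[symmetric] V2_def[symmetric]
        by (intro exI[of _ V1] exI[of _ V2] conjI)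
    qed
  qed
qed

end

theorem proposition3p4:
  fixes X :: "'a topology" and A :: "('a, complex) chart set" and \<mu> :: "('a, complex) metric"
    and Y :: "'b topology" and B :: "('b, 'h::euclidean_space) chart set"
    and \<nu> :: "('b, 'h) metric" and f :: "'a \<Rightarrow> 'b" and p\<^sub>1 p\<^sub>2 :: 'a
  assumes "riemann_surface X A" and "C2_conformal_metric A \<mu>"
    and "smooth_manifold Y B" and "DIM('h) \<ge> 3" and "C2_riemannian_metric B \<nu>"
    and "harmonic_map X A \<mu> Y B \<nu> f" and "admissible X Y B \<nu> f"
    and "\<exists>c\<in>A. \<exists>z \<in> snd c ` fst c. hopf B \<nu> f c z \<noteq> 0"
    and "p\<^sub>1 \<in> topspace X" and "p\<^sub>2 \<in> topspace X"
    and "sim' X A B \<nu> f p\<^sub>1 p\<^sub>2"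
  shows "sim X A B \<nu> f p\<^sub>1 p\<^sub>2"
proof -
  interpret harmonic_surface_map X A \<mu> Y B \<nu> f
    using assms(1-3,5,6,8) by (rule harmonic_surface_map.intro)
  show ?thesis by (rule sim'_imp_sim[OF assms(11,9,10)])
qed

end
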